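(* For every suitable model $M$ the following holds. Let $(K,\tau)$ be a compact space and let $D\subset K$ be a dense subset that is contained in the set induced by a retractional skeleton on $K$, with $\{K,D,\tau\}\subset M$. Then there exists a unique retraction $r_M:K\to\overline{D\cap M}$ with $r_M[K]=\overline{D\cap M}$ and $f=f\circ r_M$ for every $f\in\mathcal{C}(K)\cap M$. Moreover, for this retraction $r_M$ the following holds: (i) Whenever $\mathcal{A}\subset\mathcal{C}(K)$ separates the points of $K$ and $\mathcal{A}\in M$, then for every $x\in K$, $r_M(x)$ is the unique point of $\overline{D\cap M}$ satisfying $f(r_M(x))=f(x)$ for every $f\in\mathcal{A}\cap M$. (ii) Whenever $(\Gamma,\le)$ is up-directed and $\sigma$-complete and $r:\Gamma\to\mathcal{C}(K,K)$ is a mapping such that $\mathfrak{s}=\{r(s):s\in\Gamma\}$ is a retractional skeleton on $K$ with $D\subset D(\mathfrak{s})$ and $\{r,\Gamma,\le\}\subset M$, then: (a) for every $s\in\Gamma\cap M$, $r(s)[K]\subset\overline{D\cap M}$; (b) $r_M(x)=\lim_{s\in\Gamma\cap M}r(s)(x)$ for every $x\in K$; (c) if $M$ is countable, then $r_M=r(s)$ for $s=\sup(\Gamma\cap M)$; (d) $\{r(s)|_{r_M[K]}: s\in(\Gamma\cap M)_\sigma\}$ is a retractional skeleton on $r_M[K]$ with induced set $D(\mathfrak{s})\cap r_M[K]$; (e) if $\mathfrak{s}$ is commutative, then $r_M[D(\mathfrak{s})]=D(\mathfrak{s})\cap r_M[K]$. (iii) Whenever $h:K\to L$ is a surjective homeomorphism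 with $h\in M$, then $r:=h\circ r_M\circ h^{-1}$ is the unique retraction on $L$ such that $r[L]=\overline{h[D]\cap M}$ and $f\circ r=f$ for every $f\in\mathcal{C}(L)\cap M$. (iv) $w(r_M[K])\le|M|$.
   Context: Suitable models. For a set $N$ and a formula $\phi$ of the language of set theory, the relativization $\phi^N$ is obtained by replacing each quantifier $\exists x$ by $\exists x\in N$ (and $\forall x$ by $\forall x\in N$). A formula $\phi(x_1,\dots,x_n)$ (all free variables shown) is absolute for $N$ if for all $a_1,\dots,a_n\in N$: $\phi^N(a_1,\dots,a_n)\leftrightarrow\phi(a_1,\dots,a_n)$. For a finite list of formulas $\Phi$ and a set $X$, $M\prec(\Phi;X)$ means that $M\supset X$ is a set such that every formula in $\Phi$ is absolute for $M$. The phrase "for every suitable model $M$ (the following holds ...)" means: there exist a finite list of formulas $\Phi$ and a countable set $Y$ such that for every $M\prec(\Phi;Y)$ (the following holds ...). All topological spaces are Tychonoff; retractions are continuous; $w$ denotes weight; $\mathcal{C}(K)$ is the set of real-valued continuous functions on $K$; $\mathcal{C}(K,K)$ is the set of continuous maps $K\to K$. Up-directed means nonempty and any two elements have an upper bound. An up-directed partially ordered set $\Gamma$ is $\sigma$-complete if every increasing sequence $(s_n)_{n\in\omega}$ ($s_n\le s_{n+1}$) has a supremum in $\Gamma$; for $A\subset\Gamma$, $A_\sigma$ denotes the smallest subset of $\Gamma$ containing $A$ and closed under suprema of increasing sequences. A retractional skeleton on a compact space $K$ is a family $\mathfrak{s}=(r_s)_{s\in\Gamma}$ of continuous retractions on $K$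 indexed by an up-directed $\sigma$-complete partially ordered set $\Gamma$ such that: (1) $r_s[K]$ is metrizable compact for each $s$; (2) if $s\le t$ then $r_s=r_t\circ r_s=r_s\circ r_t$; (3) if $(s_n)$ is increasing with $s=\sup_n s_n$, then $r_s(x)=\lim_n r_{s_n}(x)$ for every $x\in K$; (4) $x=\lim_{s\in\Gamma}r_s(x)$ for every $x\in K$. The set induced by $\mathfrak{s}$ is $D(\mathfrak{s})=\bigcup_{s\in\Gamma}r_s[K]$. $\mathfrak{s}$ is commutative if $r_s\circ r_t=r_t\circ r_s$ for all $s,t\in\Gamma$. *)

theory Defs
  imports "HOL-Analysis.Analysis"
begin

unbundle cardinal_syntax

text \<open>
  A universe of sets: the ZFC axioms for a type with an extensional membership map, with
  arbitrary predicates and functions of the logic playing the role of classes (the usual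
  presentation of ZFC in higher-order logic; pairing follows from infinity and replacement,
  choice from the choice operator of HOL).  The type variable of this class ranges over all
  such universes.
\<close>

class set_universe =
  fixes elts :: "'a \<Rightarrow> 'a set"
  assumes extensionality: "elts x = elts y \<Longrightarrow> x = y"
    and foundation: "wf {(x, y). x \<in> elts y}"
    and separation: "Y \<subseteq> elts x \<Longrightarrow> Y \<in> range elts"
    and union: "\<Union> (elts ` elts x) \<in> range elts"
    and power: "{y. elts y \<subseteq> elts x} \<in> range elts"
    and replacement: "f ` elts x \<in> range elts"
    and infinity: "range (g :: nat \<Rightarrow> 'a) \<in> range elts"

text \<open>The inverse of \<^const>\<open>elts\<close>; it is only meaningful on collections in its range.\<close>

definition set_of :: "'v::set_universe set \<Rightarrow> 'v" where
  "set_of A = (THE x. elts x = A)"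

definition opair :: "'v::set_universe \<Rightarrow> 'v \<Rightarrow> 'v" where
  "opair a b = set_of {set_of {a}, set_of {a, b}}"

definition fun_graph :: "'v::set_universe set \<Rightarrow> ('v \<Rightarrow> 'v) \<Rightarrow> 'v" where
  "fun_graph A g = set_of ((\<lambda>x. opair x (g x)) ` A)"

definition funs :: "'v::set_universe set \<Rightarrow> 'v set \<Rightarrow> 'v set" where
  "funs A B = fun_graph A ` (A \<rightarrow> B)"

definition app :: "'v::set_universe \<Rightarrow> 'v \<Rightarrow> 'v" where
  "app f x = (THE y. opair x y \<in> elts f)"

definition relation_on :: "'v::set_universe \<Rightarrow> 'v \<Rightarrow> bool" where
  "relation_on G R \<longleftrightarrow> elts R \<subseteq> {opair a b | a b. a \<in> elts G \<and> b \<in> elts G}"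

definition rel_of :: "'v::set_universe \<Rightarrow> ('v \<times> 'v) set" where
  "rel_of R = {(a, b). opair a b \<in> elts R}"

lemma elts_set_of:
  assumes "A \<in> range elts"
  shows "elts (set_of A) = A"
proof -
  from assms obtain x where x: "elts x = A" by blast
  have "set_of A = x"
    unfolding set_of_def by (rule the_equality, rule x, rule extensionality, simp add: x)
  with x show ?thesis by simp
qed

lemma elts_doubleton: "elts (set_of {a, b}) = {a, b}"
proof (rule elts_set_of)
  have "range (\<lambda>n::nat. if n = 0 then a else b) = {a, b}"
  proof
    show "{a, b} \<subseteq> range (\<lambda>n::nat. if n = 0 then a else b)"
      using rangeI[of "\<lambda>n::nat. if n = 0 then a else b" 0]
        rangeI[of "\<lambda>n::nat. if n = 0 then a else b" 1] by simp
  qed auto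
  then show "{a, b} \<in> range elts"
    using infinity[of "\<lambda>n. if n = 0 then a else b"] by (simp only:)
qed

lemma elts_singleton: "elts (set_of {a}) = {a}"
  using elts_doubleton[of a a] by simp

lemma opair_inject: "opair a b = opair c d \<longleftrightarrow> a = c \<and> b = d"
proof
  assume "opair a b = opair c d"
  then have "elts ` elts (opair a b) = elts ` elts (opair c d)" by simp
  then have "{{a}, {a, b}} = {{c}, {c, d}}"
    by (simp add: opair_def elts_doubleton elts_singleton)
  then show "a = c \<and> b = d" by (auto simp: doubleton_eq_iff)
qed simp

lemma elts_fun_graph: "elts (fun_graph (elts u) g) = (\<lambda>x. opair x (g x)) ` elts u"
  unfolding fun_graph_def by (rule elts_set_of[OF replacement])

lemma app_fun_graph: "x \<in> elts u \<Longrightarrow> app (fun_graph (elts u) g) x = g x"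
  unfolding app_def elts_fun_graph
  by (rule the_equality) (auto simp: opair_inject)

section \<open>Formulas of the language of set theory and suitable models\<close>

datatype formula =
    Mem nat nat
  | Equal nat nat
  | Neg formula
  | Conj formula formula
  | Exists nat formula
  | Forall nat formula

fun fv :: "formula \<Rightarrow> nat set" where
  "fv (Mem i j) = {i, j}"
| "fv (Equal i j) = {i, j}"
| "fv (Neg p) = fv p"
| "fv (Conj p q) = fv p \<union> fv q"
| "fv (Exists i p) = fv p - {i}"
| "fv (Forall i p) = fv p - {i}"

text \<open>
  \<open>holds N e p\<close> is the truth value under \<open>e\<close> of the relativization of \<open>p\<close> to \<open>N\<close>;
  the formula itself is evaluated with \<open>N = UNIV\<close>.
\<close>

fun holds :: "'v::set_universe set \<Rightarrow> (nat \<Rightarrow> 'v) \<Rightarrow> formula \<Rightarrow> bool" where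
  "holds N e (Mem i j) \<longleftrightarrow> e i \<in> elts (e j)"
| "holds N e (Equal i j) \<longleftrightarrow> e i = e j"
| "holds N e (Neg p) \<longleftrightarrow> \<not> holds N e p"
| "holds N e (Conj p q) \<longleftrightarrow> holds N e p \<and> holds N e q"
| "holds N e (Exists i p) \<longleftrightarrow> (\<exists>a\<in>N. holds N (e(i := a)) p)"
| "holds N e (Forall i p) \<longleftrightarrow> (\<forall>a\<in>N. holds N (e(i := a)) p)"

definition absolute :: "formula \<Rightarrow> 'v::set_universe \<Rightarrow> bool" where
  "absolute p M \<longleftrightarrow>
     (\<forall>e. (\<forall>i\<in>fv p. e i \<in> elts M) \<longrightarrow> (holds (elts M) e p \<longleftrightarrow> holds UNIV e p))"

definition suitable :: "'v::set_universe \<Rightarrow> formula list \<Rightarrow> 'v \<Rightarrow> bool" where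
  "suitable M \<Phi> Y \<longleftrightarrow> elts Y \<subseteq> elts M \<and> (\<forall>p\<in>set \<Phi>. absolute p M)"

definition for_every_suitable_model :: "('v::set_universe \<Rightarrow> bool) \<Rightarrow> bool" where
  "for_every_suitable_model P \<longleftrightarrow>
     (\<exists>\<Phi> Y. countable (elts Y) \<and> (\<forall>M. suitable M \<Phi> Y \<longrightarrow> P M))"

section \<open>Topological spaces and continuous functions\<close>

definition tychonoff_space :: "'a topology \<Rightarrow> bool" where
  "tychonoff_space X \<longleftrightarrow> completely_regular_space X \<and> Hausdorff_space X"

definition top_of :: "'v::set_universe \<Rightarrow> 'v topology" where
  "top_of \<tau> = topology (\<lambda>U. U \<in> elts ` elts \<tau>)"

definition set_space :: "'v::set_universe \<Rightarrow> 'v \<Rightarrow> bool" where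
  "set_space K \<tau> \<longleftrightarrow> istopology (\<lambda>U. U \<in> elts ` elts \<tau>) \<and> topspace (top_of \<tau>) = elts K
     \<and> tychonoff_space (top_of \<tau>)"

text \<open>
  Real numbers enter the universe through an injection \<open>\<rho>\<close> of the type \<^typ>\<open>real\<close>, that is,
  through any fixed choice of sets serving as the real numbers.
\<close>

definition Cfun :: "(real \<Rightarrow> 'v) \<Rightarrow> 'v::set_universe \<Rightarrow> 'v \<Rightarrow> 'v set" where
  "Cfun \<rho> K \<tau> = {f \<in> funs (elts K) (range \<rho>).
     continuous_map (top_of \<tau>) euclideanreal (\<lambda>x. inv \<rho> (app f x))}"

definition Cself :: "'v::set_universe \<Rightarrow> 'v \<Rightarrow> 'v set" where
  "Cself K \<tau> = {f \<in> funs (elts K) (elts K). continuous_map (top_of \<tau>) (top_of \<tau>) (app f)}"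

definition retraction_on :: "'a topology \<Rightarrow> ('a \<Rightarrow> 'a) \<Rightarrow> bool" where
  "retraction_on X r \<longleftrightarrow> continuous_map X X r \<and> (\<forall>x\<in>topspace X. r (r x) = r x)"

definition is_base :: "'a topology \<Rightarrow> 'a set set \<Rightarrow> bool" where
  "is_base X \<B> \<longleftrightarrow> (\<forall>V\<in>\<B>. openin X V) \<and>
     (\<forall>U x. openin X U \<and> x \<in> U \<longrightarrow> (\<exists>V\<in>\<B>. x \<in> V \<and> V \<subseteq> U))"

text \<open>The weight, as the cardinal of a base of least cardinality.\<close>

definition weight :: "'a topology \<Rightarrow> 'a set rel" where
  "weight X = |SOME \<B>. is_base X \<B> \<and> (\<forall>\<B>'. is_base X \<B>' \<longrightarrow> |\<B>| \<le>o |\<B>'| )|"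

section \<open>Directed sets and retractional skeletons\<close>

definition up_directed :: "'i set \<Rightarrow> 'i rel \<Rightarrow> bool" where
  "up_directed I le \<longleftrightarrow> I \<noteq> {} \<and> (\<forall>s\<in>I. \<forall>t\<in>I. \<exists>u\<in>I. (s, u) \<in> le \<and> (t, u) \<in> le)"

definition is_sup :: "'i set \<Rightarrow> 'i rel \<Rightarrow> 'i set \<Rightarrow> 'i \<Rightarrow> bool" where
  "is_sup I le A s \<longleftrightarrow> s \<in> I \<and> (\<forall>a\<in>A. (a, s) \<in> le) \<and>
     (\<forall>u\<in>I. (\<forall>a\<in>A. (a, u) \<in> le) \<longrightarrow> (s, u) \<in> le)"

definition increasing_in :: "'i set \<Rightarrow> 'i rel \<Rightarrow> (nat \<Rightarrow> 'i) \<Rightarrow> bool" where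
  "increasing_in A le \<sigma> \<longleftrightarrow> range \<sigma> \<subseteq> A \<and> (\<forall>n. (\<sigma> n, \<sigma> (Suc n)) \<in> le)"

definition sigma_complete :: "'i set \<Rightarrow> 'i rel \<Rightarrow> bool" where
  "sigma_complete I le \<longleftrightarrow> (\<forall>\<sigma>. increasing_in I le \<sigma> \<longrightarrow> (\<exists>s. is_sup I le (range \<sigma>) s))"

definition sigma_closure :: "'i set \<Rightarrow> 'i rel \<Rightarrow> 'i set \<Rightarrow> 'i set" where
  "sigma_closure I le A = \<Inter> {B. A \<subseteq> B \<and> B \<subseteq> I \<and>
     (\<forall>\<sigma> s. increasing_in B le \<sigma> \<and> is_sup I le (range \<sigma>) s \<longrightarrow> s \<in> B)}"

text \<open>
  Convergence of a net; directedness is included, because otherwise the filter below may be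
  trivial and everything would be a limit.
\<close>

definition net_limit ::
  "'a topology \<Rightarrow> 'i set \<Rightarrow> 'i rel \<Rightarrow> ('i \<Rightarrow> 'a) \<Rightarrow> 'a \<Rightarrow> bool" where
  "net_limit X I le f l \<longleftrightarrow> up_directed I le \<and>
     limitin X f l (INF s\<in>I. principal {t \<in> I. (s, t) \<in> le})"

definition retractional_skeleton ::
  "'a topology \<Rightarrow> 'i set \<Rightarrow> 'i rel \<Rightarrow> ('i \<Rightarrow> 'a \<Rightarrow> 'a) \<Rightarrow> bool" where
  "retractional_skeleton X I le r \<longleftrightarrow>
     compact_space X \<and> tychonoff_space X \<and>
     partial_order_on I le \<and> up_directed I le \<and> sigma_complete I le \<and>
     (\<forall>s\<in>I. retraction_on X (r s)) \<and>
     (\<forall>s\<in>I. compact_space (subtopology X (r s ` topspace X)) \<and>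
             metrizable_space (subtopology X (r s ` topspace X))) \<and>
     (\<forall>s\<in>I. \<forall>t\<in>I. (s, t) \<in> le \<longrightarrow>
        (\<forall>x\<in>topspace X. r s x = r t (r s x) \<and> r s x = r s (r t x))) \<and>
     (\<forall>\<sigma> s. increasing_in I le \<sigma> \<and> is_sup I le (range \<sigma>) s \<longrightarrow>
        (\<forall>x\<in>topspace X. limitin X (\<lambda>n. r (\<sigma> n) x) (r s x) sequentially)) \<and>
     (\<forall>x\<in>topspace X. net_limit X I le (\<lambda>s. r s x) x)"

definition induced_set :: "'a topology \<Rightarrow> 'i set \<Rightarrow> ('i \<Rightarrow> 'a \<Rightarrow> 'a) \<Rightarrow> 'a set" where
  "induced_set X I r = (\<Union>s\<in>I. r s ` topspace X)"

definition commutative_skeleton :: "'a topology \<Rightarrow> 'i set \<Rightarrow> ('i \<Rightarrow> 'a \<Rightarrow> 'a) \<Rightarrow> bool" where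
  "commutative_skeleton X I r \<longleftrightarrow>
     (\<forall>s\<in>I. \<forall>t\<in>I. \<forall>x\<in>topspace X. r s (r t x) = r t (r s x))"

text \<open>Families of self-maps, and skeletons, that are elements of the universe.\<close>

definition app2 :: "'v::set_universe \<Rightarrow> 'v \<Rightarrow> 'v \<Rightarrow> 'v" where
  "app2 r s x = app (app r s) x"

definition skeleton :: "'v::set_universe \<Rightarrow> 'v \<Rightarrow> 'v \<Rightarrow> 'v \<Rightarrow> 'v \<Rightarrow> bool" where
  "skeleton K \<tau> \<Gamma> le r \<longleftrightarrow> relation_on \<Gamma> le \<and> r \<in> funs (elts \<Gamma>) (Cself K \<tau>) \<and>
     retractional_skeleton (top_of \<tau>) (elts \<Gamma>) (rel_of le) (app2 r)"

text \<open>
  \<open>r\<close> is a retraction of \<open>K\<close> onto \<open>F\<close> with \<open>f = f \<circ> r\<close> for all \<open>f\<close> in both \<open>Cfun \<rho> K \<tau>\<close> and \<open>M\<close>.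
\<close>

definition model_retraction ::
  "(real \<Rightarrow> 'v) \<Rightarrow> 'v::set_universe \<Rightarrow> 'v \<Rightarrow> 'v \<Rightarrow> 'v set \<Rightarrow> 'v \<Rightarrow> bool" where
  "model_retraction \<rho> M K \<tau> F r \<longleftrightarrow>
     r \<in> funs (elts K) (elts K) \<and> retraction_on (top_of \<tau>) (app r) \<and> app r ` elts K = F \<and>
     (\<forall>f \<in> Cfun \<rho> K \<tau> \<inter> elts M. \<forall>x\<in>elts K. app f x = app f (app r x))"

end

theory Submission
  imports Defs
begin

text \<open>
  For a directed \<open>G \<subseteq> \<Gamma>\<close> the retractions \<open>r s\<close> with \<open>s \<in> G\<close> separate the points of the closure of
  \<open>\<Union>s\<in>G. r s[K]\<close>: given two points, a chain in \<open>G\<close> that is closed under a countable approximation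
  procedure reduces the claim to the supremum of the chain.  Hence there are finitely many operations
  such that every set \<open>N\<close> closed under them contains enough continuous functions to separate the points of
  the closure of \<open>D \<inter> N\<close>.  Their existence is expressible in the language of set theory, so the
  operations can be found in \<open>M\<close>, and \<open>C(K) \<inter> M\<close> separates the points of \<open>F\<close>, the closure of
  \<open>D \<inter> M\<close>.  The point \<open>r\<^sub>M(x)\<close> is the unique point of \<open>F\<close> that no function in \<open>C(K) \<inter> M\<close>
  distinguishes from \<open>x\<close>; it exists, and depends continuously on \<open>x\<close>, because the open sets of \<open>M\<close>
  are closed under finite intersections and meet \<open>D\<close> in a point of \<open>M\<close> unless they are empty.
\<close>

section \<open>Directed sets and chains\<close>

text \<open>The formulas and the countable parameter set are fixed before \<open>K\<close>,
  \<open>D\<close> and the model are given, and a skeleton whose induced set contains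
  \<open>D\<close> need not lie in \<open>M\<close>, so nothing can be said directly about its
  indices in \<open>M\<close>. What survives is a statement about \<open>K\<close>, \<open>D\<close>
  and \<open>\<tau>\<close> alone: there are three operations, producing upper bounds of indices, an
  index whose retraction fixes a given point of \<open>D\<close>, and functions that separate
  whatever a given retraction separates. The sets closed under the operations are quantified over as
  elements of the universe, which makes the statement a first-order formula and lets
  \<open>M\<close> itself be one of these sets. A second obstacle is that \<open>M\<close> need not
  be countable or transitive. A countable set that belongs to \<open>M\<close> is nevertheless
  contained in \<open>M\<close>, because some enumeration of it belongs to \<open>M\<close> and so
  do all natural numbers. This is why so much is reduced to countable sets: countably many points of
  \<open>D\<close> whose closure covers the image of a retraction, countably many functions that
  determine a given one. Such sets can be reflected into \<open>M\<close>, and their elements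
  follow.\<close>

lemma countable_closure:
  assumes "countable S" "S \<subseteq> G"
    and "\<And>x y. x \<in> G \<Longrightarrow> y \<in> G \<Longrightarrow> countable (h x y) \<and> h x y \<subseteq> G"
  shows "\<exists>T. S \<subseteq> T \<and> T \<subseteq> G \<and> countable T \<and> (\<forall>x\<in>T. \<forall>y\<in>T. h x y \<subseteq> T)"
proof -
  \<comment> \<open>The stages of the iteration increase, so two points of the union lie in a common
    stage and \<open>h\<close> of them is absorbed one stage later.\<close>
  define step where "step T = T \<union> (\<Union>x\<in>T. \<Union>y\<in>T. h x y)" for T
  define T where "T n = (step ^^ n) S" for n
  have T0: "T 0 = S" and TS: "T (Suc n) = step (T n)" for n
    by (simp_all add: T_def)
  have T: "countable (T n) \<and> T n \<subseteq> G" for n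
  proof (induction n)
    case 0
    then show ?case using assms T0 by simp
  next
    case (Suc n)
    have "h x y \<subseteq> G \<and> countable (h x y)" if "x \<in> T n" "y \<in> T n" for x y
      using Suc that assms(3) by (meson subsetD)
    then show ?case
      using Suc unfolding TS step_def by (auto intro!: countable_UN)
  qed
  have mono: "mono T"
    by (rule mono_iff_le_Suc[THEN iffD2]) (auto simp: TS step_def)
  have "h x y \<subseteq> (\<Union>n. T n)" if "x \<in> T m" "y \<in> T n" for x y m n
  proof -
    have "x \<in> T (max m n)" "y \<in> T (max m n)"
      using that monoD[OF mono] by (meson max.cobounded1 max.cobounded2 subsetD)+
    then have "h x y \<subseteq> T (Suc (max m n))"
      unfolding TS step_def by blast
    then show ?thesis by blast
  qed
  then have "\<forall>x\<in>(\<Union>n. T n). \<forall>y\<in>(\<Union>n. T n). h x y \<subseteq> (\<Union>n. T n)"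
    by blast
  moreover have "S \<subseteq> (\<Union>n. T n)"
    using T0 by blast
  moreover have "(\<Union>n. T n) \<subseteq> G" "countable (\<Union>n. T n)"
    using T by blast+
  ultimately show ?thesis by blast
qed

lemma up_directed_nonempty: "up_directed G le \<Longrightarrow> G \<noteq> {}"
  and up_directed_bound:
    "up_directed G le \<Longrightarrow> s \<in> G \<Longrightarrow> t \<in> G \<Longrightarrow> \<exists>u\<in>G. (s, u) \<in> le \<and> (t, u) \<in> le"
  by (simp_all add: up_directed_def)

lemma up_directed_finite:
  assumes "up_directed G le" "trans le" "finite S" "S \<subseteq> G"
  shows "\<exists>u\<in>G. \<forall>s\<in>S. (s, u) \<in> le"
  using assms(3,4)
proof (induction S)
  case empty
  then show ?case using up_directed_nonempty[OF assms(1)] by blast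
next
  case (insert s S)
  then obtain u where "u \<in> G" "\<forall>t\<in>S. (t, u) \<in> le" by blast
  moreover obtain v where "v \<in> G" "(s, v) \<in> le" "(u, v) \<in> le"
    using up_directed_bound[OF assms(1), of s u] insert.prems \<open>u \<in> G\<close> by blast
  ultimately show ?case
    using transD[OF assms(2)] by blast
qed

lemma increasing_in_mono:
  assumes "increasing_in G le \<sigma>" "refl_on G le" "trans le" "m \<le> n"
  shows "(\<sigma> m, \<sigma> n) \<in> le"
  using assms(4)
proof (induction n rule: dec_induct)
  case base
  then show ?case using assms by (auto simp: increasing_in_def refl_on_def)
next
  case (step n)
  then show ?case using assms(1,3) by (meson increasing_in_def transD)
qed

text \<open>The elements are enumerated and absorbed one after another by upper bounds. Together
  with completeness this puts a countable subset of a directed set below a single index, the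
  supremum of the chain.\<close>

lemma up_directed_countable_chain:
  assumes "up_directed G le" "trans le" "countable S" "S \<subseteq> G"
  shows "\<exists>\<sigma>. increasing_in G le \<sigma> \<and> (\<forall>s\<in>S. \<exists>n. (s, \<sigma> n) \<in> le)"
proof -
  obtain g0 where g0: "g0 \<in> G" using up_directed_nonempty[OF assms(1)] by blast
  \<comment> \<open>Inserting \<open>g0\<close> covers the case of empty \<open>S\<close>, where
    \<open>from_nat_into\<close> enumerates nothing.\<close>
  define e where "e = from_nat_into (insert g0 S)"
  have e: "e n \<in> G" for n
  proof -
    have "e n \<in> insert g0 S" unfolding e_def by (rule from_nat_into) simp
    then show ?thesis using g0 assms(4) by auto
  qed
  have "\<exists>u. u \<in> G \<and> (s, u) \<in> le \<and> (t, u) \<in> le" if "s \<in> G" "t \<in> G" for s t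
    using up_directed_bound[OF assms(1)] that by blast
  then obtain v where v: "\<And>s t. s \<in> G \<Longrightarrow> t \<in> G \<Longrightarrow> v s t \<in> G \<and> (s, v s t) \<in> le \<and> (t, v s t) \<in> le"
    by metis
  define \<sigma> where "\<sigma> = rec_nat (e 0) (\<lambda>n x. v x (e n))"
  have \<sigma>S: "\<sigma> (Suc n) = v (\<sigma> n) (e n)" for n by (simp add: \<sigma>_def)
  have \<sigma>G: "\<sigma> n \<in> G" for n
    by (induction n) (use e v in \<open>auto simp: \<sigma>_def\<close>)
  have le: "(\<sigma> n, \<sigma> (Suc n)) \<in> le" "(e n, \<sigma> (Suc n)) \<in> le" for n
    unfolding \<sigma>S using v[OF \<sigma>G e] by blast+
  have "\<exists>n. (s, \<sigma> n) \<in> le" if "s \<in> S" for s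
  proof -
    have "countable (insert g0 S)" "s \<in> insert g0 S" using that assms(3) by simp_all
    then obtain n where "e n = s"
      unfolding e_def using from_nat_into_surj by metis
    then show ?thesis using le(2)[of n] by blast
  qed
  moreover have "increasing_in G le \<sigma>"
    unfolding increasing_in_def using \<sigma>G le(1) by blast
  ultimately show ?thesis by blast
qed

text \<open>Closing the point \<open>s0\<close> under \<open>h\<close> and under a choice of upper
  bounds gives a countable directed set; a chain cofinal in it has all the properties.\<close>

lemma up_directed_closed_chain:
  assumes "up_directed G le" "trans le" "s0 \<in> G"
    and h: "\<And>t. t \<in> G \<Longrightarrow> countable (h t) \<and> h t \<subseteq> G"
  shows "\<exists>\<sigma>. increasing_in G le \<sigma> \<and> (\<exists>n. (s0, \<sigma> n) \<in> le) \<and>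
    (\<forall>n. \<forall>u\<in>h (\<sigma> n). \<exists>m. (u, \<sigma> m) \<in> le)"
proof -
  have "\<exists>u. u \<in> G \<and> (s, u) \<in> le \<and> (t, u) \<in> le" if "s \<in> G" "t \<in> G" for s t
    using up_directed_bound[OF assms(1)] that by blast
  then obtain v where v: "\<And>s t. s \<in> G \<Longrightarrow> t \<in> G \<Longrightarrow> v s t \<in> G \<and> (s, v s t) \<in> le \<and> (t, v s t) \<in> le"
    by metis
  have "countable (insert (v x y) (h x)) \<and> insert (v x y) (h x) \<subseteq> G" if "x \<in> G" "y \<in> G" for x y
    using h v that by simp
  from countable_closure[of "{s0}" G "\<lambda>x y. insert (v x y) (h x)", OF _ _ this]
  obtain T where "{s0} \<subseteq> T" "T \<subseteq> G" "countable T"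
      and "\<forall>x\<in>T. \<forall>y\<in>T. insert (v x y) (h x) \<subseteq> T"
    using assms(3) by auto
  then have T: "s0 \<in> T" "T \<subseteq> G" "countable T"
    and Tv: "\<And>x y. x \<in> T \<Longrightarrow> y \<in> T \<Longrightarrow> v x y \<in> T" and Th: "\<And>x. x \<in> T \<Longrightarrow> h x \<subseteq> T"
    by blast+
  have "up_directed T le"
    unfolding up_directed_def
  proof (intro conjI ballI)
    show "T \<noteq> {}" using T(1) by blast
    fix x y assume xy: "x \<in> T" "y \<in> T"
    then have "v x y \<in> T" by (rule Tv)
    moreover have "(x, v x y) \<in> le" "(y, v x y) \<in> le" using v[of x y] xy T(2) by blast+
    ultimately show "\<exists>u\<in>T. (x, u) \<in> le \<and> (y, u) \<in> le" by blast
  qed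
  then obtain \<sigma> where \<sigma>: "increasing_in T le \<sigma>" "\<forall>s\<in>T. \<exists>n. (s, \<sigma> n) \<in> le"
    using up_directed_countable_chain[OF _ assms(2) T(3)] by blast
  have "increasing_in G le \<sigma>"
    using \<sigma>(1) T(2) by (auto simp: increasing_in_def)
  moreover have "\<forall>n. \<forall>u\<in>h (\<sigma> n). \<exists>m. (u, \<sigma> m) \<in> le"
  proof (intro allI ballI)
    fix n u assume u: "u \<in> h (\<sigma> n)"
    have "\<sigma> n \<in> T" using \<sigma>(1) by (auto simp: increasing_in_def)
    then have "u \<in> T" using Th u by blast
    then show "\<exists>m. (u, \<sigma> m) \<in> le" using \<sigma>(2) by blast
  qed
  ultimately show ?thesis using \<sigma>(2) T(1) by blast
qed

text \<open>Directedness makes the tails a filter base, so convergence can be tested on single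
  tails.\<close>

lemma net_limit_iff:
  assumes "up_directed G le" "trans le"
  shows "net_limit X G le f l \<longleftrightarrow> l \<in> topspace X \<and>
    (\<forall>U. openin X U \<and> l \<in> U \<longrightarrow> (\<exists>s\<in>G. \<forall>t\<in>G. (s, t) \<in> le \<longrightarrow> f t \<in> U))"
proof -
  have "eventually P (INF s\<in>G. principal {t \<in> G. (s, t) \<in> le}) \<longleftrightarrow>
      (\<exists>s\<in>G. \<forall>t\<in>G. (s, t) \<in> le \<longrightarrow> P t)" for P
  proof (subst eventually_INF_base)
    show "G \<noteq> {}" using up_directed_nonempty[OF assms(1)] by blast
    show "\<exists>x\<in>G. principal {t \<in> G. (x, t) \<in> le} \<le>
        inf (principal {t \<in> G. (a, t) \<in> le}) (principal {t \<in> G. (b, t) \<in> le})"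
      if "a \<in> G" "b \<in> G" for a b
    proof -
      from up_directed_bound[OF assms(1) that]
      obtain x where "x \<in> G" "(a, x) \<in> le" "(b, x) \<in> le" by blast
      then show ?thesis
        using transD[OF assms(2)] by (intro bexI[of _ x]) auto
    qed
  qed (auto simp: eventually_principal)
  then show ?thesis
    unfolding net_limit_def limitin_def using assms(1) by simp
qed

section \<open>Retractional skeletons\<close>

lemma compact_metrizable_countable_dense:
  assumes "compact_space X" "metrizable_space X"
  shows "\<exists>Q\<subseteq>topspace X. countable Q \<and> X closure_of Q = topspace X"
proof -
  obtain M d where "Metric_space M d" and X: "X = Metric_space.mtopology M d"
    using assms(2) unfolding metrizable_space_def by blast
  then interpret Metric_space M d by simp
  have "mtotally_bounded M"
    using assms(1) X compactin_imp_mtotally_bounded by (simp add: compact_space_def)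
  then have "\<exists>K. finite K \<and> K \<subseteq> M \<and> M \<subseteq> (\<Union>x\<in>K. mball x (inverse (Suc n)))" for n
    unfolding mtotally_bounded_def by simp
  then obtain K where K: "\<And>n. finite (K n)" "\<And>n. K n \<subseteq> M"
    "\<And>n. M \<subseteq> (\<Union>x\<in>K n. mball x (inverse (Suc n)))" by metis
  have "x \<in> mtopology closure_of (\<Union>n. K n)" if xM: "x \<in> M" for x
    unfolding metric_closure_of
  proof safe
    show "x \<in> M" by fact
    fix e :: real assume "0 < e"
    then obtain n where n: "inverse (Suc n) < e" using reals_Archimedean by blast
    obtain q where "q \<in> K n" "x \<in> mball q (inverse (Suc n))"
      using K(3)[of n] xM by blast
    then have "q \<in> mball x e" using n by (auto simp: commute)
    with \<open>q \<in> K n\<close> show "\<exists>y\<in>\<Union>(range K). y \<in> mball x e" by blast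
  qed
  then have "mtopology closure_of (\<Union>n. K n) = M"
    using closure_of_subset_topspace[of mtopology] by auto
  with K show ?thesis
    by (intro exI[of _ "\<Union>n. K n"]) (auto simp: X countable_finite)
qed

text \<open>The functions are the distances to the points of a countable dense set: a dense point
  closer to \<open>x\<close> than half the distance from \<open>x\<close> to \<open>y\<close> has
  different distances to the two.\<close>

lemma compact_metrizable_countable_separating:
  assumes "compact_space X" "metrizable_space X"
  shows "\<exists>f :: nat \<Rightarrow> 'a \<Rightarrow> real. (\<forall>n. continuous_map X euclideanreal (f n)) \<and>
    (\<forall>x\<in>topspace X. \<forall>y\<in>topspace X. (\<forall>n. f n x = f n y) \<longrightarrow> x = y)"
proof (cases "topspace X = {}")
  case True
  then show ?thesis by (intro exI[of _ "\<lambda>_ _. 0"]) simp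
next
  case False
  obtain Q where Q: "Q \<subseteq> topspace X" "countable Q" "X closure_of Q = topspace X"
    using compact_metrizable_countable_dense[OF assms] by blast
  have "Q \<noteq> {}" using Q(3) False by (metis closure_of_empty)
  obtain M d where MS: "Metric_space M d" and X: "X = Metric_space.mtopology M d"
    using assms(2) unfolding metrizable_space_def by blast
  then interpret Metric_space M d by simp
  define f where "f n x = d (from_nat_into Q n) x" for n x
  have q: "from_nat_into Q n \<in> M" for n
    using from_nat_into[OF \<open>Q \<noteq> {}\<close>, of n] Q(1) X by auto
  have "continuous_map X euclideanreal (f n)" for n
    using continuous_on_mdist[of "from_nat_into Q n" "metric (M, d)"] q
    by (simp add: f_def[abs_def] X mtopology_of_def mspace_metric mdist_metric)
  moreover have "x = y" if "x \<in> M" "y \<in> M" "\<forall>n. f n x = f n y" for x y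
  proof (rule ccontr)
    assume "x \<noteq> y"
    then have "d x y / 2 > 0" using that by simp
    moreover have "x \<in> X closure_of Q" using Q that X by simp
    ultimately obtain p where p: "p \<in> Q" "p \<in> mball x (d x y / 2)"
      unfolding X metric_closure_of by blast
    obtain n where "p = from_nat_into Q n" using from_nat_into_surj[OF Q(2) p(1)] by metis
    then have "d p x = d p y" using that(3) by (simp add: f_def)
    moreover have "d p x < d x y / 2" "p \<in> M" using p by (auto simp: commute)
    moreover have "d x y \<le> d p x + d p y"
      using triangle'[of x p y] that \<open>p \<in> M\<close> commute by (metis triangle)
    ultimately show False by linarith
  qed
  ultimately show ?thesis using X by (intro exI[of _ f]) simp
qed

locale ret_skeleton =
  fixes X :: "'a topology" and I :: "'i set" and le r
  assumes skel: "retractional_skeleton X I le r"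
begin

lemma compact: "compact_space X"
  and tych: "tychonoff_space X"
  and Hausdorff: "Hausdorff_space X"
  and part_ord: "partial_order_on I le"
  and directed: "up_directed I le"
  and complete: "sigma_complete I le"
  using skel unfolding retractional_skeleton_def tychonoff_space_def by auto

lemma le_trans: "trans le" and le_refl: "refl_on I le" and le_sub: "le \<subseteq> I \<times> I"
  and le_antisym: "antisym le"
  using part_ord unfolding partial_order_on_def preorder_on_def by auto

lemma continuous: "s \<in> I \<Longrightarrow> continuous_map X X (r s)"
  using skel unfolding retractional_skeleton_def retraction_on_def by auto

lemma in_space: "s \<in> I \<Longrightarrow> x \<in> topspace X \<Longrightarrow> r s x \<in> topspace X"
  using continuous continuous_map_image_subset_topspace by (metis image_subset_iff)

lemma idem: "s \<in> I \<Longrightarrow> x \<in> topspace X \<Longrightarrow> r s (r s x) = r s x"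
  using skel unfolding retractional_skeleton_def retraction_on_def by auto

lemma comp_le:
  assumes "(s, t) \<in> le" "x \<in> topspace X"
  shows "r t (r s x) = r s x" "r s (r t x) = r s x"
  using skel assms le_sub unfolding retractional_skeleton_def by (metis SigmaD1 SigmaD2 subsetD)+

lemma image_compact: "s \<in> I \<Longrightarrow> compact_space (subtopology X (r s ` topspace X))"
  and image_metrizable: "s \<in> I \<Longrightarrow> metrizable_space (subtopology X (r s ` topspace X))"
  using skel unfolding retractional_skeleton_def by auto

lemma image_sub: "s \<in> I \<Longrightarrow> r s ` topspace X \<subseteq> topspace X"
  using in_space by blast

lemma image_closed: "s \<in> I \<Longrightarrow> closedin X (r s ` topspace X)"
  using compactin_imp_closedin[OF Hausdorff] image_compact image_sub
  by (simp add: compactin_subspace)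

lemma sup_limit:
  "increasing_in I le \<sigma> \<Longrightarrow> is_sup I le (range \<sigma>) s \<Longrightarrow> x \<in> topspace X \<Longrightarrow>
    limitin X (\<lambda>n. r (\<sigma> n) x) (r s x) sequentially"
  using skel unfolding retractional_skeleton_def by blast

lemma in_image_iff: "s \<in> I \<Longrightarrow> x \<in> r s ` topspace X \<longleftrightarrow> x \<in> topspace X \<and> r s x = x"
  using idem[of s] in_space[of s x] in_space[of s] by (auto simp: image_iff) metis

lemma in_image_le: "(s, t) \<in> le \<Longrightarrow> x \<in> r s ` topspace X \<Longrightarrow> x \<in> r t ` topspace X"
  using comp_le(1)[of s t] in_image_iff[of s x] in_image_iff[of t x] le_sub by auto

lemma increasing_in_sub: "increasing_in G le \<sigma> \<Longrightarrow> G \<subseteq> I \<Longrightarrow> increasing_in I le \<sigma>"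
  by (auto simp: increasing_in_def)

lemma increasing_le: "increasing_in I le \<sigma> \<Longrightarrow> m \<le> n \<Longrightarrow> (\<sigma> m, \<sigma> n) \<in> le"
  using increasing_in_mono le_refl le_trans by metis

lemma sup_ex: "increasing_in I le \<sigma> \<Longrightarrow> \<exists>s. is_sup I le (range \<sigma>) s"
  using complete unfolding sigma_complete_def by blast

lemma sup_eqI:
  assumes "increasing_in I le \<sigma>" "is_sup I le (range \<sigma>) s" "x \<in> topspace X" "y \<in> topspace X"
    "\<And>n. r (\<sigma> n) x = r (\<sigma> n) y"
  shows "r s x = r s y"
  using limitin_Hausdorff_unique[OF sup_limit[OF assms(1,2,3)] _ sequentially_bot Hausdorff]
    sup_limit[OF assms(1,2,4)] by (simp only: assms(5))

text \<open>The countable sets \<open>h t\<close> record how \<open>r t z\<close> is approximated by images of points of \<open>A\<close>;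
  along a chain closed under \<open>h\<close> a compactness argument lifts this to the supremum.\<close>

definition approx_fun :: "'i set \<Rightarrow> 'a set \<Rightarrow> 'a \<Rightarrow> ('i \<Rightarrow> 'i set) \<Rightarrow> bool" where
  "approx_fun G A z h \<longleftrightarrow> (\<forall>t\<in>G. countable (h t) \<and> h t \<subseteq> G) \<and>
    (\<forall>\<sigma> s. increasing_in G le \<sigma> \<longrightarrow> is_sup I le (range \<sigma>) s \<longrightarrow>
        (\<forall>n. \<forall>u\<in>h (\<sigma> n). \<exists>m. (u, \<sigma> m) \<in> le) \<longrightarrow>
      (\<exists>C\<subseteq>A. countable C \<and> r s z \<in> X closure_of C))"

lemma approx_funD:
  "approx_fun G A z h \<Longrightarrow> t \<in> G \<Longrightarrow> countable (h t) \<and> h t \<subseteq> G"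
  "approx_fun G A z h \<Longrightarrow> increasing_in G le \<sigma> \<Longrightarrow> is_sup I le (range \<sigma>) s \<Longrightarrow>
    \<forall>n. \<forall>u\<in>h (\<sigma> n). \<exists>m. (u, \<sigma> m) \<in> le \<Longrightarrow> \<exists>C\<subseteq>A. countable C \<and> r s z \<in> X closure_of C"
  unfolding approx_fun_def by simp_all

text \<open>The image of \<open>r t\<close> is metrizable, so \<open>r t z\<close> is the limit of a
  sequence of values of \<open>r t\<close> on \<open>A\<close>. This selects a countable subset of
  \<open>A\<close>, and \<open>h t\<close> consists of indices in \<open>G\<close> whose retractions
  fix the selected points.\<close>

lemma approx_fun_exists:
  assumes G: "G \<subseteq> I" and A: "A \<subseteq> (\<Union>s\<in>G. r s ` topspace X)" and z: "z \<in> X closure_of A"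
  shows "\<exists>h. approx_fun G A z h"
proof -
  have zX: "z \<in> topspace X" and AX: "A \<subseteq> topspace X"
    using z in_closure_of image_sub A G by (metis, fastforce)
  have "\<exists>C\<subseteq>A. countable C \<and> r t z \<in> X closure_of (r t ` C)" if "t \<in> G" for t
  proof -
    have tI: "t \<in> I" using that G by blast
    let ?S = "subtopology X (r t ` topspace X)"
    obtain M d where "Metric_space M d" and S: "?S = Metric_space.mtopology M d"
      using image_metrizable[OF tI] unfolding metrizable_space_def by blast
    then interpret Metric_space M d by simp
    have "r t z \<in> X closure_of (r t ` A)"
      using continuous_map_image_closure_subset[OF continuous[OF tI]] z by blast
    then have "r t z \<in> ?S closure_of (r t ` A)"
      using zX AX by (auto simp: closure_of_subtopology Int_absorb1 image_mono)
    then obtain \<phi> where \<phi>: "range \<phi> \<subseteq> r t ` A" "limitin ?S \<phi> (r t z) sequentially"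
      unfolding S closure_of_sequentially by blast
    then have "\<forall>n. \<exists>c. c \<in> A \<and> \<phi> n = r t c" by blast
    then obtain c where c: "\<And>n. c n \<in> A" "\<And>n. \<phi> n = r t (c n)" by metis
    have "limitin X \<phi> (r t z) sequentially"
      using \<phi>(2) by (simp add: limitin_subtopology)
    moreover have "\<phi> n \<in> X closure_of (r t ` range c)" for n
      using closure_of_subset[of "r t ` range c" X] c AX in_space[OF tI] by blast
    ultimately have "r t z \<in> X closure_of (r t ` range c)"
      by (intro limitin_closedin[of X \<phi>]) (auto simp: closedin_closure_of)
    then show ?thesis using c(1) by (intro exI[of _ "range c"]) auto
  qed
  then obtain C where C: "\<And>t. t \<in> G \<Longrightarrow> C t \<subseteq> A \<and> countable (C t) \<and> r t z \<in> X closure_of (r t ` C t)"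
    by metis
  have "\<forall>a\<in>A. \<exists>u\<in>G. a \<in> r u ` topspace X" using A by blast
  then obtain u where u: "\<And>a. a \<in> A \<Longrightarrow> u a \<in> G \<and> a \<in> r (u a) ` topspace X" by metis
  have "\<exists>C'\<subseteq>A. countable C' \<and> r s z \<in> X closure_of C'"
    if \<sigma>: "increasing_in G le \<sigma>" and s: "is_sup I le (range \<sigma>) s"
      and cl: "\<forall>n. \<forall>v\<in>u ` C (\<sigma> n). \<exists>m. (v, \<sigma> m) \<in> le" for \<sigma> s
  proof -
    have \<sigma>G: "\<sigma> n \<in> G" for n using \<sigma> by (auto simp: increasing_in_def)
    have \<sigma>I: "increasing_in I le \<sigma>" using \<sigma> G by (rule increasing_in_sub)
    have sI: "s \<in> I" and \<sigma>s: "(\<sigma> n, s) \<in> le" for n using s by (auto simp: is_sup_def)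
    define C' where "C' = (\<Union>n. C (\<sigma> n))"
    have C'A: "C' \<subseteq> A" and C'c: "countable C'" using C \<sigma>G by (auto simp: C'_def)
    have C'r: "C' \<subseteq> (\<Union>n. r (\<sigma> n) ` topspace X)"
    proof
      fix a assume a: "a \<in> C'"
      then obtain m where "(u a, \<sigma> m) \<in> le" using cl unfolding C'_def by blast
      then have "a \<in> r (\<sigma> m) ` topspace X" using u a C'A in_image_le by blast
      then show "a \<in> (\<Union>n. r (\<sigma> n) ` topspace X)" by blast
    qed
    have C's: "C' \<subseteq> r s ` topspace X" using C'r in_image_le[OF \<sigma>s] by blast
    \<comment> \<open>The points of the closure of \<open>C'\<close> that
      \<open>r (\<sigma> n)\<close> cannot tell from \<open>z\<close> form a decreasing sequence of
      nonempty closed sets. A common point \<open>w\<close> turns out to be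
      \<open>r s z\<close>.\<close>
    define Z where "Z n = {w \<in> X closure_of C'. r (\<sigma> n) w = r (\<sigma> n) z}" for n
    have Zcl: "closedin X (Z n)" for n
    proof -
      have "Z n = X closure_of C' \<inter> {w \<in> topspace X. r (\<sigma> n) w = r (\<sigma> n) z}"
        using closure_of_subset_topspace[of X C'] unfolding Z_def by blast
      moreover have "closedin X {w \<in> topspace X. r (\<sigma> n) w = (\<lambda>_. r (\<sigma> n) z) w}"
        using \<sigma>G G zX in_space by (intro closedin_continuous_maps_eq[OF Hausdorff] continuous) auto
      ultimately show ?thesis by (simp add: closedin_Int)
    qed
    have Zne: "Z n \<noteq> {}" for n
    proof -
      have nI: "\<sigma> n \<in> I" using \<sigma>G G by blast
      \<comment> \<open>The continuous image of this compact set is closed, hence contains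
        \<open>r (\<sigma> n) z\<close> and not merely points near it.\<close>
      have "compactin X (X closure_of C')"
        by (simp add: closedin_compact_space compact)
      then have "closedin X (r (\<sigma> n) ` (X closure_of C'))"
        using compactin_imp_closedin[OF Hausdorff] image_compactin continuous[OF nI] by blast
      moreover have "r (\<sigma> n) ` C (\<sigma> n) \<subseteq> r (\<sigma> n) ` (X closure_of C')"
        using closure_of_subset[of C' X] C'A AX unfolding C'_def by (intro image_mono) auto
      ultimately have "r (\<sigma> n) z \<in> r (\<sigma> n) ` (X closure_of C')"
        using C[OF \<sigma>G] closure_of_minimal by blast
      then obtain w where "w \<in> X closure_of C'" "r (\<sigma> n) z = r (\<sigma> n) w" by blast
      then have "w \<in> Z n" by (simp add: Z_def)
      then show ?thesis by blast
    qed
    have Zmono: "Z n \<subseteq> Z m" if "m \<le> n" for m n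
    proof
      fix w assume w: "w \<in> Z n"
      then have wX: "w \<in> topspace X" unfolding Z_def using in_closure_of by fastforce
      have le: "(\<sigma> m, \<sigma> n) \<in> le" using increasing_le[OF \<sigma>I that] .
      have "r (\<sigma> m) w = r (\<sigma> m) (r (\<sigma> n) w)" using comp_le(2)[OF le wX] by simp
      also have "\<dots> = r (\<sigma> m) z" using w comp_le(2)[OF le zX] by (simp add: Z_def)
      finally show "w \<in> Z m" using w by (simp add: Z_def)
    qed
    have "\<Inter>(range Z) \<noteq> {}"
    proof (rule compact_space_fip[THEN iffD1, OF compact, rule_format], intro conjI ballI allI impI)
      fix \<F> assume \<F>: "finite \<F> \<and> \<F> \<subseteq> range Z"
      then obtain N where N: "finite N" "\<F> = Z ` N" by (meson finite_subset_image)
      have "Z (Max (insert 0 N)) \<subseteq> Z n" if "n \<in> N" for n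
        using N(1) that by (intro Zmono Max_ge) auto
      then have "Z (Max (insert 0 N)) \<subseteq> \<Inter>\<F>" using N(2) by blast
      then show "\<Inter>\<F> \<noteq> {}" using Zne by blast
    qed (use Zcl in auto)
    then obtain w where w: "\<And>n. w \<in> Z n" by blast
    \<comment> \<open>The closed image of \<open>r s\<close> contains \<open>C'\<close>, hence also
      \<open>w\<close>, which is therefore fixed by \<open>r s\<close>.\<close>
    have "X closure_of C' \<subseteq> r s ` topspace X"
      using C's image_closed[OF sI] closure_of_minimal by blast
    then have "r s w = w" and wX: "w \<in> topspace X"
      using w[of 0] in_image_iff[OF sI] by (auto simp: Z_def)
    moreover have "r s w = r s z"
      using w by (intro sup_eqI[OF \<sigma>I s wX zX]) (simp add: Z_def)
    ultimately have "r s z \<in> X closure_of C'" using w[of 0] by (simp add: Z_def)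
    then show ?thesis using C'A C'c by blast
  qed
  moreover have "\<forall>t\<in>G. countable (u ` C t) \<and> u ` C t \<subseteq> G" using C u by blast
  ultimately have "approx_fun G A z (\<lambda>t. u ` C t)" unfolding approx_fun_def by simp
  then show ?thesis by (rule exI[where x="\<lambda>t. u ` C t"])
qed

text \<open>Otherwise the points have disjoint closed neighbourhoods \<open>K\<close> and
  \<open>K'\<close>. For a chain closed under the approximations of both points, the supremum
  \<open>s\<close> puts \<open>r s x\<close> into \<open>K\<close> and \<open>r s y\<close> into
  \<open>K'\<close>; but \<open>r s\<close> takes the same value at both, since every member of the
  chain does.\<close>

lemma separates_closure:
  assumes G: "G \<subseteq> I" "up_directed G le"
    and x: "x \<in> X closure_of (\<Union>s\<in>G. r s ` topspace X)"
    and y: "y \<in> X closure_of (\<Union>s\<in>G. r s ` topspace X)"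
    and eq: "\<And>s. s \<in> G \<Longrightarrow> r s x = r s y"
  shows "x = y"
proof (rule ccontr)
  assume "x \<noteq> y"
  let ?U = "\<Union>s\<in>G. r s ` topspace X"
  have xX: "x \<in> topspace X" and yX: "y \<in> topspace X"
    using x y closure_of_subset_topspace by fast+
  have reg: "regular_space X"
    using compact Hausdorff compact_Hausdorff_or_regular_imp_normal_space normal_t1_imp_regular_space
      Hausdorff_imp_t1_space by blast
  obtain U V where UV: "openin X U" "openin X V" "x \<in> U" "y \<in> V" "disjnt U V"
    using Hausdorff \<open>x \<noteq> y\<close> xX yX unfolding Hausdorff_space_def by metis
  then obtain U' K where U': "openin X U'" "closedin X K" "x \<in> U'" "U' \<subseteq> K" "K \<subseteq> U"
    using reg unfolding neighbourhood_base_of_closedin[symmetric] neighbourhood_base_of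
    by (metis subsetD)
  define V' where "V' = topspace X - K"
  have V': "openin X V'" "y \<in> V'"
    using U' UV yX by (auto simp: V'_def disjnt_def)
  obtain V'' K' where V'': "openin X V''" "closedin X K'" "y \<in> V''" "V'' \<subseteq> K'" "K' \<subseteq> V'"
    using reg V' unfolding neighbourhood_base_of_closedin[symmetric] neighbourhood_base_of
    by (metis subsetD)
  \<comment> \<open>Restricting the approximating points to neighbourhoods of \<open>x\<close> and
    \<open>y\<close> keeps them, and so the limits, inside \<open>K\<close> and
    \<open>K'\<close>.\<close>
  have "x \<in> X closure_of (U' \<inter> ?U)" "y \<in> X closure_of (V'' \<inter> ?U)"
    using x y U' V'' openin_Int_closure_of_subset by (metis IntI subsetD)+
  then obtain h h' where h: "approx_fun G (U' \<inter> ?U) x h" and h': "approx_fun G (V'' \<inter> ?U) y h'"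
    using approx_fun_exists[OF G(1) inf_le2] by meson
  obtain s0 where "s0 \<in> G" using up_directed_nonempty[OF G(2)] by blast
  then obtain \<sigma> where \<sigma>: "increasing_in G le \<sigma>"
      "\<forall>n. \<forall>u\<in>h (\<sigma> n) \<union> h' (\<sigma> n). \<exists>m. (u, \<sigma> m) \<in> le"
    using up_directed_closed_chain[OF G(2) le_trans, of s0 "\<lambda>t. h t \<union> h' t"]
      approx_funD(1)[OF h] approx_funD(1)[OF h'] by auto
  have \<sigma>I: "increasing_in I le \<sigma>" using \<sigma>(1) G(1) by (rule increasing_in_sub)
  obtain s where s: "is_sup I le (range \<sigma>) s" using sup_ex[OF \<sigma>I] by blast
  obtain C C' where "C \<subseteq> U'" "r s x \<in> X closure_of C" "C' \<subseteq> V''" "r s y \<in> X closure_of C'"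
    using approx_funD(2)[OF h \<sigma>(1) s] approx_funD(2)[OF h' \<sigma>(1) s] \<sigma>(2) by (meson UnI1 UnI2 le_infE)
  then have "r s x \<in> K" "r s y \<in> K'"
    using U' V'' closure_of_minimal by (metis order_trans subsetD)+
  moreover have "r s x = r s y"
    using \<sigma>(1) eq by (intro sup_eqI[OF \<sigma>I s xX yX]) (auto simp: increasing_in_def)
  ultimately show False using V'' by (auto simp: V'_def)
qed

text \<open>The chain is started above an index whose retraction fixes \<open>z\<close>. Its
  supremum then fixes \<open>z\<close> too, and the approximation of \<open>r s z\<close> is one of
  \<open>z\<close> itself.\<close>

lemma countable_tightness:
  assumes "z \<in> induced_set X I r" "A \<subseteq> induced_set X I r" "z \<in> X closure_of A"
  shows "\<exists>C\<subseteq>A. countable C \<and> z \<in> X closure_of C"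
proof -
  obtain s0 where s0: "s0 \<in> I" "z \<in> r s0 ` topspace X" using assms(1) unfolding induced_set_def by blast
  have "A \<subseteq> (\<Union>s\<in>I. r s ` topspace X)" using assms(2) by (simp add: induced_set_def)
  then obtain h where h: "approx_fun I A z h"
    using approx_fun_exists[OF subset_refl _ assms(3)] by blast
  obtain \<sigma> n where \<sigma>: "increasing_in I le \<sigma>" "(s0, \<sigma> n) \<in> le"
      "\<forall>n. \<forall>u\<in>h (\<sigma> n). \<exists>m. (u, \<sigma> m) \<in> le"
    using up_directed_closed_chain[OF directed le_trans, of s0 h] approx_funD(1)[OF h] s0 by auto
  obtain s where s: "is_sup I le (range \<sigma>) s" using sup_ex[OF \<sigma>(1)] by blast
  then have "(\<sigma> n, s) \<in> le" "s \<in> I" by (auto simp: is_sup_def)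
  then have "z \<in> r s ` topspace X" using s0(2) \<sigma>(2) in_image_le by blast
  then have "r s z = z" using in_image_iff[OF \<open>s \<in> I\<close>] by blast
  then show ?thesis using approx_funD(2)[OF h \<sigma>(1) s \<sigma>(3)] by auto
qed

text \<open>By \<open>separates_closure\<close>, \<open>y\<close> is the only point of the closure
  that all \<open>r s\<close> send where they send \<open>x\<close>. By compactness finitely many
  \<open>s\<close> already exclude every point outside a given neighbourhood of \<open>y\<close>;
  for \<open>t\<close> above these, \<open>r t x\<close> passes all the tests and so lies in the
  neighbourhood.\<close>

lemma net_limit_directed:
  assumes G: "G \<subseteq> I" "up_directed G le" and x: "x \<in> topspace X"
    and y: "y \<in> X closure_of (\<Union>s\<in>G. r s ` topspace X)"
    and eq: "\<And>s. s \<in> G \<Longrightarrow> r s y = r s x"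
  shows "net_limit X G le (\<lambda>s. r s x) y"
  unfolding net_limit_iff[OF G(2) le_trans]
proof (intro conjI allI impI)
  let ?F = "X closure_of (\<Union>s\<in>G. r s ` topspace X)"
  show yX: "y \<in> topspace X" using y closure_of_subset_topspace by fast
  fix U assume U: "openin X U \<and> y \<in> U"
  define Z where "Z s = (?F - U) \<inter> {w \<in> topspace X. r s w = r s x}" for s
  have Zcl: "closedin X (Z s)" if "s \<in> G" for s
  proof -
    have "closedin X {w \<in> topspace X. r s w = (\<lambda>_. r s x) w}"
      using that G x in_space by (intro closedin_continuous_maps_eq[OF Hausdorff] continuous) auto
    then show ?thesis unfolding Z_def using U by (intro closedin_Int closedin_diff) auto
  qed
  obtain g0 where "g0 \<in> G" using up_directed_nonempty[OF G(2)] by blast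
  have "\<Inter>(Z ` G) = {}"
  proof (rule ccontr)
    assume "\<Inter>(Z ` G) \<noteq> {}"
    then obtain z where "\<And>s. s \<in> G \<Longrightarrow> z \<in> Z s" by blast
    then have "z \<in> ?F - U" "\<And>s. s \<in> G \<Longrightarrow> r s z = r s y"
      using \<open>g0 \<in> G\<close> eq by (auto simp: Z_def)
    then show False using separates_closure[OF G _ y] U by blast
  qed
  then obtain \<F> where \<F>: "finite \<F>" "\<F> \<subseteq> Z ` G" "\<Inter>\<F> = {}"
    using compact_space_fip[THEN iffD1, OF compact, rule_format, of "Z ` G"] Zcl by blast
  then obtain S where S: "finite S" "S \<subseteq> G" "\<F> = Z ` S" by (meson finite_subset_image)
  obtain u where u: "u \<in> G" "\<forall>s\<in>S. (s, u) \<in> le"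
    using up_directed_finite[OF G(2) le_trans S(1,2)] by blast
  have "r t x \<in> U" if t: "t \<in> G" "(u, t) \<in> le" for t
  proof (rule ccontr)
    assume "r t x \<notin> U"
    have tI: "t \<in> I" using t G by blast
    have "r t x \<in> ?F"
      using closure_of_subset[of "\<Union>s\<in>G. r s ` topspace X" X] image_sub G t x by blast
    moreover have "r s (r t x) = r s x" if "s \<in> S" for s
      using comp_le(2) u that t(2) x transD[OF le_trans] by metis
    ultimately have "r t x \<in> \<Inter>\<F>"
      using \<open>r t x \<notin> U\<close> S(3) in_space[OF tI x] by (auto simp: Z_def)
    then show False using \<F> by blast
  qed
  then show "\<exists>s\<in>G. \<forall>t\<in>G. (s, t) \<in> le \<longrightarrow> r t x \<in> U" using u(1) by blast
qed

text \<open>Countable tightness is applied at each point of a countable dense subset of the image.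
  Countability of \<open>C\<close> is what later allows such a set to be found inside a
  model.\<close>

lemma image_subset_countable_closure:
  assumes "s \<in> I" "D \<subseteq> induced_set X I r" "X closure_of D = topspace X"
  shows "\<exists>C\<subseteq>D. countable C \<and> r s ` topspace X \<subseteq> X closure_of C"
proof -
  let ?S = "subtopology X (r s ` topspace X)"
  have S: "topspace ?S = r s ` topspace X" using image_sub[OF assms(1)] by (simp add: Int_absorb1)
  then obtain Q where Q: "Q \<subseteq> r s ` topspace X" "countable Q" "?S closure_of Q = r s ` topspace X"
    using compact_metrizable_countable_dense[OF image_compact image_metrizable] assms(1) by metis
  have "\<exists>C\<subseteq>D. countable C \<and> q \<in> X closure_of C" if "q \<in> Q" for q
  proof (rule countable_tightness)
    show "q \<in> induced_set X I r" using that Q(1) assms(1) by (auto simp: induced_set_def)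
    show "q \<in> X closure_of D" using that Q(1) assms(1,3) image_sub by blast
  qed (fact assms)
  then obtain C where C: "\<And>q. q \<in> Q \<Longrightarrow> C q \<subseteq> D \<and> countable (C q) \<and> q \<in> X closure_of (C q)"
    by metis
  define C' where "C' = (\<Union>q\<in>Q. C q)"
  have "C' \<subseteq> D" "countable C'" using C Q(2) by (auto simp: C'_def)
  moreover have "Q \<subseteq> X closure_of C'"
  proof
    fix q assume q: "q \<in> Q"
    then have "X closure_of (C q) \<subseteq> X closure_of C'" by (intro closure_of_mono) (auto simp: C'_def)
    then show "q \<in> X closure_of C'" using C[OF q] by blast
  qed
  then have "X closure_of Q \<subseteq> X closure_of C'" by (rule closure_of_minimal) simp
  moreover have "r s ` topspace X \<subseteq> X closure_of Q"
    using Q(3) closure_of_subtopology_subset[of X "r s ` topspace X" Q] by auto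
  ultimately show ?thesis by blast
qed

lemma countable_separating:
  assumes "s \<in> I"
  shows "\<exists>f :: nat \<Rightarrow> 'a \<Rightarrow> real. (\<forall>n. continuous_map X euclideanreal (f n)) \<and>
    (\<forall>x\<in>topspace X. \<forall>y\<in>topspace X. (\<forall>n. f n x = f n y) \<longrightarrow> r s x = r s y)"
proof -
  let ?S = "subtopology X (r s ` topspace X)"
  have S: "topspace ?S = r s ` topspace X" using image_sub[OF assms(1)] by (simp add: Int_absorb1)
  from compact_metrizable_countable_separating[OF image_compact image_metrizable, OF assms assms]
  obtain f :: "nat \<Rightarrow> 'a \<Rightarrow> real" where f: "\<And>n. continuous_map ?S euclideanreal (f n)"
    "\<And>x y. x \<in> r s ` topspace X \<Longrightarrow> y \<in> r s ` topspace X \<Longrightarrow> (\<forall>n. f n x = f n y) \<Longrightarrow> x = y"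
    unfolding S by blast
  have "continuous_map X ?S (r s)"
    using continuous[OF assms] by (simp add: continuous_map_in_subtopology)
  then have "continuous_map X euclideanreal (f n \<circ> r s)" for n
    using f(1) continuous_map_compose by blast
  moreover have "r s x = r s y" if "x \<in> topspace X" "y \<in> topspace X" "\<forall>n. (f n \<circ> r s) x = (f n \<circ> r s) y" for x y
    using f(2)[of "r s x" "r s y"] that by simp
  ultimately show ?thesis by (intro exI[of _ "\<lambda>n. f n \<circ> r s"]) blast
qed

text \<open>A chain cofinal in \<open>G\<close> has the same upper bounds as \<open>G\<close>, and a
  convergent net over \<open>G\<close> becomes along it a sequence with limits \<open>y\<close> and
  \<open>r s x\<close>.\<close>

lemma sup_countable_directed:
  assumes G: "G \<subseteq> I" "up_directed G le" "countable G"
  shows "\<exists>s. is_sup I le G s \<and> (\<forall>x y. x \<in> topspace X \<longrightarrow> net_limit X G le (\<lambda>s. r s x) y \<longrightarrow> r s x = y)"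
proof -
  obtain \<sigma> where \<sigma>: "increasing_in G le \<sigma>" "\<And>s. s \<in> G \<Longrightarrow> \<exists>n. (s, \<sigma> n) \<in> le"
    using up_directed_countable_chain[OF G(2) le_trans G(3) subset_refl] by blast
  have \<sigma>I: "increasing_in I le \<sigma>" using increasing_in_sub[OF \<sigma>(1) G(1)] .
  obtain s where s: "is_sup I le (range \<sigma>) s" using sup_ex[OF \<sigma>I] by blast
  have rG: "range \<sigma> \<subseteq> G" using \<sigma>(1) by (simp add: increasing_in_def)
  have "(g, s) \<in> le" if g: "g \<in> G" for g
  proof -
    obtain n where "(g, \<sigma> n) \<in> le" using \<sigma>(2)[OF g] by blast
    moreover have "(\<sigma> n, s) \<in> le" using s by (simp add: is_sup_def)
    ultimately show ?thesis using le_trans by (meson transD)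
  qed
  then have "is_sup I le G s"
    using s rG unfolding is_sup_def by blast
  moreover have "r s x = y" if x: "x \<in> topspace X" and y: "net_limit X G le (\<lambda>s. r s x) y" for x y
  proof (rule limitin_Hausdorff_unique[OF sup_limit[OF \<sigma>I s x] _ sequentially_bot Hausdorff])
    show "limitin X (\<lambda>n. r (\<sigma> n) x) y sequentially"
      unfolding limitin_sequentially
    proof (intro conjI allI impI)
      show "y \<in> topspace X" using y net_limit_iff[OF G(2) le_trans] by metis
      fix U assume "openin X U \<and> y \<in> U"
      then obtain g where g: "g \<in> G" "\<And>t. t \<in> G \<Longrightarrow> (g, t) \<in> le \<Longrightarrow> r t x \<in> U"
        using y net_limit_iff[OF G(2) le_trans, of X "\<lambda>s. r s x" y] by metis
      obtain n where n: "(g, \<sigma> n) \<in> le" using \<sigma>(2)[OF g(1)] by blast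
      have "r (\<sigma> m) x \<in> U" if "n \<le> m" for m
        using g(2)[of "\<sigma> m"] rG increasing_le[OF \<sigma>I that] transD[OF le_trans n] by blast
      then show "\<exists>N. \<forall>n\<ge>N. r (\<sigma> n) x \<in> U" by blast
    qed
  qed
  ultimately show ?thesis by blast
qed

lemma net_limit_closed:
  assumes G: "up_directed G le" and y: "net_limit X G le f y"
    and "closedin X S" "\<And>s. s \<in> G \<Longrightarrow> f s \<in> S"
  shows "y \<in> S"
proof (rule ccontr)
  assume "y \<notin> S"
  then have "openin X (topspace X - S)" "y \<in> topspace X - S"
    using assms net_limit_iff[OF G le_trans, of X f y] by auto
  then obtain g where g: "g \<in> G" "\<And>t. t \<in> G \<Longrightarrow> (g, t) \<in> le \<Longrightarrow> f t \<in> topspace X - S"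
    using y net_limit_iff[OF G le_trans, of X f y] by metis
  obtain t where "t \<in> G" "(g, t) \<in> le" using up_directed_bound[OF G g(1) g(1)] by blast
  then show False using g(2) assms(4) by blast
qed

text \<open>If \<open>r t\<close> fixes \<open>x\<close>, then by commutativity it fixes every
  \<open>r s x\<close>, so the whole net stays in the closed image of \<open>r t\<close>.\<close>

lemma commutative_net_limit_induced:
  assumes G: "G \<subseteq> I" "up_directed G le" and c: "commutative_skeleton X I r"
    and x: "x \<in> induced_set X I r" and y: "net_limit X G le (\<lambda>s. r s x) y"
  shows "y \<in> induced_set X I r"
proof -
  obtain t where t: "t \<in> I" "x \<in> r t ` topspace X" using x by (auto simp: induced_set_def)
  have xX: "x \<in> topspace X" and rx: "r t x = x" using t in_image_iff[OF t(1)] by blast+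
  have "r s x \<in> r t ` topspace X" if "s \<in> G" for s
  proof -
    have sI: "s \<in> I" using that G by blast
    then have "r s x = r t (r s x)" using c t(1) xX rx unfolding commutative_skeleton_def by metis
    then show ?thesis using in_space[OF sI xX] by (metis imageI)
  qed
  then have "y \<in> r t ` topspace X"
    using net_limit_closed[OF G(2) y image_closed[OF t(1)]] by blast
  then show ?thesis using t(1) by (auto simp: induced_set_def)
qed

section \<open>The sigma-closure of a directed index set and the skeleton restricted to it\<close>

lemma sigma_closure_props:
  assumes "G \<subseteq> I"
  shows "G \<subseteq> sigma_closure I le G" "sigma_closure I le G \<subseteq> I"
    and "increasing_in (sigma_closure I le G) le \<sigma> \<Longrightarrow> is_sup I le (range \<sigma>) s \<Longrightarrow> s \<in> sigma_closure I le G"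
proof -
  show "G \<subseteq> sigma_closure I le G" unfolding sigma_closure_def by blast
  have "is_sup I le (range \<sigma>) s \<Longrightarrow> s \<in> I" for \<sigma> :: "nat \<Rightarrow> 'i" and s by (simp add: is_sup_def)
  then show "sigma_closure I le G \<subseteq> I"
    unfolding sigma_closure_def using assms by (intro Inter_lower) auto
  assume \<sigma>: "increasing_in (sigma_closure I le G) le \<sigma>" and s: "is_sup I le (range \<sigma>) s"
  show "s \<in> sigma_closure I le G"
    unfolding sigma_closure_def
  proof (rule InterI, clarify)
    fix B assume B: "G \<subseteq> B" "B \<subseteq> I" "\<forall>\<sigma> s. increasing_in B le \<sigma> \<and> is_sup I le (range \<sigma>) s \<longrightarrow> s \<in> B"
    then have "sigma_closure I le G \<subseteq> B" unfolding sigma_closure_def by (intro Inter_lower) simp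
    then have "increasing_in B le \<sigma>" using \<sigma> unfolding increasing_in_def by blast
    then show "s \<in> B" using B(3) s by blast
  qed
qed

lemma sigma_closure_induct:
  assumes G: "G \<subseteq> I" and base: "\<And>s. s \<in> G \<Longrightarrow> P s"
    and step: "\<And>\<sigma> s. increasing_in (sigma_closure I le G) le \<sigma> \<Longrightarrow> is_sup I le (range \<sigma>) s \<Longrightarrow>
      (\<And>n. P (\<sigma> n)) \<Longrightarrow> P s"
    and s: "s \<in> sigma_closure I le G"
  shows "P s"
proof -
  let ?J = "sigma_closure I le G"
  let ?B = "{s \<in> ?J. P s}"
  have "s \<in> ?B" if "increasing_in ?B le \<sigma> \<and> is_sup I le (range \<sigma>) s" for \<sigma> s
  proof -
    have "increasing_in ?J le \<sigma>" "\<And>n. P (\<sigma> n)" using that by (auto simp: increasing_in_def)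
    then show ?thesis using step sigma_closure_props(3)[OF G] that by blast
  qed
  moreover have "G \<subseteq> ?B" "?B \<subseteq> I" using base sigma_closure_props[OF G] by auto
  ultimately have "?J \<subseteq> ?B" by (subst sigma_closure_def, intro Inter_lower) blast
  then show ?thesis using s by blast
qed

text \<open>Upper bounds of elements of the \<open>\<sigma>\<close>-closure are found among suprema of chains in \<open>G\<close> itself,
  which makes the \<open>\<sigma>\<close>-closure of a directed set directed.\<close>

lemma sigma_closure_bound:
  assumes G: "G \<subseteq> I" "up_directed G le" and s: "s \<in> sigma_closure I le G"
  shows "\<exists>\<sigma> t. increasing_in G le \<sigma> \<and> is_sup I le (range \<sigma>) t \<and> (s, t) \<in> le"
  using G(1) _ _ s
proof (rule sigma_closure_induct)
  fix s assume "s \<in> G"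
  then obtain \<sigma> n where \<sigma>: "increasing_in G le \<sigma>" "(s, \<sigma> n) \<in> le"
    using up_directed_countable_chain[OF G(2) le_trans, of "{s}"] by auto
  then obtain t where t: "is_sup I le (range \<sigma>) t" using sup_ex increasing_in_sub G(1) by blast
  then have "(\<sigma> n, t) \<in> le" by (simp add: is_sup_def)
  then have "(s, t) \<in> le" using \<sigma>(2) le_trans by (meson transD)
  then show "\<exists>\<sigma> t. increasing_in G le \<sigma> \<and> is_sup I le (range \<sigma>) t \<and> (s, t) \<in> le" using \<sigma>(1) t by blast
next
  fix \<sigma> :: "nat \<Rightarrow> 'i" and s
  assume s: "is_sup I le (range \<sigma>) s"
    and "\<And>n. \<exists>\<rho> t. increasing_in G le \<rho> \<and> is_sup I le (range \<rho>) t \<and> (\<sigma> n, t) \<in> le"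
  then obtain \<rho> t where \<rho>: "\<And>n. increasing_in G le (\<rho> n)" "\<And>n. is_sup I le (range (\<rho> n)) (t n)"
      "\<And>n. (\<sigma> n, t n) \<in> le"
    by metis
  \<comment> \<open>The chains obtained for the single \<open>\<sigma> n\<close> have countably many
    members altogether, so one chain in \<open>G\<close> dominates them all and its supremum bounds
    every \<open>t n\<close>.\<close>
  have "(\<Union>n. range (\<rho> n)) \<subseteq> G" using \<rho>(1) by (auto simp: increasing_in_def)
  moreover have "countable (\<Union>n. range (\<rho> n))" by (intro countable_UN countable_image countableI_type)
  ultimately obtain \<tau> where \<tau>: "increasing_in G le \<tau>" "\<And>u. u \<in> (\<Union>n. range (\<rho> n)) \<Longrightarrow> \<exists>m. (u, \<tau> m) \<in> le"
    using up_directed_countable_chain[OF G(2) le_trans] by metis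
  then obtain v where v: "is_sup I le (range \<tau>) v" using sup_ex increasing_in_sub G(1) by blast
  have vI: "v \<in> I" and \<tau>v: "\<And>m. (\<tau> m, v) \<in> le" using v by (auto simp: is_sup_def)
  have "(\<rho> n k, v) \<in> le" for n k
  proof -
    obtain m where "(\<rho> n k, \<tau> m) \<in> le" using \<tau>(2)[of "\<rho> n k"] by blast
    then show ?thesis using \<tau>v le_trans by (meson transD)
  qed
  then have "(t n, v) \<in> le" for n using \<rho>(2)[of n] vI by (auto simp: is_sup_def)
  then have "(\<sigma> n, v) \<in> le" for n using \<rho>(3) le_trans by (meson transD)
  then have "(s, v) \<in> le" using s vI by (auto simp: is_sup_def)
  then show "\<exists>\<sigma> t. increasing_in G le \<sigma> \<and> is_sup I le (range \<sigma>) t \<and> (s, t) \<in> le" using \<tau>(1) v by blast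
qed

lemma sigma_closure_directed:
  assumes G: "G \<subseteq> I" "up_directed G le"
  shows "up_directed (sigma_closure I le G) le"
  unfolding up_directed_def
proof (intro conjI ballI)
  let ?J = "sigma_closure I le G"
  note J = sigma_closure_props[OF G(1)]
  show "?J \<noteq> {}" using J(1) up_directed_nonempty[OF G(2)] by blast
  fix a b assume "a \<in> ?J" "b \<in> ?J"
  then obtain \<sigma> t \<rho> u where \<sigma>: "increasing_in G le \<sigma>" "is_sup I le (range \<sigma>) t" "(a, t) \<in> le"
    and \<rho>: "increasing_in G le \<rho>" "is_sup I le (range \<rho>) u" "(b, u) \<in> le"
    using sigma_closure_bound[OF G] by metis
  have "countable (range \<sigma> \<union> range \<rho>)" "range \<sigma> \<union> range \<rho> \<subseteq> G"
    using \<sigma>(1) \<rho>(1) by (auto simp: increasing_in_def)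
  then obtain \<tau> where \<tau>: "increasing_in G le \<tau>" "\<forall>v\<in>range \<sigma> \<union> range \<rho>. \<exists>m. (v, \<tau> m) \<in> le"
    using up_directed_countable_chain[OF G(2) le_trans] by metis
  then obtain v where v: "is_sup I le (range \<tau>) v" using sup_ex increasing_in_sub G(1) by blast
  have vI: "v \<in> I" and \<tau>v: "\<And>m. (\<tau> m, v) \<in> le" using v by (auto simp: is_sup_def)
  have "(w, v) \<in> le" if w: "w \<in> range \<sigma> \<union> range \<rho>" for w
  proof -
    obtain m where "(w, \<tau> m) \<in> le" using \<tau>(2) w by blast
    then show ?thesis using \<tau>v le_trans by (meson transD)
  qed
  then have "(t, v) \<in> le" "(u, v) \<in> le" using \<sigma>(2) \<rho>(2) vI by (auto simp: is_sup_def)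
  then have "(a, v) \<in> le" "(b, v) \<in> le" using \<sigma>(3) \<rho>(3) le_trans by (meson transD)+
  moreover have "increasing_in ?J le \<tau>" using \<tau>(1) J(1) by (auto simp: increasing_in_def)
  then have "v \<in> ?J" using J(3) v by blast
  ultimately show "\<exists>v\<in>?J. (a, v) \<in> le \<and> (b, v) \<in> le" by blast
qed

lemma sigma_closure_image:
  assumes G: "G \<subseteq> I" and s: "s \<in> sigma_closure I le G"
  shows "r s ` topspace X \<subseteq> X closure_of (\<Union>s\<in>G. r s ` topspace X)"
  using G _ _ s
proof (rule sigma_closure_induct)
  let ?F = "X closure_of (\<Union>s\<in>G. r s ` topspace X)"
  fix s assume "s \<in> G"
  moreover have "(\<Union>s\<in>G. r s ` topspace X) \<subseteq> ?F"
    using image_sub G by (intro closure_of_subset) blast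
  ultimately show "r s ` topspace X \<subseteq> ?F" by blast
next
  let ?F = "X closure_of (\<Union>s\<in>G. r s ` topspace X)"
  fix \<sigma> s assume \<sigma>: "increasing_in (sigma_closure I le G) le \<sigma>"
    and s: "is_sup I le (range \<sigma>) s" and IH: "\<And>n. r (\<sigma> n) ` topspace X \<subseteq> ?F"
  show "r s ` topspace X \<subseteq> ?F"
  proof (intro image_subsetI)
    fix x assume x: "x \<in> topspace X"
    have "increasing_in I le \<sigma>" using increasing_in_sub[OF \<sigma> sigma_closure_props(2)[OF G]] .
    then have "limitin X (\<lambda>n. r (\<sigma> n) x) (r s x) sequentially" using sup_limit s x by blast
    moreover have "\<forall>n. r (\<sigma> n) x \<in> ?F" using IH x by blast
    ultimately show "r s x \<in> ?F"
      by (intro limitin_closedin[of X "\<lambda>n. r (\<sigma> n) x"]) (auto simp: always_eventually)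
  qed
qed

text \<open>Most conditions descend from \<open>X\<close> once suprema of chains in \<open>J\<close>
  are known to be the same in \<open>J\<close> and in \<open>I\<close>. Convergence to the identity
  on \<open>F\<close> is \<open>net_limit_directed\<close> with both points equal, and the induced
  set is found by countable tightness.\<close>

lemma sigma_closure_skeleton:
  assumes G: "G \<subseteq> I" "up_directed G le"
  defines "J \<equiv> sigma_closure I le G" and "F \<equiv> X closure_of (\<Union>s\<in>G. r s ` topspace X)"
  shows "retractional_skeleton (subtopology X F) J (Restr le J) r"
    and "induced_set (subtopology X F) J r = induced_set X I r \<inter> F"
proof -
  note Jp = sigma_closure_props[OF G(1), folded J_def]
  have dJ: "up_directed J le" using sigma_closure_directed[OF G] by (simp add: J_def)
  have FX: "F \<subseteq> topspace X" by (simp add: F_def closure_of_subset_topspace)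
  have Fcl: "closedin X F" by (simp add: F_def)
  have tF: "topspace (subtopology X F) = F" using FX by (simp add: Int_absorb1)
  have im: "r s ` topspace X \<subseteq> F" if "s \<in> J" for s
    using sigma_closure_image[OF G(1)] that by (simp add: F_def J_def)
  have imF: "r s ` F = r s ` topspace X" if s: "s \<in> J" for s
  proof
    show "r s ` F \<subseteq> r s ` topspace X" using FX by blast
    show "r s ` topspace X \<subseteq> r s ` F"
    proof
      fix y assume y: "y \<in> r s ` topspace X"
      then have "r s y = y" "y \<in> F" using in_image_iff im[OF s] s Jp(2) by blast+
      then show "y \<in> r s ` F" by (metis imageI)
    qed
  qed
  \<comment> \<open>Convergence of the net over \<open>J\<close> requires \<open>F\<close> to be the
    closure of the images indexed by \<open>J\<close>, whereas it is defined by those indexed by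
    \<open>G\<close>.\<close>
  have FJ: "F = X closure_of (\<Union>s\<in>J. r s ` topspace X)"
  proof
    show "F \<subseteq> X closure_of (\<Union>s\<in>J. r s ` topspace X)"
      unfolding F_def using Jp(1) by (intro closure_of_mono) blast
    show "X closure_of (\<Union>s\<in>J. r s ` topspace X) \<subseteq> F"
      using im Fcl by (intro closure_of_minimal) blast+
  qed
  have sub: "subtopology (subtopology X F) (r s ` topspace X) = subtopology X (r s ` topspace X)" if "s \<in> J" for s
    using im[OF that] by (simp add: subtopology_subtopology Int_absorb1)
  have dJ': "up_directed J (Restr le J)"
    unfolding up_directed_def
  proof (intro conjI ballI)
    show "J \<noteq> {}" using up_directed_nonempty[OF dJ] .
    fix s t assume st: "s \<in> J" "t \<in> J"
    from up_directed_bound[OF dJ st] st show "\<exists>u\<in>J. (s, u) \<in> Restr le J \<and> (t, u) \<in> Restr le J" by blast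
  qed
  have trJ: "trans (Restr le J)" using le_trans by (rule trans_Restr)
  have sup: "is_sup I le (range \<sigma>) s \<longleftrightarrow> is_sup J (Restr le J) (range \<sigma>) s"
    if \<sigma>: "increasing_in J (Restr le J) \<sigma>" for \<sigma> s
  proof -
    have \<sigma>': "increasing_in J le \<sigma>" using \<sigma> by (auto simp: increasing_in_def)
    then obtain s' where s': "is_sup I le (range \<sigma>) s'" using sup_ex increasing_in_sub Jp(2) by blast
    have s'J: "s' \<in> J" using Jp(3) \<sigma>' s' by blast
    have \<sigma>J: "\<sigma> n \<in> J" for n using \<sigma>' by (auto simp: increasing_in_def)
    have 1: "is_sup J (Restr le J) (range \<sigma>) s'"
      using s' s'J \<sigma>J Jp(2) unfolding is_sup_def by blast
    show ?thesis
    proof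
      assume s: "is_sup I le (range \<sigma>) s"
      then have "(s, s') \<in> le" "(s', s) \<in> le" using s' by (auto simp: is_sup_def)
      then have "s = s'" using le_antisym by (meson antisymD)
      then show "is_sup J (Restr le J) (range \<sigma>) s" using 1 by simp
    next
      assume s: "is_sup J (Restr le J) (range \<sigma>) s"
      then have "(s, s') \<in> le" "(s', s) \<in> le" using 1 by (auto simp: is_sup_def)
      then have "s = s'" using le_antisym by (meson antisymD)
      then show "is_sup I le (range \<sigma>) s" using s' by simp
    qed
  qed
  show "retractional_skeleton (subtopology X F) J (Restr le J) r"
    unfolding retractional_skeleton_def tF
  proof (intro conjI ballI allI impI)
    show "compact_space (subtopology X F)"
      using Fcl compact closedin_compact_space compact_space_subtopology by blast
    show "tychonoff_space (subtopology X F)"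
      using tych completely_regular_space_subtopology Hausdorff_space_subtopology
      unfolding tychonoff_space_def by blast
    show "partial_order_on J (Restr le J)"
      unfolding partial_order_on_def preorder_on_def
      using trJ le_refl le_antisym Jp(2) by (auto simp: refl_on_def antisym_def)
    show "up_directed J (Restr le J)" by fact
    show "sigma_complete J (Restr le J)"
      unfolding sigma_complete_def
    proof (intro allI impI)
      fix \<sigma> assume \<sigma>: "increasing_in J (Restr le J) \<sigma>"
      then have "increasing_in I le \<sigma>" using Jp(2) by (auto simp: increasing_in_def)
      then show "\<exists>s. is_sup J (Restr le J) (range \<sigma>) s" using sup_ex sup[OF \<sigma>] by metis
    qed
  next
    fix s assume s: "s \<in> J"
    then have sI: "s \<in> I" using Jp(2) by blast
    have "continuous_map (subtopology X F) (subtopology X F) (r s)"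
      using im[OF s] FX by (auto simp: continuous_map_in_subtopology
          intro: continuous_map_from_subtopology continuous[OF sI])
    then show "retraction_on (subtopology X F) (r s)"
      unfolding retraction_on_def tF using idem[OF sI] FX by blast
    show "compact_space (subtopology (subtopology X F) (r s ` F))"
      "metrizable_space (subtopology (subtopology X F) (r s ` F))"
      using image_compact[OF sI] image_metrizable[OF sI] by (simp_all add: imF[OF s] sub[OF s])
  next
    fix s t x assume "(s, t) \<in> Restr le J" "x \<in> F"
    then have "(s, t) \<in> le" "x \<in> topspace X" using FX by auto
    then show "r s x = r t (r s x)" "r s x = r s (r t x)" using comp_le by metis+
  next
    fix \<sigma> s x assume *: "increasing_in J (Restr le J) \<sigma> \<and> is_sup J (Restr le J) (range \<sigma>) s" and x: "x \<in> F"
    have "is_sup I le (range \<sigma>) s" using sup * by blast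
    moreover have "increasing_in I le \<sigma>" and \<sigma>J: "\<And>n. \<sigma> n \<in> J" and sJ: "s \<in> J"
      using Jp(2) * by (auto simp: increasing_in_def is_sup_def)
    ultimately have "limitin X (\<lambda>n. r (\<sigma> n) x) (r s x) sequentially" using sup_limit x FX by blast
    moreover have "r s x \<in> F" "\<And>n. r (\<sigma> n) x \<in> F" using im sJ \<sigma>J x FX by blast+
    ultimately show "limitin (subtopology X F) (\<lambda>n. r (\<sigma> n) x) (r s x) sequentially"
      unfolding limitin_subtopology by simp
  next
    fix x assume x: "x \<in> F"
    then have xX: "x \<in> topspace X" using FX by blast
    have "net_limit X J le (\<lambda>s. r s x) x"
      using net_limit_directed[OF Jp(2) dJ xX] x FJ by simp
    then have lim: "\<exists>s\<in>J. \<forall>t\<in>J. (s, t) \<in> le \<longrightarrow> r t x \<in> U" if "openin X U" "x \<in> U" for U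
      using that unfolding net_limit_iff[OF dJ le_trans] by blast
    show "net_limit (subtopology X F) J (Restr le J) (\<lambda>s. r s x) x"
      unfolding net_limit_iff[OF dJ' trJ] tF
    proof (intro conjI allI impI)
      show "x \<in> F" by fact
      fix U assume "openin (subtopology X F) U \<and> x \<in> U"
      then obtain V where V: "openin X V" "U = V \<inter> F" "x \<in> V" by (auto simp: openin_subtopology)
      obtain s where s: "s \<in> J" "\<forall>t\<in>J. (s, t) \<in> le \<longrightarrow> r t x \<in> V" using lim[OF V(1,3)] by blast
      have "r t x \<in> U" if "t \<in> J" "(s, t) \<in> Restr le J" for t
        using s(2) that im[OF that(1)] xX V(2) by blast
      then show "\<exists>s\<in>J. \<forall>t\<in>J. (s, t) \<in> Restr le J \<longrightarrow> r t x \<in> U" using s(1) by blast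
    qed
  qed
  show "induced_set (subtopology X F) J r = induced_set X I r \<inter> F"
  proof
    show "induced_set (subtopology X F) J r \<subseteq> induced_set X I r \<inter> F"
    proof
      fix x assume "x \<in> induced_set (subtopology X F) J r"
      then obtain s where "s \<in> J" "x \<in> r s ` F" unfolding induced_set_def tF by blast
      then have "s \<in> J" "x \<in> r s ` topspace X" using imF by simp_all
      then show "x \<in> induced_set X I r \<inter> F" using im Jp(2) unfolding induced_set_def by blast
    qed
    show "induced_set X I r \<inter> F \<subseteq> induced_set (subtopology X F) J r"
    proof
      fix x assume x: "x \<in> induced_set X I r \<inter> F"
      let ?U = "\<Union>s\<in>G. r s ` topspace X"
      have "?U \<subseteq> induced_set X I r" using G(1) by (auto simp: induced_set_def)
      \<comment> \<open>The countably many points of \<open>C\<close> are fixed by retractions from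
        \<open>G\<close>. A chain above their indices has its supremum in \<open>J\<close>, and the
        closed image of that retraction contains \<open>C\<close> and hence
        \<open>x\<close>.\<close>
      then obtain C where C: "C \<subseteq> ?U" "countable C" "x \<in> X closure_of C"
        using countable_tightness[of x ?U] x unfolding F_def by blast
      have "\<exists>s. s \<in> G \<and> c \<in> r s ` topspace X" if "c \<in> C" for c using C(1) that by blast
      then obtain u where u: "\<And>c. c \<in> C \<Longrightarrow> u c \<in> G \<and> c \<in> r (u c) ` topspace X" by metis
      have "countable (u ` C)" "u ` C \<subseteq> G" using C(2) u by auto
      then obtain \<sigma> where \<sigma>: "increasing_in G le \<sigma>" "\<And>s. s \<in> u ` C \<Longrightarrow> \<exists>n. (s, \<sigma> n) \<in> le"
        using up_directed_countable_chain[OF G(2) le_trans] by metis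
      then obtain s where s: "is_sup I le (range \<sigma>) s" using sup_ex increasing_in_sub G(1) by blast
      have sI: "s \<in> I" and \<sigma>s: "\<And>n. (\<sigma> n, s) \<in> le" using s by (auto simp: is_sup_def)
      have "increasing_in J le \<sigma>" using \<sigma>(1) Jp(1) by (auto simp: increasing_in_def)
      then have sJ: "s \<in> J" using Jp(3) s by blast
      have "C \<subseteq> r s ` topspace X"
      proof
        fix c assume c: "c \<in> C"
        then obtain n where "(u c, \<sigma> n) \<in> le" using \<sigma>(2) by blast
        then have "(u c, s) \<in> le" using \<sigma>s le_trans by (meson transD)
        then show "c \<in> r s ` topspace X" using u[OF c] in_image_le by blast
      qed
      then have "x \<in> r s ` topspace X" using C(3) closure_of_minimal[OF _ image_closed[OF sI]] by blast
      then show "x \<in> induced_set (subtopology X F) J r"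
        unfolding induced_set_def tF using imF[OF sJ] sJ by blast
    qed
  qed
qed

end

section \<open>Small sets\<close>

definition small :: "'v::set_universe set \<Rightarrow> bool" where
  "small A \<longleftrightarrow> A \<in> range elts"

lemma small_elts [simp]: "small (elts x)"
  by (simp add: small_def)

lemma elts_set_of_small: "small A \<Longrightarrow> elts (set_of A) = A"
  by (simp add: small_def elts_set_of)

lemma small_subset: "small A \<Longrightarrow> B \<subseteq> A \<Longrightarrow> small B"
  using separation unfolding small_def by auto

lemma small_image:
  fixes f :: "'v::set_universe \<Rightarrow> 'v"
  shows "small A \<Longrightarrow> small (f ` A)"
  using replacement unfolding small_def by auto

lemma small_countable: "countable A \<Longrightarrow> small A"
proof (cases "A = {}")
  case True
  then show ?thesis using small_subset[OF small_elts] by blast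
next
  case False
  assume "countable A"
  then show ?thesis using range_from_nat_into[OF False] infinity[of "from_nat_into A"] by (simp add: small_def)
qed

lemma small_UN:
  fixes B :: "'v::set_universe \<Rightarrow> 'v set"
  assumes "small A" "\<And>x. x \<in> A \<Longrightarrow> small (B x)"
  shows "small (\<Union>x\<in>A. B x)"
proof -
  obtain u where u: "elts u = (\<lambda>x. set_of (B x)) ` A"
    using small_image[OF assms(1)] unfolding small_def by (metis imageE)
  have "\<Union> (elts ` elts u) = (\<Union>x\<in>A. B x)"
    unfolding u using elts_set_of_small[OF assms(2)] by simp
  then show ?thesis using union[of u] by (simp add: small_def)
qed

text \<open>Only an injection of the type of reals is given, so its range has to be shown to be a
  set: a real number is the supremum of a Dedekind cut, the cuts are coded in the power set of the
  copy of the rationals, and replacement turns these codes into the reals.\<close>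

lemma small_real:
  fixes \<rho> :: "real \<Rightarrow> 'v::set_universe"
  assumes "inj \<rho>"
  shows "small (range \<rho>)"
proof -
  have "small (\<rho> ` \<rat>)" using countable_rat by (intro small_countable) blast
  then obtain u where u: "elts u = \<rho> ` \<rat>" unfolding small_def by (metis imageE)
  obtain w where w: "elts w = {y. elts y \<subseteq> elts u}" using power[of u] by (metis imageE)
  define f where "f y = \<rho> (Sup {q \<in> \<rat>. \<rho> q \<in> elts y})" for y
  have "\<rho> t \<in> f ` elts w" for t
  proof -
    define y where "y = set_of (\<rho> ` {q \<in> \<rat>. q < t})"
    have "small (\<rho> ` {q \<in> \<rat>. q < t})" by (rule small_subset[OF small_elts[of u]]) (auto simp: u)
    then have y: "elts y = \<rho> ` {q \<in> \<rat>. q < t}" unfolding y_def by (rule elts_set_of_small)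
    have "{q \<in> \<rat>. \<rho> q \<in> elts y} = {q \<in> \<rat>. q < t}"
      unfolding y using assms by (auto simp: inj_image_mem_iff)
    moreover have "Sup {q \<in> \<rat>. q < t} = t"
    proof (rule cSup_eq_non_empty)
      show "{q \<in> \<rat>. q < t} \<noteq> {}" using Rats_dense_in_real[of "t - 1" t] by auto
      show "t \<le> b" if "\<And>x. x \<in> {q \<in> \<rat>. q < t} \<Longrightarrow> x \<le> b" for b
      proof (rule ccontr)
        assume "\<not> t \<le> b"
        then obtain q where "q \<in> \<rat>" "b < q" "q < t" using Rats_dense_in_real[of b t] by auto
        then show False using that[of q] by simp
      qed
    qed simp
    moreover have "y \<in> elts w" unfolding w using y u by auto
    ultimately show ?thesis by (intro image_eqI[of _ _ y]) (simp_all add: f_def)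
  qed
  then have "range \<rho> = f ` elts w" by (auto simp: f_def)
  then show ?thesis using small_image[OF small_elts] by metis
qed

lemma small_triples:
  assumes "small A" "small B" "small C"
  shows "small {opair (opair a b) c |a b c. a \<in> A \<and> b \<in> B \<and> c \<in> C}"
proof -
  have "small (\<Union>a\<in>A. \<Union>b\<in>B. (\<lambda>c. opair (opair a b) c) ` C)"
    using assms by (intro small_UN small_image)
  then show ?thesis by (rule small_subset) blast
qed

section \<open>Definability and reflection\<close>

lemma finite_fv: "finite (fv p)"
  by (induction p) auto

lemma holds_cong: "(\<And>i. i \<in> fv p \<Longrightarrow> e i = e' i) \<Longrightarrow> holds N e p \<longleftrightarrow> holds N e' p"
proof (induction p arbitrary: e e')
  case (Exists i p)
  have "holds N (e(i := a)) p \<longleftrightarrow> holds N (e'(i := a)) p" for a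
    using Exists.prems by (intro Exists.IH) auto
  then show ?case by simp
next
  case (Forall i p)
  have "holds N (e(i := a)) p \<longleftrightarrow> holds N (e'(i := a)) p" for a
    using Forall.prems by (intro Forall.IH) auto
  then show ?case by simp
next
  case (Neg p)
  have "holds N e p \<longleftrightarrow> holds N e' p" using Neg.prems by (intro Neg.IH) simp
  then show ?case by simp
next
  case (Conj p q)
  have "holds N e p \<longleftrightarrow> holds N e' p" "holds N e q \<longleftrightarrow> holds N e' q"
    using Conj.prems by (intro Conj.IH; simp)+
  then show ?case by simp
qed simp_all

lemma rename_bound:
  assumes "k \<notin> f ` (fv p - {i})"
  shows "holds N (e(k := a) \<circ> f(i := k)) p \<longleftrightarrow> holds N ((e \<circ> f)(i := a)) p"
  using assms by (intro holds_cong) auto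

text \<open>The map \<open>f\<close> need not be injective, so a bound variable is moved to an index
  outside the images of the remaining free variables; otherwise it could capture one of
  them.\<close>

lemma rename_formula: "\<exists>q. \<forall>e. holds N e q \<longleftrightarrow> holds N (e \<circ> f) p"
proof (induction p arbitrary: f)
  case (Mem i j)
  show ?case by (rule exI[of _ "Mem (f i) (f j)"]) simp
next
  case (Equal i j)
  show ?case by (rule exI[of _ "Equal (f i) (f j)"]) simp
next
  case (Neg p)
  then obtain q where "\<forall>e. holds N e q \<longleftrightarrow> holds N (e \<circ> f) p" by blast
  then have "\<forall>e. holds N e (Neg q) \<longleftrightarrow> holds N (e \<circ> f) (Neg p)" by (simp only: holds.simps simp_thms)
  then show ?case by blast
next
  case (Conj p p')
  obtain q where "\<forall>e. holds N e q \<longleftrightarrow> holds N (e \<circ> f) p" using Conj.IH(1) by blast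
  moreover obtain q' where "\<forall>e. holds N e q' \<longleftrightarrow> holds N (e \<circ> f) p'" using Conj.IH(2) by blast
  ultimately have "\<forall>e. holds N e (Conj q q') \<longleftrightarrow> holds N (e \<circ> f) (Conj p p')" by (simp only: holds.simps simp_thms)
  then show ?case by blast
next
  case (Exists i p)
  have "finite (f ` (fv p - {i}))" using finite_fv by simp
  then obtain k where k: "k \<notin> f ` (fv p - {i})" using ex_new_if_finite infinite_UNIV_nat by blast
  obtain q where q: "\<forall>e. holds N e q \<longleftrightarrow> holds N (e \<circ> f(i := k)) p" using Exists.IH by blast
  have "holds N e (Exists k q) \<longleftrightarrow> holds N (e \<circ> f) (Exists i p)" for e
    unfolding holds.simps q[rule_format] by (simp only: rename_bound[OF k])
  then show ?case by blast
next
  case (Forall i p)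
  have "finite (f ` (fv p - {i}))" using finite_fv by simp
  then obtain k where k: "k \<notin> f ` (fv p - {i})" using ex_new_if_finite infinite_UNIV_nat by blast
  obtain q where q: "\<forall>e. holds N e q \<longleftrightarrow> holds N (e \<circ> f(i := k)) p" using Forall.IH by blast
  have "holds N e (Forall k q) \<longleftrightarrow> holds N (e \<circ> f) (Forall i p)" for e
    unfolding holds.simps q[rule_format] by (simp only: rename_bound[OF k])
  then show ?case by blast
qed

text \<open>The predicate depends on finitely many entries of an environment.  In the rules for
  quantifiers the bound variable becomes entry 0 and the other entries move up by one, so that
  definability is established by introduction rules alone.\<close>

definition definable :: "((nat \<Rightarrow> 'v::set_universe) \<Rightarrow> bool) \<Rightarrow> bool" where
  "definable P \<longleftrightarrow> (\<exists>p. \<forall>e. holds UNIV e p \<longleftrightarrow> P e)"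

lemma definableI: "(\<And>e. holds UNIV e p \<longleftrightarrow> P e) \<Longrightarrow> definable P"
  unfolding definable_def by blast

lemma definable_mem: "definable (\<lambda>e. e i \<in> elts (e j))"
  by (rule definableI[of "Mem i j"]) simp

lemma definable_eq: "definable (\<lambda>e. e i = e j)"
  by (rule definableI[of "Equal i j"]) simp

lemma definable_not: "definable P \<Longrightarrow> definable (\<lambda>e. \<not> P e)"
  unfolding definable_def by (metis holds.simps(3))

lemma definable_conj: "definable P \<Longrightarrow> definable Q \<Longrightarrow> definable (\<lambda>e. P e \<and> Q e)"
  unfolding definable_def by (metis holds.simps(4))

lemma definable_disj: "definable P \<Longrightarrow> definable Q \<Longrightarrow> definable (\<lambda>e. P e \<or> Q e)"
  using definable_not[OF definable_conj[OF definable_not definable_not, of P Q]] by simp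

lemma definable_imp: "definable P \<Longrightarrow> definable Q \<Longrightarrow> definable (\<lambda>e. P e \<longrightarrow> Q e)"
  unfolding imp_conv_disj by (intro definable_disj definable_not)

lemma definable_iff: "definable P \<Longrightarrow> definable Q \<Longrightarrow> definable (\<lambda>e. P e \<longleftrightarrow> Q e)"
  unfolding iff_conv_conj_imp by (intro definable_conj definable_imp)

lemma definable_ex:
  fixes P :: "(nat \<Rightarrow> 'v::set_universe) \<Rightarrow> 'v \<Rightarrow> bool"
  assumes "definable (\<lambda>e. P (\<lambda>n. e (Suc n)) (e 0))"
  shows "definable (\<lambda>e. \<exists>x. P e x)"
proof -
  obtain p where p: "\<And>e :: nat \<Rightarrow> 'v. holds UNIV e p \<longleftrightarrow> P (\<lambda>n. e (Suc n)) (e 0)"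
    using assms unfolding definable_def by blast
  \<comment> \<open>The bound variable 0 will become \<open>k\<close> and \<open>Suc n\<close> will
    become \<open>n\<close>. Since \<open>n - 1\<close> undoes this shift, no free variable
    \<open>Suc n\<close> of \<open>p\<close> collides with \<open>k\<close>.\<close>
  obtain k where k: "k \<notin> (\<lambda>n. n - 1) ` fv p"
    using ex_new_if_finite[of "(\<lambda>n. n - 1) ` fv p"] finite_fv infinite_UNIV_nat by blast
  obtain q where q: "\<And>e :: nat \<Rightarrow> 'v. holds UNIV e q \<longleftrightarrow> holds UNIV (e \<circ> case_nat k (\<lambda>n. n)) p"
    using rename_formula[of UNIV "case_nat k (\<lambda>n. n)" p] by blast
  have "holds UNIV e (Exists k q) \<longleftrightarrow> (\<exists>x. P e x)" for e :: "nat \<Rightarrow> 'v"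
  proof -
    have "holds UNIV (e(k := x)) q \<longleftrightarrow> P e x" for x
    proof -
      have "holds UNIV (e(k := x)) q \<longleftrightarrow> holds UNIV (case_nat x e) p"
        unfolding q[of "e(k := x)"]
      proof (rule holds_cong)
        fix i assume i: "i \<in> fv p"
        show "(e(k := x) \<circ> case_nat k (\<lambda>n. n)) i = case_nat x e i"
        proof (cases i)
          case (Suc n)
          then have "n \<noteq> k" using i k by force
          then show ?thesis using Suc by simp
        qed simp
      qed
      also have "\<dots> \<longleftrightarrow> P e x" by (simp add: p)
      finally show ?thesis .
    qed
    then show ?thesis by simp
  qed
  then show ?thesis by (rule definableI)
qed

lemma definable_all: "definable (\<lambda>e. P (\<lambda>n. e (Suc n)) (e 0)) \<Longrightarrow> definable (\<lambda>e. \<forall>x. P e x)"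
  using definable_not[OF definable_ex[OF definable_not, of P]] by simp

lemma definable_bex:
  "definable (\<lambda>e. P (\<lambda>n. e (Suc n)) (e 0)) \<Longrightarrow> definable (\<lambda>e. \<exists>x\<in>elts (e i). P e x)"
  unfolding Bex_def by (intro definable_ex definable_conj definable_mem)

lemma definable_ball:
  "definable (\<lambda>e. P (\<lambda>n. e (Suc n)) (e 0)) \<Longrightarrow> definable (\<lambda>e. \<forall>x\<in>elts (e i). P e x)"
  unfolding Ball_def by (intro definable_all definable_imp definable_mem)

lemma definable_subset: "definable (\<lambda>e. elts (e i) \<subseteq> elts (e j))"
  unfolding subset_eq by (intro definable_ball definable_mem)

lemmas definable_intros = definable_mem definable_eq definable_subset definable_not definable_conj
  definable_disj definable_imp definable_iff definable_bex definable_ball definable_ex definable_all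

lemma set_of_doubleton_iff: "w = set_of {a, b} \<longleftrightarrow> (\<forall>v. v \<in> elts w \<longleftrightarrow> v = a \<or> v = b)"
proof
  assume "\<forall>v. v \<in> elts w \<longleftrightarrow> v = a \<or> v = b"
  then have "elts w = elts (set_of {a, b})" by (auto simp: elts_doubleton)
  then show "w = set_of {a, b}" by (rule extensionality)
qed (simp add: elts_doubleton)

lemma opair_iff:
  "z = opair a b \<longleftrightarrow> (\<forall>w. w \<in> elts z \<longleftrightarrow>
    (\<forall>v. v \<in> elts w \<longleftrightarrow> v = a) \<or> (\<forall>v. v \<in> elts w \<longleftrightarrow> v = a \<or> v = b))"
  unfolding opair_def set_of_doubleton_iff
  using set_of_doubleton_iff[of _ a a] set_of_doubleton_iff[of _ a b] by simp

lemma definable_eq_opair: "definable (\<lambda>e. e i = opair (e j) (e k))"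
  unfolding opair_iff by (intro definable_intros)

lemma definable_opair_mem: "definable (\<lambda>e. opair (e i) (e j) \<in> elts (e k))"
proof -
  have "definable (\<lambda>e. \<exists>z\<in>elts (e k). z = opair (e i) (e j))"
    by (intro definable_intros definable_eq_opair)
  then show ?thesis by simp
qed

lemma definable_triple_mem: "definable (\<lambda>e. opair (opair (e i) (e j)) (e l) \<in> elts (e k))"
proof -
  have "definable (\<lambda>e. \<exists>z. z = opair (e i) (e j) \<and> opair z (e l) \<in> elts (e k))"
    by (intro definable_intros definable_eq_opair definable_opair_mem)
  then show ?thesis by simp
qed

section \<open>Combining statements about suitable models, and reflecting existential
  formulas\<close>

lemma for_every_suitable_mono:
  "for_every_suitable_model P \<Longrightarrow> (\<And>M. P M \<Longrightarrow> Q M) \<Longrightarrow> for_every_suitable_model Q"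
  unfolding for_every_suitable_model_def by meson

lemma for_every_suitable_superset:
  assumes "countable C"
  shows "for_every_suitable_model (\<lambda>M. C \<subseteq> elts M)"
  unfolding for_every_suitable_model_def suitable_def
  using elts_set_of_small[OF small_countable[OF assms]] assms
  by (intro exI[of _ "[]"] exI[of _ "set_of C"]) simp

lemma for_every_suitable_const: "\<phi> \<Longrightarrow> for_every_suitable_model (\<lambda>M. \<phi>)"
  by (rule for_every_suitable_mono[OF for_every_suitable_superset[of "{}"]]) simp_all

lemma for_every_suitable_conj:
  assumes "for_every_suitable_model P" "for_every_suitable_model Q"
  shows "for_every_suitable_model (\<lambda>M. P M \<and> Q M)"
proof -
  obtain \<Phi> Y where P: "countable (elts Y)" "\<And>M. suitable M \<Phi> Y \<Longrightarrow> P M"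
    using assms(1) unfolding for_every_suitable_model_def by blast
  obtain \<Psi> Z where Q: "countable (elts Z)" "\<And>M. suitable M \<Psi> Z \<Longrightarrow> Q M"
    using assms(2) unfolding for_every_suitable_model_def by blast
  define W where "W = set_of (elts Y \<union> elts Z)"
  have "countable (elts Y \<union> elts Z)" using P(1) Q(1) by simp
  moreover from this have W: "elts W = elts Y \<union> elts Z"
    unfolding W_def by (intro elts_set_of_small small_countable)
  ultimately have "countable (elts W)" by simp
  moreover have "P M \<and> Q M" if "suitable M (\<Phi> @ \<Psi>) W" for M
    using that P(2)[of M] Q(2)[of M] unfolding suitable_def W by auto
  ultimately show ?thesis unfolding for_every_suitable_model_def by blast
qed

text \<open>The Tarski-Vaught argument: absoluteness of \<open>Exists 0 p\<close> gives a witness in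
  \<open>M\<close> for the relativized formula, and absoluteness of \<open>p\<close> makes it a
  witness for the formula itself.\<close>

lemma for_every_suitable_reflect:
  assumes "definable P"
  shows "for_every_suitable_model (\<lambda>M. \<forall>e. range e \<subseteq> elts M \<longrightarrow>
    (\<exists>x. P (case_nat x e)) \<longrightarrow> (\<exists>x\<in>elts M. P (case_nat x e)))"
proof -
  obtain p where p: "\<And>e. holds UNIV e p \<longleftrightarrow> P e" using assms unfolding definable_def by blast
  have upd: "(case_nat y e)(0 := x) = case_nat x e" for x y and e :: "nat \<Rightarrow> 'a"
    by (auto split: nat.split)
  have "\<exists>x\<in>elts M. P (case_nat x e)"
    if M: "absolute p M" "absolute (Exists 0 p) M" and e: "range e \<subseteq> elts M" and x: "P (case_nat x e)"
    for M e x
  proof -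
    \<comment> \<open>Entry 0 is overwritten by the quantifier; it is filled with \<open>e 0\<close>
      to keep the whole environment inside \<open>M\<close>.\<close>
    have "\<And>i. case_nat (e 0) e i \<in> elts M" using e by (auto split: nat.split)
    then have "holds (elts M) (case_nat (e 0) e) (Exists 0 p) \<longleftrightarrow> holds UNIV (case_nat (e 0) e) (Exists 0 p)"
      using M(2) unfolding absolute_def by blast
    also have "holds UNIV (case_nat (e 0) e) (Exists 0 p)" using x by (auto simp: p upd)
    finally obtain y where y: "y \<in> elts M" "holds (elts M) (case_nat y e) p" by (auto simp: upd)
    have "\<And>i. case_nat y e i \<in> elts M" using e y(1) by (auto split: nat.split)
    then have "holds (elts M) (case_nat y e) p \<longleftrightarrow> P (case_nat y e)"
      using M(1) p unfolding absolute_def by blast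
    then show ?thesis using y by blast
  qed
  then show ?thesis
    unfolding for_every_suitable_model_def suitable_def
    by (intro exI[of _ "[p, Exists 0 p]"] exI[of _ "set_of {undefined}"]) (auto simp: elts_singleton)
qed

text \<open>The infinite environment stays inside \<open>M\<close> because the last parameter is
  repeated in all further entries; the same is done for more parameters below.\<close>

lemma reflect2:
  assumes "definable (\<lambda>e. P (e 0) (e 1) (e 2))"
  shows "for_every_suitable_model (\<lambda>M. \<forall>a\<in>elts M. \<forall>b\<in>elts M.
    (\<exists>x. P x a b) \<longrightarrow> (\<exists>x\<in>elts M. P x a b))"
proof (rule for_every_suitable_mono[OF for_every_suitable_reflect[OF assms]], intro ballI)
  fix M a b :: 'a
  assume R: "\<forall>e. range e \<subseteq> elts M \<longrightarrow>
    (\<exists>x. P (case_nat x e 0) (case_nat x e 1) (case_nat x e 2)) \<longrightarrow>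
    (\<exists>x\<in>elts M. P (case_nat x e 0) (case_nat x e 1) (case_nat x e 2))" and "a \<in> elts M" "b \<in> elts M"
  then have "range (case_nat a (\<lambda>_. b)) \<subseteq> elts M" by (auto split: nat.split)
  from R[rule_format, OF this] show "(\<exists>x. P x a b) \<longrightarrow> (\<exists>x\<in>elts M. P x a b)"
    by (auto simp: numeral_eq_Suc)
qed

lemma reflect3:
  assumes "definable (\<lambda>e. P (e 0) (e 1) (e 2) (e 3))"
  shows "for_every_suitable_model (\<lambda>M. \<forall>a\<in>elts M. \<forall>b\<in>elts M. \<forall>c\<in>elts M.
    (\<exists>x. P x a b c) \<longrightarrow> (\<exists>x\<in>elts M. P x a b c))"
proof (rule for_every_suitable_mono[OF for_every_suitable_reflect[OF assms]], intro ballI)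
  fix M a b c :: 'a
  assume R: "\<forall>e. range e \<subseteq> elts M \<longrightarrow>
    (\<exists>x. P (case_nat x e 0) (case_nat x e 1) (case_nat x e 2) (case_nat x e 3)) \<longrightarrow>
    (\<exists>x\<in>elts M. P (case_nat x e 0) (case_nat x e 1) (case_nat x e 2) (case_nat x e 3))"
    and "a \<in> elts M" "b \<in> elts M" "c \<in> elts M"
  then have "range (case_nat a (case_nat b (\<lambda>_. c))) \<subseteq> elts M" by (auto split: nat.split)
  from R[rule_format, OF this] show "(\<exists>x. P x a b c) \<longrightarrow> (\<exists>x\<in>elts M. P x a b c)"
    by (auto simp: numeral_eq_Suc)
qed

lemma reflect7:
  assumes "definable (\<lambda>e. P (e 0) (e 1) (e 2) (e 3) (e 4) (e 5) (e 6) (e 7))"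
  shows "for_every_suitable_model (\<lambda>M. \<forall>a\<in>elts M. \<forall>b\<in>elts M. \<forall>c\<in>elts M. \<forall>d\<in>elts M.
    \<forall>f\<in>elts M. \<forall>g\<in>elts M. \<forall>h\<in>elts M.
    (\<exists>x. P x a b c d f g h) \<longrightarrow> (\<exists>x\<in>elts M. P x a b c d f g h))"
proof (rule for_every_suitable_mono[OF for_every_suitable_reflect[OF assms]], intro ballI)
  fix M a b c d f g h :: 'a
  let ?e = "case_nat a (case_nat b (case_nat c (case_nat d (case_nat f (case_nat g (\<lambda>_. h))))))"
  assume R: "\<forall>e. range e \<subseteq> elts M \<longrightarrow>
    (\<exists>x. P (case_nat x e 0) (case_nat x e 1) (case_nat x e 2) (case_nat x e 3)
       (case_nat x e 4) (case_nat x e 5) (case_nat x e 6) (case_nat x e 7)) \<longrightarrow>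
    (\<exists>x\<in>elts M. P (case_nat x e 0) (case_nat x e 1) (case_nat x e 2) (case_nat x e 3)
       (case_nat x e 4) (case_nat x e 5) (case_nat x e 6) (case_nat x e 7))"
    and "a \<in> elts M" "b \<in> elts M" "c \<in> elts M" "d \<in> elts M" "f \<in> elts M" "g \<in> elts M" "h \<in> elts M"
  then have "range ?e \<subseteq> elts M" by (auto split: nat.split)
  from R[rule_format, OF this]
  show "(\<exists>x. P x a b c d f g h) \<longrightarrow> (\<exists>x\<in>elts M. P x a b c d f g h)"
    by (auto simp: numeral_eq_Suc)
qed

lemma reflect6:
  assumes "definable (\<lambda>e. P (e 0) (e 1) (e 2) (e 3) (e 4) (e 5) (e 6))"
  shows "for_every_suitable_model (\<lambda>M. \<forall>a\<in>elts M. \<forall>b\<in>elts M. \<forall>c\<in>elts M. \<forall>d\<in>elts M. \<forall>f\<in>elts M.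
    \<forall>g\<in>elts M. (\<exists>x. P x a b c d f g) \<longrightarrow> (\<exists>x\<in>elts M. P x a b c d f g))"
  by (rule for_every_suitable_mono[OF reflect7[OF assms]]) blast

lemma reflect5:
  assumes "definable (\<lambda>e. P (e 0) (e 1) (e 2) (e 3) (e 4) (e 5))"
  shows "for_every_suitable_model (\<lambda>M. \<forall>a\<in>elts M. \<forall>b\<in>elts M. \<forall>c\<in>elts M. \<forall>d\<in>elts M. \<forall>f\<in>elts M.
    (\<exists>x. P x a b c d f) \<longrightarrow> (\<exists>x\<in>elts M. P x a b c d f))"
  by (rule for_every_suitable_mono[OF reflect7[OF assms]]) blast

lemma reflect4:
  assumes "definable (\<lambda>e. P (e 0) (e 1) (e 2) (e 3) (e 4))"
  shows "for_every_suitable_model (\<lambda>M. \<forall>a\<in>elts M. \<forall>b\<in>elts M. \<forall>c\<in>elts M. \<forall>d\<in>elts M.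
    (\<exists>x. P x a b c d) \<longrightarrow> (\<exists>x\<in>elts M. P x a b c d))"
  by (rule for_every_suitable_mono[OF reflect7[OF assms]]) blast

section \<open>Functions inside the universe\<close>

lemma opair_mem_funs:
  assumes "f \<in> funs (elts K) B"
  shows "opair x y \<in> elts f \<longleftrightarrow> x \<in> elts K \<and> y = app f x"
proof -
  obtain g where g: "f = fun_graph (elts K) g" using assms by (auto simp: funs_def)
  have "x \<in> elts K \<Longrightarrow> app f x = g x" unfolding g by (rule app_fun_graph)
  then show ?thesis unfolding g elts_fun_graph by (auto simp: opair_inject)
qed

lemma funs_app_in: "f \<in> funs (elts K) B \<Longrightarrow> x \<in> elts K \<Longrightarrow> app f x \<in> B"
  by (auto simp: funs_def app_fun_graph)

lemma funs_elts:
  assumes "f \<in> funs (elts K) B"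
  shows "elts f = (\<lambda>x. opair x (app f x)) ` elts K"
proof -
  obtain g where g: "f = fun_graph (elts K) g" using assms by (auto simp: funs_def)
  then show ?thesis by (simp add: elts_fun_graph app_fun_graph)
qed

lemma funs_eqI:
  assumes "f \<in> funs (elts K) B" "g \<in> funs (elts K) C" "\<And>x. x \<in> elts K \<Longrightarrow> app f x = app g x"
  shows "f = g"
  using assms by (intro extensionality) (simp add: funs_elts)

lemma fun_graph_funs: "(\<And>x. x \<in> elts K \<Longrightarrow> g x \<in> B) \<Longrightarrow> fun_graph (elts K) g \<in> funs (elts K) B"
  by (auto simp: funs_def)

lemma fun_graph_mem: "z \<in> elts (fun_graph (elts K) g) \<longleftrightarrow> (\<exists>x\<in>elts K. z = opair x (g x))"
  by (auto simp: elts_fun_graph)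

lemma
  assumes "set_space K \<tau>"
  shows openin_set_space: "openin (top_of \<tau>) U \<longleftrightarrow> U \<in> elts ` elts \<tau>"
    and topspace_set_space: "topspace (top_of \<tau>) = elts K"
    and open_subset_set_space: "u \<in> elts \<tau> \<Longrightarrow> elts u \<subseteq> elts K"
proof -
  show *: "openin (top_of \<tau>) U \<longleftrightarrow> U \<in> elts ` elts \<tau>" for U
    using assms unfolding set_space_def top_of_def by (subst topology_inverse') auto
  show t: "topspace (top_of \<tau>) = elts K" using assms by (simp add: set_space_def)
  show "u \<in> elts \<tau> \<Longrightarrow> elts u \<subseteq> elts K" using *[of "elts u"] t openin_subset by fastforce
qed

lemma Cfun_funs: "f \<in> Cfun \<rho> K \<tau> \<Longrightarrow> f \<in> funs (elts K) (range \<rho>)"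
  by (simp add: Cfun_def)

lemma Cfun_continuous:
  "f \<in> Cfun \<rho> K \<tau> \<Longrightarrow> continuous_map (top_of \<tau>) euclideanreal (\<lambda>x. inv \<rho> (app f x))"
  by (simp add: Cfun_def)

lemma Cfun_app_eq:
  assumes "f \<in> Cfun \<rho> K \<tau>" "x \<in> elts K" "y \<in> elts K"
  shows "app f x = app f y \<longleftrightarrow> inv \<rho> (app f x) = inv \<rho> (app f y)"
  using funs_app_in[OF Cfun_funs[OF assms(1)]] assms by (metis f_inv_into_f)

lemma fun_graph_Cfun:
  assumes "inj \<rho>" "set_space K \<tau>" "continuous_map (top_of \<tau>) euclideanreal g"
  shows "fun_graph (elts K) (\<lambda>x. \<rho> (g x)) \<in> Cfun \<rho> K \<tau>"
  unfolding Cfun_def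
proof safe
  show "fun_graph (elts K) (\<lambda>x. \<rho> (g x)) \<in> funs (elts K) (range \<rho>)" by (rule fun_graph_funs) simp
  show "continuous_map (top_of \<tau>) euclideanreal (\<lambda>x. inv \<rho> (app (fun_graph (elts K) (\<lambda>x. \<rho> (g x))) x))"
    using assms(3) by (rule continuous_map_eq)
      (simp add: topspace_set_space[OF assms(2)] app_fun_graph inv_f_f[OF assms(1)])
qed

text \<open>The copy of the natural numbers inside the chosen copy of the reals. It and its elements
  are parameters of every model considered, and countability is expressed by enumerations indexed by
  it.\<close>

definition nats :: "(real \<Rightarrow> 'v) \<Rightarrow> 'v::set_universe" where
  "nats \<rho> = set_of (range (\<lambda>n::nat. \<rho> (real n)))"

definition interval :: "(real \<Rightarrow> 'v) \<Rightarrow> real \<times> real \<Rightarrow> 'v::set_universe" where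
  "interval \<rho> = (\<lambda>(p, q). set_of (\<rho> ` {p<..<q}))"

definition intervals :: "(real \<Rightarrow> 'v) \<Rightarrow> 'v::set_universe" where
  "intervals \<rho> = set_of (interval \<rho> ` (\<rat> \<times> \<rat>))"

lemma elts_nats: "elts (nats \<rho>) = range (\<lambda>n::nat. \<rho> (real n))"
  unfolding nats_def by (rule elts_set_of_small) (simp add: small_countable)

lemma elts_interval: "inj \<rho> \<Longrightarrow> elts (interval \<rho> (p, q)) = \<rho> ` {p<..<q}"
  unfolding interval_def prod.case by (intro elts_set_of_small small_subset[OF small_real]) auto

lemma countable_intervals: "countable (interval \<rho> ` (\<rat> \<times> \<rat>))"
  using countable_rat by (intro countable_image countable_SIGMA)

lemma elts_intervals: "elts (intervals \<rho>) = interval \<rho> ` (\<rat> \<times> \<rat>)"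
  unfolding intervals_def by (rule elts_set_of_small) (simp add: small_countable countable_intervals)

text \<open>A first-order rendering of \<open>f \<in> Cfun \<rho> K \<tau>\<close>, where \<open>B\<close> is the set of rational intervals.\<close>

definition cont_fun :: "'v::set_universe \<Rightarrow> 'v \<Rightarrow> 'v \<Rightarrow> 'v \<Rightarrow> bool" where
  "cont_fun B K \<tau> f \<longleftrightarrow>
    (\<forall>z\<in>elts f. \<exists>x\<in>elts K. \<exists>W\<in>elts B. \<exists>y\<in>elts W. z = opair x y) \<and>
    (\<forall>x\<in>elts K. \<exists>y. opair x y \<in> elts f) \<and>
    (\<forall>x y z. opair x y \<in> elts f \<and> opair x z \<in> elts f \<longrightarrow> y = z) \<and>
    (\<forall>W\<in>elts B. \<exists>U\<in>elts \<tau>. \<forall>x\<in>elts K. x \<in> elts U \<longleftrightarrow> (\<exists>y\<in>elts W. opair x y \<in> elts f))"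

lemma definable_cont_fun: "definable (\<lambda>e. cont_fun (e i) (e j) (e k) (e l))"
  unfolding cont_fun_def by (intro definable_intros definable_eq_opair definable_opair_mem)

lemma rational_interval:
  assumes "open S" "(t::real) \<in> S"
  shows "\<exists>p\<in>\<rat>. \<exists>q\<in>\<rat>. t \<in> {p<..<q} \<and> {p<..<q} \<subseteq> S"
proof -
  obtain e where e: "e > 0" "\<And>y. \<bar>y - t\<bar> < e \<Longrightarrow> y \<in> S"
    using assms unfolding open_dist dist_real_def by metis
  obtain p where p: "p \<in> \<rat>" "t - e < p" "p < t" using Rats_dense_in_real[of "t - e" t] e by auto
  obtain q where q: "q \<in> \<rat>" "t < q" "q < t + e" using Rats_dense_in_real[of t "t + e"] e by auto
  have "{p<..<q} \<subseteq> S" using p q e(2) by (auto simp: abs_less_iff)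
  then show ?thesis using p q by auto
qed

text \<open>The rational intervals form a base of the real line, so continuity need only be tested
  on their preimages; being countable in number, they can all be put into a model. They also cover
  the line, so the first clause of \<open>cont_fun\<close> says that values lie in the range of
  \<open>\<rho>\<close>.\<close>

lemma cont_fun_iff:
  assumes \<rho>: "inj \<rho>" and K: "set_space K \<tau>"
  shows "cont_fun (intervals \<rho>) K \<tau> f \<longleftrightarrow> f \<in> Cfun \<rho> K \<tau>"
proof
  assume f: "f \<in> Cfun \<rho> K \<tau>"
  note fF = Cfun_funs[OF f] and pair = opair_mem_funs[OF Cfun_funs[OF f]]
  show "cont_fun (intervals \<rho>) K \<tau> f"
    unfolding cont_fun_def
  proof (intro conjI ballI allI impI)
    fix z assume "z \<in> elts f"
    then obtain x where x: "x \<in> elts K" "z = opair x (app f x)" using funs_elts[OF fF] by auto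
    obtain t where t: "app f x = \<rho> t" using funs_app_in[OF fF x(1)] by blast
    obtain p q where pq: "p \<in> \<rat>" "q \<in> \<rat>" "t \<in> {p<..<q}" using rational_interval[of UNIV t] by auto
    then have "app f x \<in> elts (interval \<rho> (p, q))" by (simp add: t elts_interval[OF \<rho>])
    moreover have "interval \<rho> (p, q) \<in> elts (intervals \<rho>)" using pq by (auto simp: elts_intervals)
    ultimately show "\<exists>x\<in>elts K. \<exists>W\<in>elts (intervals \<rho>). \<exists>y\<in>elts W. z = opair x y" using x by blast
  next
    fix W assume "W \<in> elts (intervals \<rho>)"
    then obtain p q where W: "W = interval \<rho> (p, q)" by (auto simp: elts_intervals)
    have "openin (top_of \<tau>) {x \<in> topspace (top_of \<tau>). inv \<rho> (app f x) \<in> {p<..<q}}"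
      using Cfun_continuous[OF f] by (rule openin_continuous_map_preimage) simp
    then obtain U where U: "U \<in> elts \<tau>" "elts U = {x \<in> elts K. inv \<rho> (app f x) \<in> {p<..<q}}"
      using openin_set_space[OF K] topspace_set_space[OF K] by auto
    have "x \<in> elts U \<longleftrightarrow> (\<exists>y\<in>elts W. opair x y \<in> elts f)" if x: "x \<in> elts K" for x
    proof -
      obtain t where t: "app f x = \<rho> t" using funs_app_in[OF fF x] by blast
      have "(\<exists>y\<in>elts W. opair x y \<in> elts f) \<longleftrightarrow> app f x \<in> \<rho> ` {p<..<q}"
        using x by (auto simp: W elts_interval[OF \<rho>] pair)
      also have "\<dots> \<longleftrightarrow> inv \<rho> (app f x) \<in> {p<..<q}"
        unfolding t by (simp add: inj_image_mem_iff[OF \<rho>] inv_f_f[OF \<rho>])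
      also have "\<dots> \<longleftrightarrow> x \<in> elts U" using x unfolding U(2) by simp
      finally show ?thesis by blast
    qed
    then show "\<exists>U\<in>elts \<tau>. \<forall>x\<in>elts K. x \<in> elts U \<longleftrightarrow> (\<exists>y\<in>elts W. opair x y \<in> elts f)"
      using U(1) by blast
  qed (auto simp: pair)
next
  assume f: "cont_fun (intervals \<rho>) K \<tau> f"
  then have 1: "\<And>z. z \<in> elts f \<Longrightarrow> \<exists>x\<in>elts K. \<exists>W\<in>elts (intervals \<rho>). \<exists>y\<in>elts W. z = opair x y"
    and 2: "\<And>x. x \<in> elts K \<Longrightarrow> \<exists>y. opair x y \<in> elts f"
    and 3: "\<And>x y z. opair x y \<in> elts f \<Longrightarrow> opair x z \<in> elts f \<Longrightarrow> y = z"
    and 4: "\<And>W. W \<in> elts (intervals \<rho>) \<Longrightarrow>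
      \<exists>U\<in>elts \<tau>. \<forall>x\<in>elts K. x \<in> elts U \<longleftrightarrow> (\<exists>y\<in>elts W. opair x y \<in> elts f)"
    unfolding cont_fun_def by blast+
  obtain g where g: "\<And>x. x \<in> elts K \<Longrightarrow> opair x (g x) \<in> elts f" using 2 by metis
  have "elts f = (\<lambda>x. opair x (g x)) ` elts K"
  proof
    show "elts f \<subseteq> (\<lambda>x. opair x (g x)) ` elts K"
    proof
      fix z assume z: "z \<in> elts f"
      then obtain x y where xy: "x \<in> elts K" "z = opair x y" using 1 by blast
      then have "y = g x" using 3 g z by blast
      then show "z \<in> (\<lambda>x. opair x (g x)) ` elts K" using xy by blast
    qed
  qed (use g in blast)
  then have fg: "f = fun_graph (elts K) g" by (intro extensionality) (simp add: elts_fun_graph)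
  have "g x \<in> range \<rho>" if x: "x \<in> elts K" for x
  proof -
    obtain x' W y where "W \<in> elts (intervals \<rho>)" "y \<in> elts W" "opair x (g x) = opair x' y"
      using 1[OF g[OF x]] by blast
    then show ?thesis by (auto simp: opair_inject elts_intervals elts_interval[OF \<rho>])
  qed
  then have fF: "f \<in> funs (elts K) (range \<rho>)" unfolding fg by (rule fun_graph_funs)
  note pair = opair_mem_funs[OF fF]
  have "continuous_map (top_of \<tau>) euclideanreal (\<lambda>x. inv \<rho> (app f x))"
    unfolding continuous_map
  proof (intro conjI allI impI)
    fix S :: "real set" assume S: "openin euclideanreal S"
    show "openin (top_of \<tau>) {x \<in> topspace (top_of \<tau>). inv \<rho> (app f x) \<in> S}"
    proof (subst openin_subopen, intro ballI)
      fix x assume "x \<in> {x \<in> topspace (top_of \<tau>). inv \<rho> (app f x) \<in> S}"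
      then have x: "x \<in> elts K" "inv \<rho> (app f x) \<in> S" using topspace_set_space[OF K] by auto
      then obtain p q where pq: "p \<in> \<rat>" "q \<in> \<rat>" "inv \<rho> (app f x) \<in> {p<..<q}" "{p<..<q} \<subseteq> S"
        using rational_interval[of S "inv \<rho> (app f x)"] S by auto
      then have "interval \<rho> (p, q) \<in> elts (intervals \<rho>)" by (auto simp: elts_intervals)
      then obtain U where U: "U \<in> elts \<tau>"
        "\<And>y. y \<in> elts K \<Longrightarrow> y \<in> elts U \<longleftrightarrow> app f y \<in> \<rho> ` {p<..<q}"
        using 4[of "interval \<rho> (p, q)"] by (auto simp: pair elts_interval[OF \<rho>])
      have inv: "app f y \<in> \<rho> ` {p<..<q} \<longleftrightarrow> inv \<rho> (app f y) \<in> {p<..<q}" if y: "y \<in> elts K" for y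
      proof -
        obtain t where "app f y = \<rho> t" using funs_app_in[OF fF y] by blast
        then show ?thesis by (simp add: inj_image_mem_iff[OF \<rho>] inv_f_f[OF \<rho>])
      qed
      have "openin (top_of \<tau>) (elts U)" using U(1) openin_set_space[OF K] by blast
      moreover have "x \<in> elts U" using U(2) inv x(1) pq(3) by blast
      moreover have "elts U \<subseteq> {x \<in> topspace (top_of \<tau>). inv \<rho> (app f x) \<in> S}"
        using U(2) inv pq(4) open_subset_set_space[OF K U(1)] topspace_set_space[OF K] by blast
      ultimately show "\<exists>T. openin (top_of \<tau>) T \<and> x \<in> T \<and>
          T \<subseteq> {x \<in> topspace (top_of \<tau>). inv \<rho> (app f x) \<in> S}" by blast
    qed
  qed simp
  then show "f \<in> Cfun \<rho> K \<tau>" using fF by (simp add: Cfun_def)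
qed

section \<open>Closure properties of suitable models\<close>

text \<open>The relation is functional from numbers to elements, so that an element of
  \<open>C\<close> can be recovered inside a model from a number and the enumeration.\<close>

definition enumerates :: "'v::set_universe \<Rightarrow> 'v \<Rightarrow> 'v \<Rightarrow> bool" where
  "enumerates N e C \<longleftrightarrow> (\<forall>f\<in>elts C. \<exists>n\<in>elts N. opair n f \<in> elts e) \<and>
    (\<forall>n f f'. opair n f \<in> elts e \<and> opair n f' \<in> elts e \<longrightarrow> f = f')"

lemma definable_enumerates: "definable (\<lambda>e. enumerates (e i) (e j) (e k))"
  unfolding enumerates_def by (intro definable_intros definable_opair_mem)

lemma enumerates_nats:
  assumes "inj \<rho>" "countable (elts C)"
  shows "\<exists>e. enumerates (nats \<rho>) e C"
proof -
  define e where "e = set_of ((\<lambda>f. opair (\<rho> (real (to_nat_on (elts C) f))) f) ` elts C)"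
  have e: "elts e = (\<lambda>f. opair (\<rho> (real (to_nat_on (elts C) f))) f) ` elts C"
    unfolding e_def by (rule elts_set_of_small) (rule small_image[OF small_elts])
  have "enumerates (nats \<rho>) e C"
    unfolding enumerates_def
  proof (intro conjI ballI allI impI)
    fix f assume "f \<in> elts C"
    then show "\<exists>n\<in>elts (nats \<rho>). opair n f \<in> elts e" unfolding e elts_nats by blast
  next
    fix n f f' assume "opair n f \<in> elts e \<and> opair n f' \<in> elts e"
    then have f: "f \<in> elts C" "f' \<in> elts C" and
      "\<rho> (real (to_nat_on (elts C) f)) = \<rho> (real (to_nat_on (elts C) f'))"
      unfolding e by (auto simp: opair_inject)
    then have "to_nat_on (elts C) f = to_nat_on (elts C) f'" using assms(1) by (simp add: inj_eq)
    then show "f = f'" using inj_on_to_nat_on[OF assms(2)] f by (meson inj_onD)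
  qed
  then show ?thesis ..
qed

text \<open>Speaking of pairs replaces \<open>app\<close>, which is a definite description, by a
  formula.\<close>

definition agree_on_value :: "'v::set_universe \<Rightarrow> 'v \<Rightarrow> 'v \<Rightarrow> bool" where
  "agree_on_value f x y \<longleftrightarrow> (\<exists>v. opair x v \<in> elts f \<and> opair y v \<in> elts f)"

lemma definable_agree: "definable (\<lambda>e. agree_on_value (e i) (e j) (e k))"
  unfolding agree_on_value_def by (intro definable_intros definable_opair_mem)

lemma agree_on_value_iff:
  "f \<in> funs (elts K) B \<Longrightarrow> x \<in> elts K \<Longrightarrow> y \<in> elts K \<Longrightarrow> agree_on_value f x y \<longleftrightarrow> app f x = app f y"
  unfolding agree_on_value_def by (auto simp: opair_mem_funs)

text \<open>The triples in \<open>T\<close> stand for a partial binary operation that may have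
  several values. Closure asks for one value only, which is exactly what reflection
  provides.\<close>

definition closed_under :: "'v::set_universe \<Rightarrow> 'v \<Rightarrow> bool" where
  "closed_under T N \<longleftrightarrow> (\<forall>a\<in>elts N. \<forall>b\<in>elts N. (\<exists>z. opair (opair a b) z \<in> elts T) \<longrightarrow>
    (\<exists>z\<in>elts N. opair (opair a b) z \<in> elts T))"

lemma definable_closed_under: "definable (\<lambda>e. closed_under (e i) (e j))"
  unfolding closed_under_def by (intro definable_intros definable_triple_mem)

text \<open>A formula for lying in the closure of the part of \<open>D\<close> in \<open>N\<close>;
  with \<open>N\<close> equal to \<open>D\<close> it expresses the closure of \<open>D\<close>
  itself.\<close>

definition adherent :: "'v::set_universe \<Rightarrow> 'v \<Rightarrow> 'v \<Rightarrow> 'v \<Rightarrow> bool" where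
  "adherent \<tau> D N y \<longleftrightarrow> (\<forall>U\<in>elts \<tau>. y \<in> elts U \<longrightarrow> (\<exists>z\<in>elts U. z \<in> elts D \<and> z \<in> elts N))"

lemma definable_adherent: "definable (\<lambda>e. adherent (e i) (e j) (e k) (e l))"
  unfolding adherent_def by (intro definable_intros)

lemma adherent_iff:
  assumes "set_space K \<tau>" "y \<in> elts K"
  shows "adherent \<tau> D N y \<longleftrightarrow> y \<in> top_of \<tau> closure_of (elts D \<inter> elts N)"
  unfolding adherent_def in_closure_of openin_set_space[OF assms(1)] topspace_set_space[OF assms(1)]
  using assms(2) by blast

text \<open>\<open>T\<^sub>1\<close>, \<open>T\<^sub>2\<close>, \<open>T\<^sub>3\<close> are operations such that every set closed under them contains enough
  continuous functions.  The existence of such operations is what a retractional skeleton of which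
  nothing is known to lie in the model contributes: it is first-order in \<open>K\<close>, \<open>D\<close>, \<open>\<tau>\<close>.\<close>

definition separating_ops :: "'v::set_universe \<Rightarrow> 'v \<Rightarrow> 'v \<Rightarrow> 'v \<Rightarrow> 'v \<Rightarrow> 'v \<Rightarrow> 'v \<Rightarrow> 'v \<Rightarrow> bool" where
  "separating_ops T\<^sub>3 T\<^sub>2 T\<^sub>1 K D \<tau> B N \<longleftrightarrow>
    (\<forall>P. closed_under T\<^sub>1 P \<and> closed_under T\<^sub>2 P \<and> closed_under T\<^sub>3 P \<and> elts N \<subseteq> elts P \<longrightarrow>
      (\<forall>x\<in>elts K. \<forall>y\<in>elts K. x \<noteq> y \<and> adherent \<tau> D P x \<and> adherent \<tau> D P y \<longrightarrow>
        (\<exists>f\<in>elts P. cont_fun B K \<tau> f \<and> \<not> agree_on_value f x y)))"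

lemma definable_separating_ops:
  "definable (\<lambda>e. separating_ops (e i) (e j) (e k) (e l) (e m) (e n) (e o') (e p))"
  unfolding separating_ops_def
  by (intro definable_intros definable_closed_under definable_adherent definable_cont_fun definable_agree)

text \<open>The finitely many existential formulas whose reflection is used, each saying that
  parameters in \<open>M\<close> with a witness in the universe have one in \<open>M\<close>. The
  three operations are found one quantifier at a time, by \<open>refl_T1\<close>,
  \<open>refl_T2\<close> and \<open>refl_T3\<close>, each operation found becoming a parameter for
  the next.\<close>

locale suitable_model =
  fixes \<rho> :: "real \<Rightarrow> 'v::set_universe" and M :: 'v
  assumes rho: "inj \<rho>"
    and params: "elts (nats \<rho>) \<union> elts (intervals \<rho>) \<union> {nats \<rho>, intervals \<rho>} \<subseteq> elts M"
    and refl_inter: "\<forall>u\<in>elts M. \<forall>v\<in>elts M.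
      (\<exists>w. \<forall>z. z \<in> elts w \<longleftrightarrow> z \<in> elts u \<and> z \<in> elts v) \<longrightarrow>
      (\<exists>w\<in>elts M. \<forall>z. z \<in> elts w \<longleftrightarrow> z \<in> elts u \<and> z \<in> elts v)"
    and refl_meet: "\<forall>u\<in>elts M. \<forall>v\<in>elts M.
      (\<exists>x. x \<in> elts u \<and> x \<in> elts v) \<longrightarrow> (\<exists>x\<in>elts M. x \<in> elts u \<and> x \<in> elts v)"
    and refl_preimage: "\<forall>K\<in>elts M. \<forall>f\<in>elts M. \<forall>W\<in>elts M.
      (\<exists>U. \<forall>x. x \<in> elts U \<longleftrightarrow> x \<in> elts K \<and> (\<exists>y\<in>elts W. opair x y \<in> elts f)) \<longrightarrow>
      (\<exists>U\<in>elts M. \<forall>x. x \<in> elts U \<longleftrightarrow> x \<in> elts K \<and> (\<exists>y\<in>elts W. opair x y \<in> elts f))"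
    and refl_comp: "\<forall>K\<in>elts M. \<forall>f\<in>elts M. \<forall>g\<in>elts M.
      (\<exists>h. \<forall>z. z \<in> elts h \<longleftrightarrow>
        (\<exists>x\<in>elts K. \<exists>y v. opair x y \<in> elts f \<and> opair y v \<in> elts g \<and> z = opair x v)) \<longrightarrow>
      (\<exists>h\<in>elts M. \<forall>z. z \<in> elts h \<longleftrightarrow>
        (\<exists>x\<in>elts K. \<exists>y v. opair x y \<in> elts f \<and> opair y v \<in> elts g \<and> z = opair x v))"
    and refl_push: "\<forall>K\<in>elts M. \<forall>f\<in>elts M. \<forall>g\<in>elts M.
      (\<exists>h. \<forall>z. z \<in> elts h \<longleftrightarrow>
        (\<exists>x\<in>elts K. \<exists>y v. opair x y \<in> elts f \<and> opair x v \<in> elts g \<and> z = opair y v)) \<longrightarrow>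
      (\<exists>h\<in>elts M. \<forall>z. z \<in> elts h \<longleftrightarrow>
        (\<exists>x\<in>elts K. \<exists>y v. opair x y \<in> elts f \<and> opair x v \<in> elts g \<and> z = opair y v))"
    and refl_app: "\<forall>f\<in>elts M. \<forall>a\<in>elts M.
      (\<exists>y. opair a y \<in> elts f) \<longrightarrow> (\<exists>y\<in>elts M. opair a y \<in> elts f)"
    and refl_op: "\<forall>T\<in>elts M. \<forall>a\<in>elts M. \<forall>b\<in>elts M.
      (\<exists>z. opair (opair a b) z \<in> elts T) \<longrightarrow> (\<exists>z\<in>elts M. opair (opair a b) z \<in> elts T)"
    and refl_enum: "\<forall>N\<in>elts M. \<forall>C\<in>elts M.
      (\<exists>e. enumerates N e C) \<longrightarrow> (\<exists>e\<in>elts M. enumerates N e C)"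
    and refl_dense: "\<forall>D\<in>elts M. \<forall>K\<in>elts M. \<forall>\<tau>\<in>elts M. \<forall>q\<in>elts M. \<forall>N\<in>elts M.
      (\<exists>C. elts C \<subseteq> elts D \<and> (\<exists>e. enumerates N e C) \<and>
        (\<forall>x\<in>elts K. \<forall>y. opair x y \<in> elts q \<longrightarrow> adherent \<tau> C C y)) \<longrightarrow>
      (\<exists>C\<in>elts M. elts C \<subseteq> elts D \<and> (\<exists>e. enumerates N e C) \<and>
        (\<forall>x\<in>elts K. \<forall>y. opair x y \<in> elts q \<longrightarrow> adherent \<tau> C C y))"
    and refl_bound: "\<forall>\<Gamma>\<in>elts M. \<forall>le\<in>elts M. \<forall>s\<in>elts M. \<forall>t\<in>elts M.
      (\<exists>u. u \<in> elts \<Gamma> \<and> opair s u \<in> elts le \<and> opair t u \<in> elts le) \<longrightarrow>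
      (\<exists>u\<in>elts M. u \<in> elts \<Gamma> \<and> opair s u \<in> elts le \<and> opair t u \<in> elts le)"
    and refl_index: "\<forall>\<Gamma>\<in>elts M. \<forall>r\<in>elts M. \<forall>d\<in>elts M.
      (\<exists>s. s \<in> elts \<Gamma> \<and> (\<exists>q x. opair s q \<in> elts r \<and> opair x d \<in> elts q)) \<longrightarrow>
      (\<exists>s\<in>elts M. s \<in> elts \<Gamma> \<and> (\<exists>q x. opair s q \<in> elts r \<and> opair x d \<in> elts q))"
    and refl_vimage: "\<forall>D\<in>elts M. \<forall>h\<in>elts M. \<forall>y\<in>elts M.
      (\<exists>d. d \<in> elts D \<and> opair d y \<in> elts h) \<longrightarrow> (\<exists>d\<in>elts M. d \<in> elts D \<and> opair d y \<in> elts h)"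
    and refl_determine: "\<forall>A\<in>elts M. \<forall>g\<in>elts M. \<forall>K\<in>elts M. \<forall>N\<in>elts M.
      (\<exists>C. elts C \<subseteq> elts A \<and> (\<exists>e. enumerates N e C) \<and> (\<forall>x\<in>elts K. \<forall>y\<in>elts K.
        (\<forall>f\<in>elts C. agree_on_value f x y) \<longrightarrow> agree_on_value g x y)) \<longrightarrow>
      (\<exists>C\<in>elts M. elts C \<subseteq> elts A \<and> (\<exists>e. enumerates N e C) \<and> (\<forall>x\<in>elts K. \<forall>y\<in>elts K.
        (\<forall>f\<in>elts C. agree_on_value f x y) \<longrightarrow> agree_on_value g x y))"
    and refl_T1: "\<forall>K\<in>elts M. \<forall>D\<in>elts M. \<forall>\<tau>\<in>elts M. \<forall>B\<in>elts M. \<forall>N\<in>elts M.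
      (\<exists>T\<^sub>1. \<exists>T\<^sub>2 T\<^sub>3. separating_ops T\<^sub>3 T\<^sub>2 T\<^sub>1 K D \<tau> B N) \<longrightarrow>
      (\<exists>T\<^sub>1\<in>elts M. \<exists>T\<^sub>2 T\<^sub>3. separating_ops T\<^sub>3 T\<^sub>2 T\<^sub>1 K D \<tau> B N)"
    and refl_T2: "\<forall>T\<^sub>1\<in>elts M. \<forall>K\<in>elts M. \<forall>D\<in>elts M. \<forall>\<tau>\<in>elts M. \<forall>B\<in>elts M. \<forall>N\<in>elts M.
      (\<exists>T\<^sub>2. \<exists>T\<^sub>3. separating_ops T\<^sub>3 T\<^sub>2 T\<^sub>1 K D \<tau> B N) \<longrightarrow>
      (\<exists>T\<^sub>2\<in>elts M. \<exists>T\<^sub>3. separating_ops T\<^sub>3 T\<^sub>2 T\<^sub>1 K D \<tau> B N)"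
    and refl_T3: "\<forall>T\<^sub>2\<in>elts M. \<forall>T\<^sub>1\<in>elts M. \<forall>K\<in>elts M. \<forall>D\<in>elts M. \<forall>\<tau>\<in>elts M. \<forall>B\<in>elts M. \<forall>N\<in>elts M.
      (\<exists>T\<^sub>3. separating_ops T\<^sub>3 T\<^sub>2 T\<^sub>1 K D \<tau> B N) \<longrightarrow>
      (\<exists>T\<^sub>3\<in>elts M. separating_ops T\<^sub>3 T\<^sub>2 T\<^sub>1 K D \<tau> B N)"

lemma for_every_suitable_suitable_model:
  assumes "inj \<rho>"
  shows "for_every_suitable_model (suitable_model \<rho>)"
proof -
  note ivs = definable_intros definable_eq_opair definable_opair_mem definable_triple_mem
    definable_enumerates definable_adherent definable_agree definable_separating_ops
  have "countable (elts (nats \<rho>) \<union> elts (intervals \<rho>) \<union> {nats \<rho>, intervals \<rho>})"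
    by (simp add: elts_nats elts_intervals countable_intervals)
  then show ?thesis
    unfolding suitable_model_def
    apply (intro for_every_suitable_conj)
    subgoal using for_every_suitable_const[OF assms] .
    subgoal by (rule for_every_suitable_superset)
    subgoal by (rule reflect2) (intro ivs)
    subgoal by (rule reflect2) (intro ivs)
    subgoal by (rule reflect3) (intro ivs)
    subgoal by (rule reflect3) (intro ivs)
    subgoal by (rule reflect3) (intro ivs)
    subgoal by (rule reflect2) (intro ivs)
    subgoal by (rule reflect3) (intro ivs)
    subgoal by (rule reflect2) (intro ivs)
    subgoal by (rule reflect5) (intro ivs)
    subgoal by (rule reflect4) (intro ivs)
    subgoal by (rule reflect3) (intro ivs)
    subgoal by (rule reflect3) (intro ivs)
    subgoal by (rule reflect4) (intro ivs)
    subgoal by (rule reflect5) (intro ivs)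
    subgoal by (rule reflect6) (intro ivs)
    subgoal by (rule reflect7) (intro ivs)
    done
qed

context suitable_model
begin

lemma nats_in: "nats \<rho> \<in> elts M" "elts (nats \<rho>) \<subseteq> elts M"
  and intervals_in: "intervals \<rho> \<in> elts M" "elts (intervals \<rho>) \<subseteq> elts M"
  using params by blast+

text \<open>By extensionality only one set has the members prescribed by \<open>Q\<close>, so the
  witness in \<open>M\<close> is the given set.\<close>

lemma reflect_set:
  assumes "(\<exists>w. \<forall>z. z \<in> elts w \<longleftrightarrow> Q z) \<longrightarrow> (\<exists>w\<in>elts M. \<forall>z. z \<in> elts w \<longleftrightarrow> Q z)"
    and "\<And>z. z \<in> elts w \<longleftrightarrow> Q z"
  shows "w \<in> elts M"
proof -
  obtain w' where "w' \<in> elts M" "\<And>z. z \<in> elts w' \<longleftrightarrow> Q z" using assms by blast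
  moreover from this have "w' = w" using assms(2) by (intro extensionality) blast
  ultimately show ?thesis by simp
qed

lemma inter_in: "u \<in> elts M \<Longrightarrow> v \<in> elts M \<Longrightarrow> elts w = elts u \<inter> elts v \<Longrightarrow> w \<in> elts M"
  by (rule reflect_set[OF bspec[OF bspec[OF refl_inter]]]) auto

lemma app_in:
  assumes "f \<in> funs (elts K) B" "f \<in> elts M" "x \<in> elts K" "x \<in> elts M"
  shows "app f x \<in> elts M"
proof -
  have "\<exists>y. opair x y \<in> elts f" using assms(3) by (simp add: opair_mem_funs[OF assms(1)])
  from refl_app[rule_format, OF assms(2,4) this] show ?thesis
    by (auto simp: opair_mem_funs[OF assms(1)])
qed

text \<open>\<open>M\<close> need not be transitive. An enumeration of \<open>C\<close> found in
  \<open>M\<close>, evaluated at numbers, which all belong to \<open>M\<close>, produces every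
  element of \<open>C\<close> inside \<open>M\<close>.\<close>

lemma enumerated_subset:
  assumes "C \<in> elts M" "\<exists>e. enumerates (nats \<rho>) e C"
  shows "elts C \<subseteq> elts M"
proof
  fix f assume f: "f \<in> elts C"
  obtain e where e: "e \<in> elts M" "enumerates (nats \<rho>) e C"
    using refl_enum[rule_format, OF nats_in(1) assms] by blast
  then obtain n where n: "n \<in> elts (nats \<rho>)" "opair n f \<in> elts e" using f by (auto simp: enumerates_def)
  then obtain f' where "f' \<in> elts M" "opair n f' \<in> elts e"
    using refl_app[rule_format, OF e(1)] nats_in(2) by blast
  then show "f \<in> elts M" using e(2) n(2) unfolding enumerates_def by blast
qed

abbreviation CM :: "'v \<Rightarrow> 'v \<Rightarrow> 'v set" where
  "CM K \<tau> \<equiv> Cfun \<rho> K \<tau> \<inter> elts M"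

text \<open>The graph of the composite is definable from \<open>K\<close>, \<open>q\<close> and
  \<open>g\<close>, so it belongs to \<open>M\<close> even if \<open>L\<close> and
  \<open>\<sigma>\<close> do not.\<close>

lemma comp_CM:
  assumes K: "set_space K \<tau>" "K \<in> elts M" and L: "set_space L \<sigma>"
    and q: "q \<in> funs (elts K) (elts L)" "q \<in> elts M" "continuous_map (top_of \<tau>) (top_of \<sigma>) (app q)"
    and g: "g \<in> CM L \<sigma>"
  shows "\<exists>h\<in>CM K \<tau>. \<forall>x\<in>elts K. app h x = app g (app q x)"
proof -
  have gC: "g \<in> Cfun \<rho> L \<sigma>" and gM: "g \<in> elts M" using g by auto
  have "continuous_map (top_of \<tau>) euclideanreal ((\<lambda>x. inv \<rho> (app g x)) \<circ> app q)"
    using q(3) Cfun_continuous[OF gC] by (rule continuous_map_compose)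
  from fun_graph_Cfun[OF rho K(1) this]
  have h: "fun_graph (elts K) (\<lambda>x. \<rho> (inv \<rho> (app g (app q x)))) \<in> Cfun \<rho> K \<tau>" (is "?h \<in> _") by simp
  have gq: "\<rho> (inv \<rho> (app g (app q x))) = app g (app q x)" if "x \<in> elts K" for x
    using funs_app_in[OF Cfun_funs[OF gC] funs_app_in[OF q(1) that]] by (simp add: f_inv_into_f)
  have "?h \<in> elts M"
  proof (rule reflect_set[OF bspec[OF bspec[OF bspec[OF refl_comp K(2)] q(2)] gM]])
    fix z show "z \<in> elts ?h \<longleftrightarrow>
        (\<exists>x\<in>elts K. \<exists>y v. opair x y \<in> elts q \<and> opair y v \<in> elts g \<and> z = opair x v)"
      using funs_app_in[OF q(1)] gq
      by (auto simp: fun_graph_mem opair_mem_funs[OF q(1)] opair_mem_funs[OF Cfun_funs[OF gC]])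
  qed
  with h gq show ?thesis by (intro bexI[of _ ?h]) (auto simp: app_fun_graph)
qed

text \<open>The pairs of \<open>app q x\<close> and \<open>app g x\<close> form the graph of
  \<open>g\<close> after the inverse of \<open>q\<close> without mentioning the inverse, so
  \<open>K\<close>, \<open>q\<close> and \<open>g\<close> suffice as parameters.\<close>

lemma push_CM:
  assumes K: "set_space K \<tau>" "K \<in> elts M" and L: "set_space L \<sigma>"
    and q: "q \<in> funs (elts K) (elts L)" "q \<in> elts M" "homeomorphic_map (top_of \<tau>) (top_of \<sigma>) (app q)"
    and g: "g \<in> CM K \<tau>"
  shows "\<exists>h\<in>CM L \<sigma>. \<forall>x\<in>elts K. app h (app q x) = app g x"
proof -
  have gC: "g \<in> Cfun \<rho> K \<tau>" and gM: "g \<in> elts M" using g by auto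
  obtain p where p: "continuous_map (top_of \<sigma>) (top_of \<tau>) p" "\<And>x. x \<in> elts K \<Longrightarrow> p (app q x) = x"
      "\<And>y. y \<in> elts L \<Longrightarrow> app q (p y) = y"
    using q(3) topspace_set_space[OF K(1)] topspace_set_space[OF L]
    unfolding homeomorphic_map_maps homeomorphic_maps_def by auto
  have pK: "p y \<in> elts K" if "y \<in> elts L" for y
    using continuous_map_image_subset_topspace[OF p(1)] that
      topspace_set_space[OF K(1)] topspace_set_space[OF L] by blast
  have "continuous_map (top_of \<sigma>) euclideanreal ((\<lambda>x. inv \<rho> (app g x)) \<circ> p)"
    using p(1) Cfun_continuous[OF gC] by (rule continuous_map_compose)
  from fun_graph_Cfun[OF rho L this]
  have h: "fun_graph (elts L) (\<lambda>y. \<rho> (inv \<rho> (app g (p y)))) \<in> Cfun \<rho> L \<sigma>" (is "?h \<in> _") by simp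
  have gp: "\<rho> (inv \<rho> (app g (p y))) = app g (p y)" if "y \<in> elts L" for y
    using funs_app_in[OF Cfun_funs[OF gC] pK[OF that]] by (simp add: f_inv_into_f)
  have "?h \<in> elts M"
  proof (rule reflect_set[OF bspec[OF bspec[OF bspec[OF refl_push K(2)] q(2)] gM]])
    fix z
    have "z \<in> elts ?h \<longleftrightarrow> (\<exists>y\<in>elts L. z = opair y (app g (p y)))"
      using gp by (auto simp: fun_graph_mem)
    also have "\<dots> \<longleftrightarrow> (\<exists>x\<in>elts K. z = opair (app q x) (app g x))"
      using p pK funs_app_in[OF q(1)] by metis
    finally show "z \<in> elts ?h \<longleftrightarrow>
        (\<exists>x\<in>elts K. \<exists>y v. opair x y \<in> elts q \<and> opair x v \<in> elts g \<and> z = opair y v)"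
      by (auto simp: opair_mem_funs[OF q(1)] opair_mem_funs[OF Cfun_funs[OF gC]])
  qed
  moreover have "app ?h (app q x) = app g x" if "x \<in> elts K" for x
    using gp[OF funs_app_in[OF q(1) that]] funs_app_in[OF q(1) that] p(2)[OF that] by (simp add: app_fun_graph)
  ultimately show ?thesis using h by (intro bexI[of _ ?h]) auto
qed

text \<open>The pairs of points at which \<open>g\<close> differs by at least
  \<open>inverse (real (Suc n))\<close> form a compact subset of the square. It is covered by the
  open sets of pairs separated by a member of \<open>A\<close>, so finitely many members suffice for
  each \<open>n\<close>.\<close>

lemma determined_by_countable:
  assumes K: "set_space K \<tau>" "compact_space (top_of \<tau>)"
    and A: "elts A \<subseteq> Cfun \<rho> K \<tau>" "\<And>x y. x \<in> elts K \<Longrightarrow> y \<in> elts K \<Longrightarrow> x \<noteq> y \<Longrightarrow> \<exists>f\<in>elts A. app f x \<noteq> app f y"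
    and g: "g \<in> Cfun \<rho> K \<tau>"
  shows "\<exists>C\<subseteq>elts A. countable C \<and> (\<forall>x\<in>elts K. \<forall>y\<in>elts K. (\<forall>f\<in>C. app f x = app f y) \<longrightarrow> app g x = app g y)"
proof -
  let ?X = "top_of \<tau>" and ?P = "prod_topology (top_of \<tau>) (top_of \<tau>)"
  let ?d = "\<lambda>f p. inv \<rho> (app f (fst p)) - inv \<rho> (app f (snd p))"
  have tX: "topspace ?X = elts K" using topspace_set_space[OF K(1)] .
  have cont: "continuous_map ?P euclideanreal (?d f)" if f: "f \<in> Cfun \<rho> K \<tau>" for f
  proof -
    have "continuous_map ?P euclideanreal ((\<lambda>x. inv \<rho> (app f x)) \<circ> fst)"
      "continuous_map ?P euclideanreal ((\<lambda>x. inv \<rho> (app f x)) \<circ> snd)"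
      by (rule continuous_map_compose[OF _ Cfun_continuous[OF f]], rule continuous_map_fst continuous_map_snd)+
    from continuous_map_diff[OF this] show ?thesis by simp
  qed
  define \<Delta> where "\<Delta> n = {p \<in> topspace ?P. \<bar>?d g p\<bar> \<in> {inverse (real (Suc n))..}}" for n
  define U where "U f = {p \<in> topspace ?P. ?d f p \<in> - {0}}" for f
  have "\<exists>C. finite C \<and> C \<subseteq> elts A \<and> \<Delta> n \<subseteq> \<Union> (U ` C)" for n
  proof -
    have "closedin ?P (\<Delta> n)" unfolding \<Delta>_def
      by (rule closedin_continuous_map_preimage[OF continuous_map_real_abs[OF cont[OF g]]]) simp
    then have "compactin ?P (\<Delta> n)"
      using closedin_compact_space K(2) by (metis compact_space_prod_topology)
    moreover have "openin ?P (U f)" if "f \<in> elts A" for f unfolding U_def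
      using that A(1) by (intro openin_continuous_map_preimage[OF cont]) auto
    moreover have "\<Delta> n \<subseteq> \<Union> (U ` elts A)"
    proof
      fix p assume p: "p \<in> \<Delta> n"
      then have pK: "fst p \<in> elts K" "snd p \<in> elts K" by (auto simp: \<Delta>_def tX)
      have "\<bar>?d g p\<bar> > 0" using p unfolding \<Delta>_def
        by (auto intro: less_le_trans[of 0 "inverse (real (Suc n))"] simp del: of_nat_Suc)
      then have "fst p \<noteq> snd p" by auto
      then obtain f where f: "f \<in> elts A" "app f (fst p) \<noteq> app f (snd p)" using A(2) pK by blast
      then have "?d f p \<noteq> 0" using Cfun_app_eq[of f \<rho> K \<tau>] A(1) pK by auto
      then show "p \<in> \<Union> (U ` elts A)" using f(1) p by (auto simp: U_def \<Delta>_def)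
    qed
    ultimately obtain \<F> where "finite \<F>" "\<F> \<subseteq> U ` elts A" "\<Delta> n \<subseteq> \<Union>\<F>"
      unfolding compactin_def by (metis (no_types, lifting) imageE)
    then show ?thesis by (metis finite_subset_image)
  qed
  then obtain C where C: "\<And>n. finite (C n)" "\<And>n. C n \<subseteq> elts A" "\<And>n. \<Delta> n \<subseteq> \<Union> (U ` C n)" by metis
  have "app g x = app g y" if x: "x \<in> elts K" and y: "y \<in> elts K" and eq: "\<forall>f\<in>(\<Union>n. C n). app f x = app f y" for x y
  proof (rule ccontr)
    assume "app g x \<noteq> app g y"
    then have "\<bar>?d g (x, y)\<bar> > 0" using Cfun_app_eq[OF g x y] by simp
    then obtain n where "inverse (real (Suc n)) < \<bar>?d g (x, y)\<bar>" using reals_Archimedean by blast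
    then have "(x, y) \<in> \<Delta> n" using x y by (simp add: \<Delta>_def tX)
    then obtain f where "f \<in> C n" "(x, y) \<in> U f" using C(3)[of n] by blast
    then show False using eq by (auto simp: U_def)
  qed
  moreover have "(\<Union>n. C n) \<subseteq> elts A" "countable (\<Union>n. C n)" using C by (auto simp: countable_finite)
  ultimately show ?thesis by (intro exI[of _ "\<Union>n. C n"]) blast
qed

text \<open>A countable subset of \<open>A\<close> that determines \<open>g\<close> on all of
  \<open>K\<close> can be found in \<open>M\<close>. It is then contained in \<open>M\<close>, so
  \<open>x\<close> and \<open>y\<close> are known to agree on its members.\<close>

lemma separating_determines:
  assumes K: "set_space K \<tau>" "compact_space (top_of \<tau>)" "K \<in> elts M"
    and A: "elts A \<subseteq> Cfun \<rho> K \<tau>" "\<And>x y. x \<in> elts K \<Longrightarrow> y \<in> elts K \<Longrightarrow> x \<noteq> y \<Longrightarrow> \<exists>f\<in>elts A. app f x \<noteq> app f y"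
      "A \<in> elts M"
    and g: "g \<in> CM K \<tau>" and x: "x \<in> elts K" and y: "y \<in> elts K"
    and eq: "\<And>f. f \<in> elts A \<inter> elts M \<Longrightarrow> app f x = app f y"
  shows "app g x = app g y"
proof -
  have gC: "g \<in> Cfun \<rho> K \<tau>" and gM: "g \<in> elts M" using g by auto
  have agree: "agree_on_value f x y \<longleftrightarrow> app f x = app f y"
    if "f \<in> Cfun \<rho> K \<tau>" "x \<in> elts K" "y \<in> elts K" for f x y
    using agree_on_value_iff[OF Cfun_funs] that by blast
  obtain C where C: "C \<subseteq> elts A" "countable C"
      "\<forall>x\<in>elts K. \<forall>y\<in>elts K. (\<forall>f\<in>C. app f x = app f y) \<longrightarrow> app g x = app g y"
    using determined_by_countable[OF K(1,2) A(1,2) gC] by auto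
  define c where "c = set_of C"
  have c: "elts c = C" unfolding c_def by (rule elts_set_of_small[OF small_countable[OF C(2)]])
  have "elts c \<subseteq> elts A \<and> (\<exists>e. enumerates (nats \<rho>) e c) \<and> (\<forall>x\<in>elts K. \<forall>y\<in>elts K.
      (\<forall>f\<in>elts c. agree_on_value f x y) \<longrightarrow> agree_on_value g x y)"
  proof (intro conjI ballI impI)
    show "elts c \<subseteq> elts A" using C c by simp
    show "\<exists>e. enumerates (nats \<rho>) e c" using enumerates_nats[OF rho] C(2) c by simp
    fix x y assume xy: "x \<in> elts K" "y \<in> elts K" "\<forall>f\<in>elts c. agree_on_value f x y"
    then have "\<forall>f\<in>C. app f x = app f y" using agree C(1) A(1) c by blast
    then show "agree_on_value g x y" using C(3) xy agree[OF gC] by blast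
  qed
  then obtain c' where c': "c' \<in> elts M" "elts c' \<subseteq> elts A" "\<exists>e. enumerates (nats \<rho>) e c'"
      "\<forall>x\<in>elts K. \<forall>y\<in>elts K. (\<forall>f\<in>elts c'. agree_on_value f x y) \<longrightarrow> agree_on_value g x y"
    using refl_determine[rule_format, OF A(3) gM K(3) nats_in(1)] by blast
  have "\<forall>f\<in>elts c'. agree_on_value f x y"
  proof
    fix f assume f: "f \<in> elts c'"
    then have "f \<in> elts A \<inter> elts M" using c'(2) enumerated_subset[OF c'(1,3)] by blast
    then show "agree_on_value f x y" using eq agree A(1) x y by blast
  qed
  then show ?thesis using c'(4) x y agree[OF gC x y] by blast
qed

end

text \<open>\<open>T1\<close> gives upper bounds of indices, \<open>T2\<close> indices whose
  retractions fix a given point of \<open>D\<close>, and \<open>T3\<close> the functions of a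
  sequence that determines a given retraction. If \<open>P\<close> is closed under them, the indices
  in \<open>P\<close> form a directed set whose images cover the part of \<open>D\<close> in
  \<open>P\<close>, and \<open>separates_closure\<close> applies to it.\<close>

lemma skeleton_separating_ops:
  assumes rho: "inj \<rho>" and K: "set_space K \<tau>" and sk: "skeleton K \<tau> \<Gamma> le r"
    and D: "elts D \<subseteq> induced_set (top_of \<tau>) (elts \<Gamma>) (app2 r)"
  shows "\<exists>T\<^sub>1 T\<^sub>2 T\<^sub>3. separating_ops T\<^sub>3 T\<^sub>2 T\<^sub>1 K D \<tau> (intervals \<rho>) (nats \<rho>)"
proof -
  let ?X = "top_of \<tau>"
  interpret ret_skeleton ?X "elts \<Gamma>" "rel_of le" "app2 r"
    by unfold_locales (use sk in \<open>simp add: skeleton_def\<close>)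
  note tX = topspace_set_space[OF K]
  define T1 where "T1 = set_of {opair (opair s t) u |s t u. s \<in> elts \<Gamma> \<and> t \<in> elts \<Gamma> \<and> u \<in> elts \<Gamma> \<and>
    (s, u) \<in> rel_of le \<and> (t, u) \<in> rel_of le}"
  have T1: "elts T1 = {opair (opair s t) u |s t u. s \<in> elts \<Gamma> \<and> t \<in> elts \<Gamma> \<and> u \<in> elts \<Gamma> \<and>
    (s, u) \<in> rel_of le \<and> (t, u) \<in> rel_of le}"
    unfolding T1_def
    by (rule elts_set_of_small, rule small_subset[OF small_triples[OF small_elts[of \<Gamma>] small_elts[of \<Gamma>] small_elts[of \<Gamma>]]])
      blast
  \<comment> \<open>This operation is unary and is made binary by repeating its argument.\<close>
  define T2 where "T2 = set_of {opair (opair d d) s |d s. d \<in> elts D \<and> s \<in> elts \<Gamma> \<and> d \<in> app2 r s ` elts K}"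
  have T2: "elts T2 = {opair (opair d d) s |d s. d \<in> elts D \<and> s \<in> elts \<Gamma> \<and> d \<in> app2 r s ` elts K}"
    unfolding T2_def
    by (rule elts_set_of_small, rule small_subset[OF small_triples[OF small_elts[of D] small_elts[of D] small_elts[of \<Gamma>]]])
      blast
  have "\<forall>s\<in>elts \<Gamma>. \<exists>f :: nat \<Rightarrow> 'a \<Rightarrow> real. (\<forall>n. continuous_map ?X euclideanreal (f n)) \<and>
    (\<forall>x\<in>elts K. \<forall>y\<in>elts K. (\<forall>n. f n x = f n y) \<longrightarrow> app2 r s x = app2 r s y)"
    using countable_separating unfolding tX by blast
  then obtain f :: "'a \<Rightarrow> nat \<Rightarrow> 'a \<Rightarrow> real" where
      f: "\<And>s n. s \<in> elts \<Gamma> \<Longrightarrow> continuous_map ?X euclideanreal (f s n)"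
      "\<And>s x y. s \<in> elts \<Gamma> \<Longrightarrow> x \<in> elts K \<Longrightarrow> y \<in> elts K \<Longrightarrow> \<forall>n. f s n x = f s n y \<Longrightarrow> app2 r s x = app2 r s y"
    by metis
  define g where "g s n = fun_graph (elts K) (\<lambda>x. \<rho> (f s n x))" for s n
  have g: "g s n \<in> Cfun \<rho> K \<tau>" if "s \<in> elts \<Gamma>" for s n
    unfolding g_def using fun_graph_Cfun[OF rho K f(1)[OF that]] .
  \<comment> \<open>The second arguments are the numbers, which \<open>separating_ops\<close> puts
    into \<open>P\<close>.\<close>
  define T3 where "T3 = set_of (\<Union>s\<in>elts \<Gamma>. range (\<lambda>n. opair (opair s (\<rho> (real n))) (g s n)))"
  have T3: "elts T3 = (\<Union>s\<in>elts \<Gamma>. range (\<lambda>n. opair (opair s (\<rho> (real n))) (g s n)))"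
    unfolding T3_def by (intro elts_set_of_small small_UN) (simp_all add: small_countable)
  have "separating_ops T3 T2 T1 K D \<tau> (intervals \<rho>) (nats \<rho>)"
    unfolding separating_ops_def
  proof (intro allI impI ballI)
    fix P x y
    assume P: "closed_under T1 P \<and> closed_under T2 P \<and> closed_under T3 P \<and> elts (nats \<rho>) \<subseteq> elts P"
      and x: "x \<in> elts K" and y: "y \<in> elts K" and xy: "x \<noteq> y \<and> adherent \<tau> D P x \<and> adherent \<tau> D P y"
    let ?G = "elts \<Gamma> \<inter> elts P"
    have DG: "elts D \<inter> elts P \<subseteq> (\<Union>s\<in>?G. app2 r s ` topspace ?X)"
    proof
      fix d assume d: "d \<in> elts D \<inter> elts P"
      then obtain s where "s \<in> elts \<Gamma>" "d \<in> app2 r s ` elts K" using D unfolding induced_set_def tX by blast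
      then have "opair (opair d d) s \<in> elts T2" unfolding T2 using d by blast
      then obtain s' where "s' \<in> elts P" "opair (opair d d) s' \<in> elts T2"
        using P d unfolding closed_under_def by blast
      then show "d \<in> (\<Union>s\<in>?G. app2 r s ` topspace ?X)" unfolding T2 tX by (auto simp: opair_inject)
    qed
    have cl: "x \<in> ?X closure_of (\<Union>s\<in>?G. app2 r s ` topspace ?X)"
      "y \<in> ?X closure_of (\<Union>s\<in>?G. app2 r s ` topspace ?X)"
      using xy closure_of_mono[OF DG] adherent_iff[OF K x] adherent_iff[OF K y] by blast+
    have "up_directed ?G (rel_of le)"
      unfolding up_directed_def
    proof (intro conjI ballI)
      \<comment> \<open>With no index there would be nothing for \<open>x\<close> to be adherent
        to.\<close>
      show "?G \<noteq> {}"
      proof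
        assume "?G = {}"
        then have "x \<in> ?X closure_of {}" using cl(1) by simp
        then show False by simp
      qed
      fix s t assume st: "s \<in> ?G" "t \<in> ?G"
      then obtain u where "u \<in> elts \<Gamma>" "(s, u) \<in> rel_of le" "(t, u) \<in> rel_of le"
        using up_directed_bound[OF directed, of s t] by blast
      then have "opair (opair s t) u \<in> elts T1" unfolding T1 using st by blast
      then obtain u' where "u' \<in> elts P" "opair (opair s t) u' \<in> elts T1"
        using P st unfolding closed_under_def by blast
      then show "\<exists>u\<in>?G. (s, u) \<in> rel_of le \<and> (t, u) \<in> rel_of le" unfolding T1 by (auto simp: opair_inject)
    qed
    then obtain s where s: "s \<in> ?G" "app2 r s x \<noteq> app2 r s y"
      using separates_closure[OF _ _ cl] xy by blast
    then obtain n where n: "f s n x \<noteq> f s n y" using f(2)[of s x y] x y by blast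
    have "opair (opair s (\<rho> (real n))) (g s n) \<in> elts T3" unfolding T3 using s by blast
    moreover have "\<rho> (real n) \<in> elts P" using P by (auto simp: elts_nats)
    ultimately obtain h where "h \<in> elts P" "opair (opair s (\<rho> (real n))) h \<in> elts T3"
      using P s unfolding closed_under_def by blast
    then have gP: "g s n \<in> elts P" unfolding T3 using rho by (auto simp: opair_inject inj_eq)
    have "app (g s n) x \<noteq> app (g s n) y"
      unfolding g_def using n x y rho by (simp add: app_fun_graph inj_eq)
    then have "\<not> agree_on_value (g s n) x y" using agree_on_value_iff[OF Cfun_funs[OF g] x y] s by blast
    moreover have "cont_fun (intervals \<rho>) K \<tau> (g s n)" using cont_fun_iff[OF rho K] g s by blast
    ultimately show "\<exists>f\<in>elts P. cont_fun (intervals \<rho>) K \<tau> f \<and> \<not> agree_on_value f x y" using gP by blast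
  qed
  then show ?thesis by blast
qed

text \<open>\<open>M\<close> is closed under every operation that belongs to it, by
  \<open>refl_op\<close>, so \<open>M\<close> is one of the sets \<open>P\<close> in
  \<open>separating_ops\<close>. The skeleton enters only through the existence of the
  operations.\<close>

lemma (in suitable_model) CM_separates:
  assumes K: "set_space K \<tau>" and M: "K \<in> elts M" "D \<in> elts M" "\<tau> \<in> elts M"
    and sk: "skeleton K \<tau> \<Gamma> le r" "elts D \<subseteq> induced_set (top_of \<tau>) (elts \<Gamma>) (app2 r)"
    and x: "x \<in> top_of \<tau> closure_of (elts D \<inter> elts M)" and y: "y \<in> top_of \<tau> closure_of (elts D \<inter> elts M)"
    and eq: "\<And>f. f \<in> CM K \<tau> \<Longrightarrow> app f x = app f y"
  shows "x = y"
proof (rule ccontr)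
  assume "x \<noteq> y"
  have xK: "x \<in> elts K" and yK: "y \<in> elts K"
    using x y closure_of_subset_topspace topspace_set_space[OF K] by fastforce+
  obtain T\<^sub>1 where T1: "T\<^sub>1 \<in> elts M" "\<exists>T\<^sub>2 T\<^sub>3. separating_ops T\<^sub>3 T\<^sub>2 T\<^sub>1 K D \<tau> (intervals \<rho>) (nats \<rho>)"
    using refl_T1[rule_format, OF M intervals_in(1) nats_in(1) skeleton_separating_ops[OF rho K sk]] by blast
  obtain T\<^sub>2 where T2: "T\<^sub>2 \<in> elts M" "\<exists>T\<^sub>3. separating_ops T\<^sub>3 T\<^sub>2 T\<^sub>1 K D \<tau> (intervals \<rho>) (nats \<rho>)"
    using refl_T2[rule_format, OF T1(1) M intervals_in(1) nats_in(1) T1(2)] by blast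
  obtain T\<^sub>3 where T3: "T\<^sub>3 \<in> elts M" "separating_ops T\<^sub>3 T\<^sub>2 T\<^sub>1 K D \<tau> (intervals \<rho>) (nats \<rho>)"
    using refl_T3[rule_format, OF T2(1) T1(1) M intervals_in(1) nats_in(1) T2(2)] by blast
  have "closed_under T M" if "T \<in> elts M" for T
    unfolding closed_under_def using refl_op[THEN bspec, OF that] by simp
  then have "closed_under T\<^sub>1 M \<and> closed_under T\<^sub>2 M \<and> closed_under T\<^sub>3 M \<and> elts (nats \<rho>) \<subseteq> elts M"
    using T1(1) T2(1) T3(1) nats_in(2) by simp
  moreover have "x \<noteq> y \<and> adherent \<tau> D M x \<and> adherent \<tau> D M y"
    using \<open>x \<noteq> y\<close> x y adherent_iff[OF K xK] adherent_iff[OF K yK] by simp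
  ultimately obtain f where f: "f \<in> elts M" "cont_fun (intervals \<rho>) K \<tau> f" "\<not> agree_on_value f x y"
    using T3(2)[unfolded separating_ops_def, rule_format, of M x y] xK yK by blast
  then have "f \<in> CM K \<tau>" using cont_fun_iff[OF rho K] by blast
  then show False using eq f(3) agree_on_value_iff[OF Cfun_funs xK yK] by blast
qed

section \<open>The canonical retraction of a suitable model\<close>

text \<open>Cardinals are well-ordered, so a base of least cardinality exists and the choice in
  \<open>weight\<close> does pick one.\<close>

lemma weight_le_base:
  assumes "is_base X B"
  shows "weight X \<le>o |B|"
proof -
  let ?R = "card_of ` {B. is_base X B}"
  have "?R \<noteq> {}" "\<forall>r\<in>?R. Card_order r" using assms card_of_Card_order by blast+
  from exists_minim_Card_order[OF this]
  obtain B0 where "is_base X B0" "\<forall>B'. is_base X B' \<longrightarrow> |B0| \<le>o |B'|" by auto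
  then have "\<exists>B0. is_base X B0 \<and> (\<forall>B'. is_base X B' \<longrightarrow> |B0| \<le>o |B'| )" by blast
  from someI_ex[OF this] show ?thesis unfolding weight_def using assms by blast
qed

locale model_space = suitable_model +
  fixes K \<tau> D
  assumes K: "set_space K \<tau>" and compact: "compact_space (top_of \<tau>)"
    and DK: "elts D \<subseteq> elts K" and dense: "top_of \<tau> closure_of elts D = elts K"
    and in_M: "K \<in> elts M" "D \<in> elts M" "\<tau> \<in> elts M"
    and skel: "\<exists>\<Gamma> le r. skeleton K \<tau> \<Gamma> le r \<and> elts D \<subseteq> induced_set (top_of \<tau>) (elts \<Gamma>) (app2 r)"
begin

definition F where "F = top_of \<tau> closure_of (elts D \<inter> elts M)"

definition agree where "agree x y \<longleftrightarrow> (\<forall>f\<in>CM K \<tau>. app f x = app f y)"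

lemma tX [simp]: "topspace (top_of \<tau>) = elts K"
  by (rule topspace_set_space[OF K])

lemma openin_iff: "openin (top_of \<tau>) U \<longleftrightarrow> U \<in> elts ` elts \<tau>"
  by (rule openin_set_space[OF K])

lemma F_sub: "F \<subseteq> elts K"
  using closure_of_subset_topspace[of "top_of \<tau>"] by (simp add: F_def)

lemma F_closed: "closedin (top_of \<tau>) F"
  by (simp add: F_def)

lemma DM_F: "elts D \<inter> elts M \<subseteq> F"
  unfolding F_def using DK by (intro closure_of_subset) auto

lemma agree_eq: "x \<in> F \<Longrightarrow> y \<in> F \<Longrightarrow> agree x y \<Longrightarrow> x = y"
  using CM_separates[OF K in_M] skel unfolding F_def agree_def by metis

lemma agree_refl: "agree x x" and agree_sym: "agree x y \<Longrightarrow> agree y x"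
  and agree_trans: "agree x y \<Longrightarrow> agree y z \<Longrightarrow> agree x z"
  by (simp_all add: agree_def)

text \<open>The open sets of \<open>M\<close> that are saturated for \<open>agree\<close>.
  Saturation passes membership between a point and its image under the retraction, and the traces on
  \<open>F\<close> will form a base of \<open>F\<close>.\<close>

definition MU where "MU = {U \<in> elts \<tau> \<inter> elts M. \<forall>x\<in>elts K. \<forall>y\<in>elts K. agree x y \<longrightarrow> x \<in> elts U \<longrightarrow> y \<in> elts U}"

lemma MU_open: "U \<in> MU \<Longrightarrow> openin (top_of \<tau>) (elts U)"
  by (auto simp: MU_def openin_iff)

lemma MU_agree: "U \<in> MU \<Longrightarrow> agree x y \<Longrightarrow> x \<in> elts K \<Longrightarrow> y \<in> elts K \<Longrightarrow> x \<in> elts U \<longleftrightarrow> y \<in> elts U"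
  unfolding MU_def using agree_sym by blast

lemma MU_K: "K \<in> MU"
proof -
  have "elts K \<in> elts ` elts \<tau>" using openin_topspace[of "top_of \<tau>"] by (simp only: openin_iff tX)
  then have "K \<in> elts \<tau>" using extensionality by (metis imageE)
  then show ?thesis using in_M by (simp add: MU_def)
qed

lemma MU_Int:
  assumes "U \<in> MU" "V \<in> MU"
  shows "\<exists>W\<in>MU. elts W = elts U \<inter> elts V"
proof -
  have "openin (top_of \<tau>) (elts U \<inter> elts V)" using assms MU_open by blast
  then obtain W where W: "W \<in> elts \<tau>" "elts W = elts U \<inter> elts V" using openin_iff by auto
  then have "W \<in> elts M" using inter_in[of U V W] assms by (auto simp: MU_def)
  then have "W \<in> MU" using W assms by (auto simp: MU_def)
  then show ?thesis using W(2) by blast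
qed

lemma MU_finite:
  assumes "finite S" "\<And>s. s \<in> S \<Longrightarrow> W s \<in> MU"
  shows "\<exists>U\<in>MU. elts U = elts K \<inter> (\<Inter>s\<in>S. elts (W s))"
  using assms
proof (induction S)
  case empty
  then show ?case using MU_K by auto
next
  case (insert s S)
  then obtain U where U: "U \<in> MU" "elts U = elts K \<inter> (\<Inter>s\<in>S. elts (W s))" by auto
  obtain V where V: "V \<in> MU" "elts V = elts U \<inter> elts (W s)" using MU_Int[OF U(1)] insert.prems by blast
  then show ?case using U(2) by (intro bexI[of _ V]) auto
qed

lemma MU_preimage:
  assumes f: "f \<in> CM K \<tau>" and W: "W \<in> elts (intervals \<rho>)"
  shows "\<exists>U\<in>MU. elts U = {x \<in> elts K. app f x \<in> elts W}"
proof -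
  have fC: "f \<in> Cfun \<rho> K \<tau>" and fM: "f \<in> elts M" using f by auto
  note pair = opair_mem_funs[OF Cfun_funs[OF fC]]
  obtain U where U: "U \<in> elts \<tau>" "\<forall>x\<in>elts K. x \<in> elts U \<longleftrightarrow> (\<exists>y\<in>elts W. opair x y \<in> elts f)"
    using fC W unfolding cont_fun_iff[OF rho K, symmetric] cont_fun_def by blast
  have mem: "x \<in> elts U \<longleftrightarrow> x \<in> elts K \<and> (\<exists>y\<in>elts W. opair x y \<in> elts f)" for x
    using U open_subset_set_space[OF K U(1)] by blast
  have "U \<in> elts M"
    by (rule reflect_set[OF bspec[OF bspec[OF bspec[OF refl_preimage in_M(1)] fM]] mem])
      (use W intervals_in in blast)
  moreover have eq: "elts U = {x \<in> elts K. app f x \<in> elts W}" using mem by (auto simp: pair)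
  moreover have "app f x = app f y" if "agree x y" for x y using that f by (simp add: agree_def)
  ultimately have "U \<in> MU" using U(1) by (auto simp: MU_def)
  then show ?thesis using eq by blast
qed

lemma MU_separate:
  assumes "x \<in> elts K" "z \<in> elts K" "\<not> agree z x"
  shows "\<exists>V\<in>MU. \<exists>W\<in>MU. z \<in> elts V \<and> x \<in> elts W \<and> elts V \<inter> elts W = {}"
proof -
  obtain f where f: "f \<in> CM K \<tau>" "app f z \<noteq> app f x" using assms(3) unfolding agree_def by blast
  have fF: "f \<in> funs (elts K) (range \<rho>)" using f(1) Cfun_funs by blast
  obtain s t where st: "app f z = \<rho> s" "app f x = \<rho> t"
    using funs_app_in[OF fF assms(2)] funs_app_in[OF fF assms(1)] by blast
  then have "s \<noteq> t" using f(2) by auto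
  then obtain S T where ST: "open S" "open T" "s \<in> S" "t \<in> T" "S \<inter> T = {}" using hausdorff by metis
  obtain p q where pq: "p \<in> \<rat>" "q \<in> \<rat>" "s \<in> {p<..<q}" "{p<..<q} \<subseteq> S" using rational_interval ST by metis
  obtain p' q' where pq': "p' \<in> \<rat>" "q' \<in> \<rat>" "t \<in> {p'<..<q'}" "{p'<..<q'} \<subseteq> T"
    using rational_interval ST by metis
  have "interval \<rho> (p, q) \<in> elts (intervals \<rho>)" "interval \<rho> (p', q') \<in> elts (intervals \<rho>)"
    using pq pq' by (auto simp: elts_intervals)
  then obtain V W where V: "V \<in> MU" "elts V = {x \<in> elts K. app f x \<in> \<rho> ` {p<..<q}}"
    and W: "W \<in> MU" "elts W = {x \<in> elts K. app f x \<in> \<rho> ` {p'<..<q'}}"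
    using MU_preimage[OF f(1)] unfolding elts_interval[OF rho, symmetric] by meson
  have "z \<in> elts V" "x \<in> elts W" using V W assms pq pq' st by simp_all
  moreover have "\<rho> ` {p<..<q} \<inter> \<rho> ` {p'<..<q'} = {}"
    using ST(5) pq(4) pq'(4) image_Int[OF rho] by (metis Int_mono image_empty subset_empty)
  then have "elts V \<inter> elts W = {}" using V(2) W(2) by blast
  ultimately show ?thesis using V(1) W(1) by blast
qed

text \<open>The usual separation of a point from a compact set by a finite subcover, carried out
  within \<open>MU\<close>, which is closed under finite intersections.\<close>

lemma MU_compact:
  assumes C: "compactin (top_of \<tau>) C" and x: "x \<in> elts K" and na: "\<And>z. z \<in> C \<Longrightarrow> \<not> agree z x"
  shows "\<exists>U\<in>MU. x \<in> elts U \<and> elts U \<inter> C = {}"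
proof -
  have CK: "C \<subseteq> elts K" using compactin_subset_topspace[OF C] by simp
  have "\<forall>z\<in>C. \<exists>V W. V \<in> MU \<and> W \<in> MU \<and> z \<in> elts V \<and> x \<in> elts W \<and> elts V \<inter> elts W = {}"
    using MU_separate[OF x] na CK by blast
  then obtain V W where VW: "\<And>z. z \<in> C \<Longrightarrow> V z \<in> MU \<and> W z \<in> MU \<and> z \<in> elts (V z) \<and> x \<in> elts (W z) \<and>
      elts (V z) \<inter> elts (W z) = {}"
    by metis
  have "\<exists>\<F>. finite \<F> \<and> \<F> \<subseteq> (\<lambda>z. elts (V z)) ` C \<and> C \<subseteq> \<Union>\<F>"
    using VW MU_open by (intro compactinD[OF C]) auto
  then obtain Z where Z: "finite Z" "Z \<subseteq> C" "C \<subseteq> (\<Union>z\<in>Z. elts (V z))" by (metis finite_subset_image)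
  obtain U where U: "U \<in> MU" "elts U = elts K \<inter> (\<Inter>z\<in>Z. elts (W z))"
    using MU_finite[OF Z(1), of W] VW Z(2) by blast
  have "x \<in> elts U" using U(2) x VW Z(2) by blast
  moreover have "elts U \<inter> C = {}"
  proof (rule ccontr)
    assume "elts U \<inter> C \<noteq> {}"
    then obtain c z where "c \<in> elts U" "z \<in> Z" "c \<in> elts (V z)" using Z(3) by blast
    then show False using U(2) VW[of z] Z(2) by blast
  qed
  ultimately show ?thesis using U(1) by blast
qed

lemma agree_ex:
  assumes "x \<in> elts K"
  shows "\<exists>y\<in>F. agree y x"
proof (rule ccontr)
  assume "\<not> (\<exists>y\<in>F. agree y x)"
  moreover have "compactin (top_of \<tau>) F" using F_closed closedin_compact_space compact by blast
  ultimately obtain U where U: "U \<in> MU" "x \<in> elts U" "elts U \<inter> F = {}" using MU_compact assms by blast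
  \<comment> \<open>Density puts a point of \<open>D\<close> into \<open>U\<close>. Both sets belong
    to \<open>M\<close>, so reflection finds such a point in \<open>M\<close>, and it lies in
    \<open>F\<close>.\<close>
  have "x \<in> top_of \<tau> closure_of elts D" using assms dense by simp
  then have "\<exists>y. y \<in> elts U \<and> y \<in> elts D" using U MU_open unfolding in_closure_of by blast
  moreover have "U \<in> elts M" using U(1) by (simp add: MU_def)
  ultimately obtain d where "d \<in> elts M" "d \<in> elts U" "d \<in> elts D"
    using refl_meet[THEN bspec, THEN bspec, of U D] in_M by blast
  then show False using U(3) DM_F by blast
qed

definition rm where "rm x = (SOME y. y \<in> F \<and> agree y x)"

lemma rm: assumes "x \<in> elts K" shows "rm x \<in> F" "agree (rm x) x"
  using someI_ex[of "\<lambda>y. y \<in> F \<and> agree y x"] agree_ex[OF assms] unfolding rm_def by blast+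

lemma rm_eqI: "x \<in> elts K \<Longrightarrow> y \<in> F \<Longrightarrow> agree y x \<Longrightarrow> rm x = y"
  using rm agree_eq agree_sym agree_trans by blast

definition rM where "rM = fun_graph (elts K) rm"

lemma rM_app: "x \<in> elts K \<Longrightarrow> app rM x = rm x"
  unfolding rM_def by (rule app_fun_graph)

lemma rm_F: "x \<in> F \<Longrightarrow> rm x = x"
  using rm_eqI F_sub agree_refl by blast

lemma rm_image: "rm ` elts K = F"
proof
  show "rm ` elts K \<subseteq> F" using rm by blast
  show "F \<subseteq> rm ` elts K"
  proof
    fix x assume "x \<in> F"
    then have "x = rm x" "x \<in> elts K" using rm_F F_sub by auto
    then show "x \<in> rm ` elts K" by (rule image_eqI)
  qed
qed

lemma rM_funs: "rM \<in> funs (elts K) (elts K)"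
  unfolding rM_def using rm F_sub by (intro fun_graph_funs) blast

text \<open>A member of \<open>MU\<close> that contains \<open>rm x\<close> and misses the compact
  set \<open>F - S\<close> is saturated; so it contains \<open>x\<close> as well, and
  \<open>rm\<close> maps it into \<open>S\<close>.\<close>

lemma rm_continuous: "continuous_map (top_of \<tau>) (top_of \<tau>) rm"
  unfolding continuous_map
proof (intro conjI allI impI)
  show "rm ` topspace (top_of \<tau>) \<subseteq> topspace (top_of \<tau>)" using rm_image F_sub by simp
  fix S assume S: "openin (top_of \<tau>) S"
  show "openin (top_of \<tau>) {x \<in> topspace (top_of \<tau>). rm x \<in> S}"
  proof (subst openin_subopen, intro ballI)
    fix x assume "x \<in> {x \<in> topspace (top_of \<tau>). rm x \<in> S}"
    then have x: "x \<in> elts K" "rm x \<in> S" by auto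
    have "compactin (top_of \<tau>) (F - S)"
      using closedin_diff[OF F_closed S] closedin_compact_space compact by blast
    moreover have "\<not> agree z (rm x)" if "z \<in> F - S" for z
      using agree_eq[of z "rm x"] that x rm(1)[OF x(1)] by blast
    moreover have rx: "rm x \<in> elts K" using rm(1)[OF x(1)] F_sub by blast
    ultimately obtain U where U: "U \<in> MU" "rm x \<in> elts U" "elts U \<inter> (F - S) = {}"
      using MU_compact by blast
    have "x \<in> elts U" using MU_agree[OF U(1) rm(2)[OF x(1)] rx x(1)] U(2) by blast
    moreover have "elts U \<subseteq> {x \<in> topspace (top_of \<tau>). rm x \<in> S}"
    proof
      fix w assume w: "w \<in> elts U"
      then have wK: "w \<in> elts K" using openin_subset[OF MU_open[OF U(1)]] by auto
      have "rm w \<in> elts K" using rm(1)[OF wK] F_sub by blast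
      then have "rm w \<in> elts U" using MU_agree[OF U(1) rm(2)[OF wK]] wK w by blast
      then show "w \<in> {x \<in> topspace (top_of \<tau>). rm x \<in> S}" using U(3) rm(1)[OF wK] wK by auto
    qed
    ultimately show "\<exists>T. openin (top_of \<tau>) T \<and> x \<in> T \<and> T \<subseteq> {x \<in> topspace (top_of \<tau>). rm x \<in> S}"
      using MU_open[OF U(1)] by blast
  qed
qed

lemma rM_image: "app rM ` elts K = F"
  using rm_image by (simp add: rM_app cong: image_cong)

lemma model_retraction_rM: "model_retraction \<rho> M K \<tau> F rM"
  unfolding model_retraction_def retraction_on_def
proof (intro conjI ballI)
  show "continuous_map (top_of \<tau>) (top_of \<tau>) (app rM)"
    using rm_continuous by (rule continuous_map_eq) (simp add: rM_app)
  fix x assume "x \<in> topspace (top_of \<tau>)"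
  then have x: "x \<in> elts K" by simp
  then show "app rM (app rM x) = app rM x" using rm(1)[OF x] rm_F F_sub by (simp add: rM_app subset_eq)
next
  fix f x assume "f \<in> CM K \<tau>" and x: "x \<in> elts K"
  then show "app f x = app f (app rM x)" using rm(2)[OF x] by (simp add: rM_app agree_def)
qed (fact rM_funs rM_image)+

lemma model_retraction_unique:
  assumes "model_retraction \<rho> M K \<tau> F r'"
  shows "r' = rM"
proof (rule funs_eqI)
  show "r' \<in> funs (elts K) (elts K)" using assms by (simp add: model_retraction_def)
  fix x assume x: "x \<in> elts K"
  have "app r' x \<in> F" "agree (app r' x) x"
    using assms x unfolding model_retraction_def agree_def by auto
  then show "app r' x = app rM x" using rm_eqI[OF x] rM_app[OF x] by simp
qed (rule rM_funs)

text \<open>By \<open>separating_determines\<close>, points of \<open>K\<close> with equal values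
  under all functions of \<open>A\<close> in \<open>M\<close> satisfy \<open>agree\<close>.\<close>

lemma rM_characterization:
  assumes A: "elts A \<subseteq> Cfun \<rho> K \<tau>" "A \<in> elts M"
      "\<forall>x\<in>elts K. \<forall>y\<in>elts K. x \<noteq> y \<longrightarrow> (\<exists>f\<in>elts A. app f x \<noteq> app f y)"
    and x: "x \<in> elts K"
  shows "y \<in> F \<and> (\<forall>f\<in>elts A \<inter> elts M. app f y = app f x) \<longleftrightarrow> y = app rM x"
proof
  assume y: "y \<in> F \<and> (\<forall>f\<in>elts A \<inter> elts M. app f y = app f x)"
  then have yK: "y \<in> elts K" using F_sub by blast
  have "app g y = app g x" if "g \<in> CM K \<tau>" for g
    using A y by (intro separating_determines[OF K compact in_M(1) A(1) _ A(2) that yK x]) auto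
  then have "agree y x" by (simp add: agree_def)
  then show "y = app rM x" using rm_eqI[OF x, of y] y rM_app[OF x] by simp
next
  assume "y = app rM x"
  then show "y \<in> F \<and> (\<forall>f\<in>elts A \<inter> elts M. app f y = app f x)"
    using rm[OF x] rM_app[OF x] A(1) unfolding agree_def by auto
qed

text \<open>A point of \<open>F\<close> agrees with no other point of \<open>F\<close>, so
  \<open>MU_compact\<close> separates it from \<open>F - S\<close>, and the traces of
  \<open>MU\<close> form a base of size at most that of \<open>M\<close>.\<close>

lemma weight_F: "weight (subtopology (top_of \<tau>) F) \<le>o |elts M|"
proof -
  let ?B = "(\<lambda>U. elts U \<inter> F) ` MU"
  have "is_base (subtopology (top_of \<tau>) F) ?B"
    unfolding is_base_def
  proof (intro conjI ballI allI impI)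
    fix V assume "V \<in> ?B"
    then show "openin (subtopology (top_of \<tau>) F) V" using MU_open by (auto simp: openin_subtopology)
  next
    fix U x assume Ux: "openin (subtopology (top_of \<tau>) F) U \<and> x \<in> U"
    then obtain S where S: "openin (top_of \<tau>) S" "U = S \<inter> F" by (auto simp: openin_subtopology)
    then have x: "x \<in> F" "x \<in> S" using Ux by auto
    have "compactin (top_of \<tau>) (F - S)"
      using closedin_diff[OF F_closed S(1)] closedin_compact_space compact by blast
    moreover have "\<not> agree z x" if "z \<in> F - S" for z using agree_eq[of z x] that x by blast
    moreover have "x \<in> elts K" using x F_sub by blast
    ultimately obtain W where W: "W \<in> MU" "x \<in> elts W" "elts W \<inter> (F - S) = {}"
      using MU_compact[of "F - S" x] by blast
    have "x \<in> elts W \<inter> F" "elts W \<inter> F \<subseteq> U" using W S(2) x by auto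
    then show "\<exists>V\<in>?B. x \<in> V \<and> V \<subseteq> U" using W(1) by (intro bexI[of _ "elts W \<inter> F"]) simp_all
  qed
  then have "weight (subtopology (top_of \<tau>) F) \<le>o |?B|" by (rule weight_le_base)
  also have "|?B| \<le>o |MU|" by (rule card_of_image)
  also have "|MU| \<le>o |elts M|" by (rule card_of_mono1) (auto simp: MU_def)
  finally show ?thesis .
qed

section \<open>A skeleton that belongs to the model\<close>

context
  fixes \<Gamma> le r
  assumes sk: "skeleton K \<tau> \<Gamma> le r" and Dsub: "elts D \<subseteq> induced_set (top_of \<tau>) (elts \<Gamma>) (app2 r)"
    and in_M': "r \<in> elts M" "\<Gamma> \<in> elts M" "le \<in> elts M"
begin

interpretation ret_skeleton "top_of \<tau>" "elts \<Gamma>" "rel_of le" "app2 r"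
  by unfold_locales (use sk in \<open>simp add: skeleton_def\<close>)

lemma r_funs: "r \<in> funs (elts \<Gamma>) (Cself K \<tau>)"
  using sk by (simp add: skeleton_def)

lemma app_r: assumes "s \<in> elts \<Gamma>"
  shows "app r s \<in> funs (elts K) (elts K)" "continuous_map (top_of \<tau>) (top_of \<tau>) (app (app r s))"
  using funs_app_in[OF r_funs assms] by (simp_all add: Cself_def)

lemma app_r_in: "s \<in> elts \<Gamma> \<Longrightarrow> s \<in> elts M \<Longrightarrow> app r s \<in> elts M"
  using app_in[OF r_funs in_M'(1)] .

text \<open>The image lies in the closure of a countable part of \<open>D\<close>. Such a part can
  be found in \<open>M\<close>, since \<open>app r s\<close> belongs to \<open>M\<close>, and being
  enumerated there it is contained in \<open>M\<close>.\<close>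

lemma image_sub_F:
  assumes s: "s \<in> elts \<Gamma> \<inter> elts M"
  shows "app2 r s ` elts K \<subseteq> F"
proof -
  have s': "s \<in> elts \<Gamma>" "s \<in> elts M" using s by auto
  note q = app_r(1)[OF s'(1)]
  note pair = opair_mem_funs[OF q]
  have "\<exists>C\<subseteq>elts D. countable C \<and> app2 r s ` topspace (top_of \<tau>) \<subseteq> top_of \<tau> closure_of C"
    using image_subset_countable_closure[OF s'(1) Dsub] dense by simp
  then obtain C where C: "C \<subseteq> elts D" "countable C" "app2 r s ` elts K \<subseteq> top_of \<tau> closure_of C" by auto
  define c where "c = set_of C"
  have c: "elts c = C" unfolding c_def by (rule elts_set_of_small[OF small_countable[OF C(2)]])
  have ad: "adherent \<tau> u u y \<longleftrightarrow> y \<in> top_of \<tau> closure_of elts u" if "y \<in> elts K" for u y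
    using adherent_iff[OF K that, of u u] by simp
  have y: "x \<in> elts K \<and> y \<in> elts K \<and> y = app2 r s x" if "opair x y \<in> elts (app r s)" for x y
    using that funs_app_in[OF q] by (auto simp: pair app2_def)
  have "elts c \<subseteq> elts D \<and> (\<exists>e. enumerates (nats \<rho>) e c) \<and>
      (\<forall>x\<in>elts K. \<forall>y. opair x y \<in> elts (app r s) \<longrightarrow> adherent \<tau> c c y)"
  proof (intro conjI ballI allI impI)
    show "elts c \<subseteq> elts D" using C(1) c by simp
    show "\<exists>e. enumerates (nats \<rho>) e c" using enumerates_nats[OF rho] C(2) c by simp
    fix x y' assume "opair x y' \<in> elts (app r s)"
    from y[OF this] show "adherent \<tau> c c y'" using C(3) ad[of y' c] c by auto
  qed
  then obtain d where d: "d \<in> elts M" "elts d \<subseteq> elts D" "\<exists>e. enumerates (nats \<rho>) e d"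
      "\<forall>x\<in>elts K. \<forall>y. opair x y \<in> elts (app r s) \<longrightarrow> adherent \<tau> d d y"
    using refl_dense[rule_format, OF in_M(2,1,3) app_r_in[OF s'] nats_in(1)] by blast
  have "elts d \<subseteq> elts D \<inter> elts M" using d(2) enumerated_subset[OF d(1,3)] by blast
  then have dF: "top_of \<tau> closure_of elts d \<subseteq> F" unfolding F_def by (rule closure_of_mono)
  show ?thesis
  proof
    fix z assume "z \<in> app2 r s ` elts K"
    then obtain x where x: "x \<in> elts K" "z = app2 r s x" by blast
    then have "opair x z \<in> elts (app r s)" by (simp add: pair app2_def)
    then show "z \<in> F" using d(4) x(1) y ad[of z d] dF by blast
  qed
qed

lemma D_index:
  assumes d: "d \<in> elts D \<inter> elts M"
  shows "\<exists>s\<in>elts \<Gamma> \<inter> elts M. d \<in> app2 r s ` elts K"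
proof -
  have mem: "(\<exists>q x. opair s q \<in> elts r \<and> opair x d \<in> elts q) \<longleftrightarrow> d \<in> app2 r s ` elts K" if s: "s \<in> elts \<Gamma>" for s
    using s by (auto simp: opair_mem_funs[OF r_funs] opair_mem_funs[OF app_r(1)[OF s]] app2_def)
  obtain s where "s \<in> elts \<Gamma>" "d \<in> app2 r s ` elts K" using d Dsub by (auto simp: induced_set_def)
  then have "\<exists>s. s \<in> elts \<Gamma> \<and> (\<exists>q x. opair s q \<in> elts r \<and> opair x d \<in> elts q)" using mem by blast
  then obtain s' where "s' \<in> elts M" "s' \<in> elts \<Gamma>" "\<exists>q x. opair s' q \<in> elts r \<and> opair x d \<in> elts q"
    using refl_index[THEN bspec, OF in_M'(2), THEN bspec, OF in_M'(1), THEN bspec, of d] d by blast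
  then show ?thesis using mem by blast
qed

lemma model_directed: "up_directed (elts \<Gamma> \<inter> elts M) (rel_of le)"
  unfolding up_directed_def
proof (intro conjI ballI)
  have "\<exists>s. s \<in> elts \<Gamma> \<and> s \<in> elts \<Gamma>" using up_directed_nonempty[OF directed] by blast
  then show "elts \<Gamma> \<inter> elts M \<noteq> {}"
    using refl_meet[THEN bspec, OF in_M'(2), THEN bspec, OF in_M'(2)] by blast
  fix s t assume st: "s \<in> elts \<Gamma> \<inter> elts M" "t \<in> elts \<Gamma> \<inter> elts M"
  then obtain u where "u \<in> elts \<Gamma>" "(s, u) \<in> rel_of le" "(t, u) \<in> rel_of le"
    using up_directed_bound[OF directed, of s t] by blast
  then have "\<exists>u. u \<in> elts \<Gamma> \<and> opair s u \<in> elts le \<and> opair t u \<in> elts le" by (auto simp: rel_of_def)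
  then obtain u where "u \<in> elts M" "u \<in> elts \<Gamma>" "opair s u \<in> elts le" "opair t u \<in> elts le"
    using refl_bound[THEN bspec, OF in_M'(2), THEN bspec, OF in_M'(3), THEN bspec, THEN bspec, of s t] st
    by blast
  then show "\<exists>u\<in>elts \<Gamma> \<inter> elts M. (s, u) \<in> rel_of le \<and> (t, u) \<in> rel_of le" by (auto simp: rel_of_def)
qed

text \<open>In this form the results on directed sets of indices apply to the indices that belong to
  \<open>M\<close>.\<close>

lemma F_eq: "F = top_of \<tau> closure_of (\<Union>s\<in>elts \<Gamma> \<inter> elts M. app2 r s ` topspace (top_of \<tau>))"
proof
  have "elts D \<inter> elts M \<subseteq> (\<Union>s\<in>elts \<Gamma> \<inter> elts M. app2 r s ` topspace (top_of \<tau>))"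
    using D_index by auto
  then show "F \<subseteq> top_of \<tau> closure_of (\<Union>s\<in>elts \<Gamma> \<inter> elts M. app2 r s ` topspace (top_of \<tau>))"
    unfolding F_def by (rule closure_of_mono)
  show "top_of \<tau> closure_of (\<Union>s\<in>elts \<Gamma> \<inter> elts M. app2 r s ` topspace (top_of \<tau>)) \<subseteq> F"
    using image_sub_F F_closed by (intro closure_of_minimal) auto
qed

text \<open>Functions in \<open>CM K \<tau>\<close> stay there when composed with a retraction
  indexed in \<open>M\<close>, so such retractions preserve \<open>agree\<close>. The images of
  \<open>x\<close> and of \<open>app rM x\<close> therefore agree, and since both lie in
  \<open>F\<close> they coincide, as \<open>net_limit_directed\<close> requires.\<close>

lemma rM_limit:
  assumes x: "x \<in> elts K"
  shows "net_limit (top_of \<tau>) (elts \<Gamma> \<inter> elts M) (rel_of le) (\<lambda>s. app2 r s x) (app rM x)"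
proof (rule net_limit_directed)
  show "elts \<Gamma> \<inter> elts M \<subseteq> elts \<Gamma>" by blast
  show "up_directed (elts \<Gamma> \<inter> elts M) (rel_of le)" by (rule model_directed)
  show "x \<in> topspace (top_of \<tau>)" using x by simp
  show "app rM x \<in> top_of \<tau> closure_of (\<Union>s\<in>elts \<Gamma> \<inter> elts M. app2 r s ` topspace (top_of \<tau>))"
    using rm(1)[OF x] rM_app[OF x] F_eq by simp
  fix s assume s: "s \<in> elts \<Gamma> \<inter> elts M"
  then have s': "s \<in> elts \<Gamma>" "s \<in> elts M" by auto
  have y: "app rM x \<in> elts K" using rm(1)[OF x] rM_app[OF x] F_sub by auto
  have "agree (app2 r s (app rM x)) (app2 r s x)"
    unfolding agree_def
  proof
    fix g assume "g \<in> CM K \<tau>"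
    then obtain h where h: "h \<in> CM K \<tau>" "\<forall>x\<in>elts K. app h x = app g (app (app r s) x)"
      using comp_CM[OF K in_M(1) K app_r(1)[OF s'(1)] app_r_in[OF s'] app_r(2)[OF s'(1)]] by blast
    have "app h (app rM x) = app h x" using rm(2)[OF x] h(1) rM_app[OF x] by (simp add: agree_def)
    then show "app g (app2 r s (app rM x)) = app g (app2 r s x)" using h(2) x y by (simp add: app2_def)
  qed
  then show "app2 r s (app rM x) = app2 r s x"
    using agree_eq image_sub_F[OF s] x y by blast
qed

lemma rM_countable:
  assumes "countable (elts M)"
  shows "\<exists>s. is_sup (elts \<Gamma>) (rel_of le) (elts \<Gamma> \<inter> elts M) s \<and> rM = app r s"
proof -
  have "countable (elts \<Gamma> \<inter> elts M)" using assms by simp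
  from sup_countable_directed[OF Int_lower1 model_directed this]
  obtain s where s: "is_sup (elts \<Gamma>) (rel_of le) (elts \<Gamma> \<inter> elts M) s"
    "\<And>x y. x \<in> topspace (top_of \<tau>) \<Longrightarrow>
      net_limit (top_of \<tau>) (elts \<Gamma> \<inter> elts M) (rel_of le) (\<lambda>s. app2 r s x) y \<Longrightarrow> app2 r s x = y"
    by blast
  have "s \<in> elts \<Gamma>" using s(1) by (simp add: is_sup_def)
  moreover have "app rM x = app (app r s) x" if "x \<in> elts K" for x
    using s(2)[OF _ rM_limit[OF that]] that by (simp add: app2_def)
  ultimately have "rM = app r s" by (intro funs_eqI[OF rM_funs app_r(1)])
  then show ?thesis using s(1) by blast
qed

lemma skeleton_F:
  "retractional_skeleton (subtopology (top_of \<tau>) F) (sigma_closure (elts \<Gamma>) (rel_of le) (elts \<Gamma> \<inter> elts M))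
    (Restr (rel_of le) (sigma_closure (elts \<Gamma>) (rel_of le) (elts \<Gamma> \<inter> elts M))) (app2 r)"
  "induced_set (subtopology (top_of \<tau>) F) (sigma_closure (elts \<Gamma>) (rel_of le) (elts \<Gamma> \<inter> elts M)) (app2 r) =
    induced_set (top_of \<tau>) (elts \<Gamma>) (app2 r) \<inter> F"
  using sigma_closure_skeleton[OF Int_lower1 model_directed, folded F_eq] by blast+

lemma rM_commutative:
  assumes "commutative_skeleton (top_of \<tau>) (elts \<Gamma>) (app2 r)"
  shows "app rM ` induced_set (top_of \<tau>) (elts \<Gamma>) (app2 r) = induced_set (top_of \<tau>) (elts \<Gamma>) (app2 r) \<inter> F"
proof
  let ?D = "induced_set (top_of \<tau>) (elts \<Gamma>) (app2 r)"
  have DK': "?D \<subseteq> elts K" using image_sub by (auto simp: induced_set_def)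
  show "app rM ` ?D \<subseteq> ?D \<inter> F"
  proof
    fix y assume "y \<in> app rM ` ?D"
    then obtain x where x: "x \<in> ?D" "y = app rM x" by blast
    then have xK: "x \<in> elts K" using DK' by blast
    show "y \<in> ?D \<inter> F"
      using commutative_net_limit_induced[OF Int_lower1 model_directed assms x(1) rM_limit[OF xK]]
        x(2) rm(1)[OF xK] rM_app[OF xK] by simp
  qed
  show "?D \<inter> F \<subseteq> app rM ` ?D"
  proof
    fix y assume y: "y \<in> ?D \<inter> F"
    then have "app rM y = y" using rM_app rm_F DK' by (metis IntE subsetD)
    then show "y \<in> app rM ` ?D" using y by (metis IntE imageI)
  qed
qed

end

section \<open>Transport along a homeomorphism that belongs to the model\<close>

context
  fixes L \<sigma> h
  assumes L: "set_space L \<sigma>" and h: "h \<in> funs (elts K) (elts L)" "homeomorphic_map (top_of \<tau>) (top_of \<sigma>) (app h)"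
    and hM: "h \<in> elts M"
begin

text \<open>By reflection a point of \<open>M\<close> in the image of \<open>D\<close> has a
  preimage in both \<open>D\<close> and \<open>M\<close>, so intersecting with \<open>M\<close>
  commutes with \<open>h\<close> on \<open>D\<close>.\<close>

lemma homeo_closure: "top_of \<sigma> closure_of ((app h ` elts D) \<inter> elts M) = app h ` F"
proof -
  have "(app h ` elts D) \<inter> elts M = app h ` (elts D \<inter> elts M)"
  proof
    show "(app h ` elts D) \<inter> elts M \<subseteq> app h ` (elts D \<inter> elts M)"
    proof
      fix y assume y: "y \<in> app h ` elts D \<inter> elts M"
      then have "\<exists>d. d \<in> elts D \<and> opair d y \<in> elts h" using DK by (auto simp: opair_mem_funs[OF h(1)])
      then obtain d where "d \<in> elts M" "d \<in> elts D" "opair d y \<in> elts h"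
        using refl_vimage[THEN bspec, OF in_M(2), THEN bspec, OF hM, THEN bspec, of y] y by blast
      then show "y \<in> app h ` (elts D \<inter> elts M)" by (auto simp: opair_mem_funs[OF h(1)])
    qed
    show "app h ` (elts D \<inter> elts M) \<subseteq> (app h ` elts D) \<inter> elts M"
      using app_in[OF h(1) hM] DK by blast
  qed
  moreover have "elts D \<inter> elts M \<subseteq> topspace (top_of \<tau>)" using DK by auto
  ultimately show ?thesis unfolding F_def using homeomorphic_map_closure_of[OF h(2)] by simp
qed

lemma homeo_retraction:
  fixes r
  defines "r \<equiv> fun_graph (elts L) (\<lambda>y. app h (app rM (inv_into (elts K) (app h) y)))"
  shows "model_retraction \<rho> M L \<sigma> (app h ` F) r"
    and "\<And>r'. model_retraction \<rho> M L \<sigma> (app h ` F) r' \<Longrightarrow> r' = r"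
proof -
  note tY = topspace_set_space[OF L]
  let ?p = "inv_into (elts K) (app h)"
  obtain p where p: "continuous_map (top_of \<sigma>) (top_of \<tau>) p" "\<And>x. x \<in> elts K \<Longrightarrow> p (app h x) = x"
      "\<And>y. y \<in> elts L \<Longrightarrow> app h (p y) = y"
    using h(2) unfolding homeomorphic_map_maps homeomorphic_maps_def tX tY by blast
  have hc: "continuous_map (top_of \<tau>) (top_of \<sigma>) (app h)" using h(2) homeomorphic_imp_continuous_map by blast
  have hL: "app h x \<in> elts L" if "x \<in> elts K" for x using funs_app_in[OF h(1) that] .
  have pK: "p y \<in> elts K" if "y \<in> elts L" for y
    using continuous_map_image_subset_topspace[OF p(1)] that tX tY by blast
  have inj: "inj_on (app h) (elts K)" using p(2) by (metis inj_onI)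
  have pp: "?p y = p y" if "y \<in> elts L" for y
    using inv_into_f_f[OF inj pK[OF that]] p(3)[OF that] by simp
  have r: "app r y = app h (rm (p y))" if "y \<in> elts L" for y
    unfolding r_def using that by (simp add: app_fun_graph pp rM_app pK)
  have rmK: "rm x \<in> elts K" if "x \<in> elts K" for x using rm(1)[OF that] F_sub by blast
  have rL: "app r y \<in> elts L" if "y \<in> elts L" for y using r[OF that] hL rmK pK that by simp
  have rF: "r \<in> funs (elts L) (elts L)"
    unfolding r_def using hL rmK pK by (intro fun_graph_funs) (simp add: pp rM_app)
  have rrm: "rm (rm x) = rm x" if "x \<in> elts K" for x using rm_F rm(1)[OF that] .
  have mr: "model_retraction \<rho> M L \<sigma> (app h ` F) r"
    unfolding model_retraction_def retraction_on_def
  proof (intro conjI ballI)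
    have "continuous_map (top_of \<sigma>) (top_of \<sigma>) (app h \<circ> (rm \<circ> p))"
      by (intro continuous_map_compose[OF _ hc] continuous_map_compose[OF p(1) rm_continuous])
    then show "continuous_map (top_of \<sigma>) (top_of \<sigma>) (app r)"
      by (rule continuous_map_eq) (simp add: tY r)
    fix y assume "y \<in> topspace (top_of \<sigma>)"
    then have y: "y \<in> elts L" using tY by simp
    show "app r (app r y) = app r y"
      using r[OF rL[OF y]] r[OF y] p(2)[OF rmK[OF pK[OF y]]] rrm[OF pK[OF y]] by simp
  next
    have "app r ` elts L = app h ` rm ` p ` elts L" by (simp add: r image_image cong: image_cong)
    also have "p ` elts L = elts K"
    proof
      show "elts K \<subseteq> p ` elts L"
      proof
        fix x assume "x \<in> elts K"
        then have "x = p (app h x)" "app h x \<in> elts L" using p(2) hL by auto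
        then show "x \<in> p ` elts L" by (rule image_eqI)
      qed
    qed (use pK in blast)
    finally show "app r ` elts L = app h ` F" by (simp add: rm_image)
  next
    fix f y assume f: "f \<in> CM L \<sigma>" and y: "y \<in> elts L"
    obtain g where g: "g \<in> CM K \<tau>" "\<forall>x\<in>elts K. app g x = app f (app h x)"
      using comp_CM[OF K in_M(1) L h(1) hM hc f] by blast
    have "app g (rm (p y)) = app g (p y)" using rm(2)[OF pK[OF y]] g(1) by (simp add: agree_def)
    then show "app f y = app f (app r y)"
      using g(2) pK[OF y] rmK[OF pK[OF y]] r[OF y] p(3)[OF y] by simp
  qed (fact rF)
  show "model_retraction \<rho> M L \<sigma> (app h ` F) r" by (fact mr)
  fix r' assume r': "model_retraction \<rho> M L \<sigma> (app h ` F) r'"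
  show "r' = r"
  proof (rule funs_eqI[OF _ rF])
    show "r' \<in> funs (elts L) (elts L)" using r' by (simp add: model_retraction_def)
    fix y assume y: "y \<in> elts L"
    then have "app r' y \<in> app h ` F" "app r y \<in> app h ` F" using r' mr unfolding model_retraction_def by blast+
    then obtain a b where ab: "a \<in> F" "b \<in> F" "app r' y = app h a" "app r y = app h b" by blast
    have "agree a b"
      unfolding agree_def
    proof
      fix g assume "g \<in> CM K \<tau>"
      then obtain k where k: "k \<in> CM L \<sigma>" "\<forall>x\<in>elts K. app k (app h x) = app g x"
        using push_CM[OF K in_M(1) L h(1) hM h(2)] by blast
      have "app k (app r' y) = app k y" "app k (app r y) = app k y"
        using r' mr k(1) y unfolding model_retraction_def by simp_all
      moreover have "a \<in> elts K" "b \<in> elts K" using ab F_sub by blast+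
      ultimately show "app g a = app g b" using ab(3,4) k(2) by metis
    qed
    then have "a = b" using ab(1,2) by (intro agree_eq)
    then show "app r' y = app r y" using ab by simp
  qed
qed

end

end

theorem theorem15:
  fixes \<rho> :: "real \<Rightarrow> 'v::set_universe"
  assumes "inj \<rho>"
  shows "for_every_suitable_model (\<lambda>M.
    \<forall>K \<tau> D. set_space K \<tau> \<and> compact_space (top_of \<tau>) \<and>
      elts D \<subseteq> elts K \<and> top_of \<tau> closure_of elts D = elts K \<and>
      (\<exists>\<Gamma> le r. skeleton K \<tau> \<Gamma> le r \<and> elts D \<subseteq> induced_set (top_of \<tau>) (elts \<Gamma>) (app2 r)) \<and>
      {K, D, \<tau>} \<subseteq> elts M \<longrightarrow>
    (let X = top_of \<tau>; F = X closure_of (elts D \<inter> elts M) in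
     \<exists>rM. model_retraction \<rho> M K \<tau> F rM \<and>
      (\<forall>r'. model_retraction \<rho> M K \<tau> F r' \<longrightarrow> r' = rM) \<and>
      \<comment> \<open>(i)\<close>
      (\<forall>A. elts A \<subseteq> Cfun \<rho> K \<tau> \<and> A \<in> elts M \<and>
          (\<forall>x\<in>elts K. \<forall>y\<in>elts K. x \<noteq> y \<longrightarrow> (\<exists>f\<in>elts A. app f x \<noteq> app f y)) \<longrightarrow>
        (\<forall>x\<in>elts K. \<forall>y.
          y \<in> F \<and> (\<forall>f \<in> elts A \<inter> elts M. app f y = app f x) \<longleftrightarrow> y = app rM x)) \<and>
      \<comment> \<open>(ii)\<close>
      (\<forall>\<Gamma> le r. skeleton K \<tau> \<Gamma> le r \<and>
          elts D \<subseteq> induced_set X (elts \<Gamma>) (app2 r) \<and> {r, \<Gamma>, le} \<subseteq> elts M \<longrightarrow>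
        (let I = elts \<Gamma> \<inter> elts M; J = sigma_closure (elts \<Gamma>) (rel_of le) I;
             Ds = induced_set X (elts \<Gamma>) (app2 r); R = app rM ` elts K in
         (\<forall>s\<in>I. app2 r s ` elts K \<subseteq> F) \<and>
         (\<forall>x\<in>elts K. net_limit X I (rel_of le) (\<lambda>s. app2 r s x) (app rM x)) \<and>
         (countable (elts M) \<longrightarrow> (\<exists>s. is_sup (elts \<Gamma>) (rel_of le) I s \<and> rM = app r s)) \<and>
         (retractional_skeleton (subtopology X R) J (Restr (rel_of le) J) (app2 r) \<and>
          induced_set (subtopology X R) J (app2 r) = Ds \<inter> R) \<and>
         (commutative_skeleton X (elts \<Gamma>) (app2 r) \<longrightarrow> app rM ` Ds = Ds \<inter> R))) \<and>
      \<comment> \<open>(iii)\<close>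
      (\<forall>L \<sigma> h. set_space L \<sigma> \<and> h \<in> funs (elts K) (elts L) \<and> homeomorphic_map X (top_of \<sigma>) (app h) \<and>
          h \<in> elts M \<longrightarrow>
        (let r = fun_graph (elts L) (\<lambda>y. app h (app rM (inv_into (elts K) (app h) y)));
             FL = top_of \<sigma> closure_of ((app h ` elts D) \<inter> elts M) in
         model_retraction \<rho> M L \<sigma> FL r \<and>
         (\<forall>r'. model_retraction \<rho> M L \<sigma> FL r' \<longrightarrow> r' = r))) \<and>
      \<comment> \<open>(iv)\<close>
      weight (subtopology X (app rM ` elts K)) \<le>o |elts M| ))"
proof (rule for_every_suitable_mono[OF for_every_suitable_suitable_model[OF assms]], intro allI impI, goal_cases)
  case (1 M K \<tau> D)
  interpret model_space \<rho> M K \<tau> D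
    by (rule model_space.intro[OF 1(1)], unfold_locales) (use 1(2) in auto)
  show ?case
    unfolding Let_def F_def[symmetric]
  \<comment> \<open>Rewriting with \<open>rM_image\<close> turns the image of the retraction into
    \<open>F\<close>, the form in which the clauses about that image were proved.\<close>
  proof (rule exI[of _ rM], unfold rM_image, intro conjI allI impI ballI, goal_cases)
    case 1
    show ?case by (rule model_retraction_rM)
  next
    case (2 r')
    then show ?case by (rule model_retraction_unique)
  next
    case (3 A x y)
    then show ?case using rM_characterization[of A x y] by simp
  next
    case (4 \<Gamma> le r s)
    then show ?case using image_sub_F[of \<Gamma> le r s] by simp
  next
    case (5 \<Gamma> le r x)
    then show ?case using rM_limit[of \<Gamma> le r x] by simp
  next
    case (6 \<Gamma> le r)
    then show ?case using rM_countable[of \<Gamma> le r] by simp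
  next
    case (7 \<Gamma> le r)
    then show ?case using skeleton_F(1)[of \<Gamma> le r] by simp
  next
    case (8 \<Gamma> le r)
    then show ?case using skeleton_F(2)[of \<Gamma> le r] by simp
  next
    case (9 \<Gamma> le r)
    then show ?case using rM_commutative[of \<Gamma> le r] by simp
  next
    case (10 L \<sigma> h)
    then show ?case using homeo_retraction(1)[of L \<sigma> h] homeo_closure[of L \<sigma> h] by simp
  next
    case (11 L \<sigma> h r')
    then show ?case using homeo_retraction(2)[of L \<sigma> h r'] homeo_closure[of L \<sigma> h] by simp
  next
    case 12
    show ?case by (rule weight_F)
  qed
qed

end
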